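(* Let $G$ be a finite group, let $n\geqslant 2$, and let $$w=\sum_{1\leqslant i<j\leqslant n}\mathsf a_{ij}(ij)+\sum_{g\in G^n}\mathsf c_g\,g\in\mathbb R[W_n(G)],\qquad \mathsf a_{ij}\geqslant 0,\quad \mathsf c_g=\mathsf c_{g^{-1}}\geqslant 0 .$$ Then $$\psi_{W_n(G)}(w)=\psi_{W_n(G)}\bigl(w,\mathrm{Std}_n\oplus\mathcal P_n^0(G)\bigr).$$
   Context: $\mathfrak S_n$ is the symmetric group. $W_n(G)=G\wr\mathfrak S_n=G^n\rtimes\mathfrak S_n$ has multiplication $(g;\pi)(h;\sigma)=(g(\pi\cdot h);\pi\sigma)$, where $\pi\cdot g=(g_{\pi^{-1}(1)},\dots,g_{\pi^{-1}(n)})$ for $g=(g_1,\dots,g_n)\in G^n$. Both $G^n$ and $\mathfrak S_n$ are regarded as subgroups of $W_n(G)$, and $(ij)$ denotes the transposition in $\mathfrak S_n\leqslant W_n(G)$. All representations are finite-dimensional, complex and unitary. For a finite group $H$ and $w=\sum_{h\in H}\mathsf c_h h\in\mathbb R[H]$ with $\mathsf c_h=\mathsf c_{h^{-1}}\geqslant 0$, put $\Delta_H(w)=\sum_{h\in H}\mathsf c_h(1_H-h)$. It acts as a positive semidefinite self-adjoint operator in every unitary representation. For a representation $V$ of $H$ with $H$-fixed subspace $V^H$, the spectral gap $\psi_H(w,V)$ is the smallest eigenvalue of $\Delta_H(w)$ acting on $(V^H)^\perp$, with $\psi_H(w,V)=+\infty$ if $V=V^H$. Put $\psi_H(w)=\psi_H(w,\mathrm{Reg}_H)$,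 where $\mathrm{Reg}_H$ is the regular representation. $\mathrm{Std}_n$ is the irreducible $(n-1)$-dimensional representation of $\mathfrak S_n$ of shape $(n-1,1)$, lifted to $W_n(G)$ through the quotient map $W_n(G)\to\mathfrak S_n$ (so $G^n$ acts trivially). $\mathcal P_n(G)=\mathrm{Ind}_{\mathfrak S_n}^{W_n(G)}\mathrm{triv}\cong\mathbb C[W_n(G)/\mathfrak S_n]$ is the quasi-regular representation, and $\mathcal P_n^0(G)$ is the orthogonal complement in it of its one-dimensional fixed subspace (the constant vectors). *)

theory Defs
  imports
    "HOL-Algebra.Sym_Groups"
    "HOL-Algebra.Product_Groups"
    "HOL-Algebra.Left_Coset"
    "HOL-Combinatorics.Transposition"
    "HOL-Library.Poly_Mapping"
    "HOL-Library.Function_Algebras"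
    "HOL-Library.Product_Plus"
    "HOL-Library.Extended_Real"
begin

section \<open>Wreath products with symmetric groups\<close>

abbreviation power_group :: "('a, 'b) monoid_scheme \<Rightarrow> nat \<Rightarrow> (nat \<Rightarrow> 'a) monoid"
  where "power_group G n \<equiv> product_group {1..n} (\<lambda>_. G)"

type_synonym 'a wreath_elt = "(nat \<Rightarrow> 'a) \<times> (nat \<Rightarrow> nat)"

definition permute_tuple :: "nat \<Rightarrow> (nat \<Rightarrow> nat) \<Rightarrow> (nat \<Rightarrow> 'a) \<Rightarrow> (nat \<Rightarrow> 'a)"
  where "permute_tuple n \<pi> g = (\<lambda>i\<in>{1..n}. g (inv' \<pi> i))"

definition wreath :: "('a, 'b) monoid_scheme \<Rightarrow> nat \<Rightarrow> 'a wreath_elt monoid"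
  where "wreath G n =
    \<lparr> carrier = carrier (power_group G n) \<times> carrier (sym_group n),
      mult = (\<lambda>(g, \<pi>) (h, \<sigma>).
        (g \<otimes>\<^bsub>power_group G n\<^esub> permute_tuple n \<pi> h, \<pi> \<otimes>\<^bsub>sym_group n\<^esub> \<sigma>)),
      one = (\<one>\<^bsub>power_group G n\<^esub>, \<one>\<^bsub>sym_group n\<^esub>) \<rparr>"

definition base_emb :: "nat \<Rightarrow> (nat \<Rightarrow> 'a) \<Rightarrow> 'a wreath_elt"
  where "base_emb n g = (g, \<one>\<^bsub>sym_group n\<^esub>)"

definition sym_emb ::
    "('a, 'b) monoid_scheme \<Rightarrow> nat \<Rightarrow> (nat \<Rightarrow> nat) \<Rightarrow> 'a wreath_elt"
  where "sym_emb G n \<pi> = (\<one>\<^bsub>power_group G n\<^esub>, \<pi>)"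

section \<open>Finite-dimensional unitary representations\<close>

text \<open>The underlying Hermitian space is the subset \<open>vecs\<close> of an ambient additive group,
  which is made a complex vector space by \<open>scl\<close>.  The form \<open>ip\<close> is linear in its first
  argument.  The values of \<open>ip\<close> and \<open>act\<close> outside \<open>vecs\<close> are irrelevant.\<close>

record ('g, 'v) rep =
  vecs :: "'v set"
  scl :: "complex \<Rightarrow> 'v \<Rightarrow> 'v"
  ip :: "'v \<Rightarrow> 'v \<Rightarrow> complex"
  act :: "'g \<Rightarrow> 'v \<Rightarrow> 'v"

locale unitary_rep = group H + vector_space "scl V"
  for H :: "('g, 'm) monoid_scheme" (structure) and V :: "('g, 'v :: ab_group_add) rep" +
  assumes finite_group: "finite (carrier H)"
    and subspace_vecs: "subspace (vecs V)"
    and finite_dim: "\<exists>B. finite B \<and> vecs V \<subseteq> span B"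
    and ip_add: "\<lbrakk>u \<in> vecs V; v \<in> vecs V; x \<in> vecs V\<rbrakk> \<Longrightarrow> ip V (u + v) x = ip V u x + ip V v x"
    and ip_scl: "\<lbrakk>u \<in> vecs V; v \<in> vecs V\<rbrakk> \<Longrightarrow> ip V (scl V c u) v = c * ip V u v"
    and ip_cnj: "\<lbrakk>u \<in> vecs V; v \<in> vecs V\<rbrakk> \<Longrightarrow> ip V v u = cnj (ip V u v)"
    and ip_pos: "\<lbrakk>u \<in> vecs V; u \<noteq> 0\<rbrakk> \<Longrightarrow> 0 < Re (ip V u u)"
    and act_closed: "\<lbrakk>h \<in> carrier H; u \<in> vecs V\<rbrakk> \<Longrightarrow> act V h u \<in> vecs V"
    and act_add: "\<lbrakk>h \<in> carrier H; u \<in> vecs V; v \<in> vecs V\<rbrakk>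
      \<Longrightarrow> act V h (u + v) = act V h u + act V h v"
    and act_scl: "\<lbrakk>h \<in> carrier H; u \<in> vecs V\<rbrakk> \<Longrightarrow> act V h (scl V c u) = scl V c (act V h u)"
    and act_one: "u \<in> vecs V \<Longrightarrow> act V \<one> u = u"
    and act_mult: "\<lbrakk>g \<in> carrier H; h \<in> carrier H; u \<in> vecs V\<rbrakk>
      \<Longrightarrow> act V (g \<otimes> h) u = act V g (act V h u)"
    and act_unitary: "\<lbrakk>h \<in> carrier H; u \<in> vecs V; v \<in> vecs V\<rbrakk>
      \<Longrightarrow> ip V (act V h u) (act V h v) = ip V u v"

definition fixed_space :: "('g, 'm) monoid_scheme \<Rightarrow> ('g, 'v) rep \<Rightarrow> 'v set"
  where "fixed_space H V = {v \<in> vecs V. \<forall>h\<in>carrier H. act V h v = v}"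

definition orth_compl :: "('g, 'v) rep \<Rightarrow> 'v set \<Rightarrow> 'v set"
  where "orth_compl V U = {v \<in> vecs V. \<forall>u\<in>U. ip V v u = 0}"

subsection \<open>Laplacian and spectral gap\<close>

definition laplacian ::
    "('g, 'm) monoid_scheme \<Rightarrow> ('g \<Rightarrow>\<^sub>0 real) \<Rightarrow> ('g, 'v :: ab_group_add) rep \<Rightarrow> 'v \<Rightarrow> 'v"
  where "laplacian H w V v =
    (\<Sum>h\<in>carrier H. scl V (complex_of_real (Poly_Mapping.lookup w h)) (v - act V h v))"

text \<open>Only real eigenvalues are collected: the Laplacian is self-adjoint whenever the
  coefficients of \<open>w\<close> are invariant under inversion.\<close>

definition spectral_gap ::
    "('g, 'm) monoid_scheme \<Rightarrow> ('g \<Rightarrow>\<^sub>0 real) \<Rightarrow> ('g, 'v :: ab_group_add) rep \<Rightarrow> ereal"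
  where "spectral_gap H w V =
    (if vecs V = fixed_space H V then \<infinity>
     else ereal (Min {r. \<exists>v\<in>orth_compl V (fixed_space H V).
       v \<noteq> 0 \<and> laplacian H w V v = scl V (complex_of_real r) v}))"

subsection \<open>Constructions\<close>

text \<open>The permutation representation on \<open>\<complex>[X]\<close>, with \<open>X\<close> as orthonormal basis, of an action
  \<open>\<phi>\<close> of \<open>H\<close> on a finite set \<open>X\<close>.  The vector \<open>\<Sum>x\<in>X. f x \<cdot> x\<close> is encoded by its coefficient
  function \<open>f\<close>, extended by 0 outside \<open>X\<close>; hence the inverse in the action.\<close>

definition perm_rep ::
    "('g, 'm) monoid_scheme \<Rightarrow> 'x set \<Rightarrow> ('g \<Rightarrow> 'x \<Rightarrow> 'x) \<Rightarrow> ('g, 'x \<Rightarrow> complex) rep"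
  where "perm_rep H X \<phi> =
    \<lparr> vecs = {f. \<forall>x. x \<notin> X \<longrightarrow> f x = 0},
      scl = (\<lambda>c f x. c * f x),
      ip = (\<lambda>f f'. \<Sum>x\<in>X. f x * cnj (f' x)),
      act = (\<lambda>h f x. if x \<in> X then f (\<phi> (inv\<^bsub>H\<^esub> h) x) else 0) \<rparr>"

definition regular_rep :: "('g, 'm) monoid_scheme \<Rightarrow> ('g, 'g \<Rightarrow> complex) rep"
  where "regular_rep H = perm_rep H (carrier H) (\<lambda>h x. h \<otimes>\<^bsub>H\<^esub> x)"

definition quasi_regular_rep ::
    "('g, 'm) monoid_scheme \<Rightarrow> 'g set \<Rightarrow> ('g, 'g set \<Rightarrow> complex) rep"
  where "quasi_regular_rep H K = perm_rep H (lcosets\<^bsub>H\<^esub> K) (\<lambda>h C. h <#\<^bsub>H\<^esub> C)"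

definition sub_rep :: "('g, 'v) rep \<Rightarrow> 'v set \<Rightarrow> ('g, 'v) rep"
  where "sub_rep V U = V\<lparr>vecs := U\<rparr>"

definition pullback_rep :: "('h \<Rightarrow> 'g) \<Rightarrow> ('g, 'v) rep \<Rightarrow> ('h, 'v) rep"
  where "pullback_rep \<theta> V = \<lparr> vecs = vecs V, scl = scl V, ip = ip V, act = (\<lambda>h. act V (\<theta> h)) \<rparr>"

definition direct_sum_rep ::
    "('g, 'v) rep \<Rightarrow> ('g, 'u) rep \<Rightarrow> ('g, 'v \<times> 'u) rep" (infixr \<open>\<oplus>\<^sub>R\<close> 65)
  where "V \<oplus>\<^sub>R U =
    \<lparr> vecs = vecs V \<times> vecs U,
      scl = (\<lambda>c (v, u). (scl V c v, scl U c u)),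
      ip = (\<lambda>(v, u) (v', u'). ip V v v' + ip U u u'),
      act = (\<lambda>h (v, u). (act V h v, act U h u)) \<rparr>"

subsection \<open>The representations of the wreath product\<close>

text \<open>The Specht module of shape \<open>(n - 1, 1)\<close>, realised as the vectors with coordinate sum zero
  in the natural permutation module of the symmetric group.\<close>

definition std_rep_sym :: "nat \<Rightarrow> (nat \<Rightarrow> nat, nat \<Rightarrow> complex) rep"
  where "std_rep_sym n =
    (let V = perm_rep (sym_group n) {1..n} (\<lambda>\<pi> i. \<pi> i)
     in sub_rep V {f \<in> vecs V. (\<Sum>i\<in>{1..n}. f i) = 0})"

definition std_rep :: "nat \<Rightarrow> ('a wreath_elt, nat \<Rightarrow> complex) rep"
  where "std_rep n = pullback_rep snd (std_rep_sym n)"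

definition P_rep ::
    "('a, 'b) monoid_scheme \<Rightarrow> nat \<Rightarrow> ('a wreath_elt, 'a wreath_elt set \<Rightarrow> complex) rep"
  where "P_rep G n = quasi_regular_rep (wreath G n) (sym_emb G n ` carrier (sym_group n))"

definition P0_rep ::
    "('a, 'b) monoid_scheme \<Rightarrow> nat \<Rightarrow> ('a wreath_elt, 'a wreath_elt set \<Rightarrow> complex) rep"
  where "P0_rep G n =
    sub_rep (P_rep G n) (orth_compl (P_rep G n) (fixed_space (wreath G n) (P_rep G n)))"


subsection \<open>These are unitary representations\<close>

lemma group_wreath:
  assumes "group G"
  shows "group (wreath G n)"
proof -
  interpret group G by fact
  have inv_in: "inv' p i \<in> {1..n}" if "p permutes {1..n}" "i \<in> {1..n}" for p i
    using permutes_in_image [OF permutes_inv [OF that(1)]] that(2) by simp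
  have comp: "inv' (p \<circ> q) = inv' q \<circ> inv' p"
    if "p permutes {1..n}" "q permutes {1..n}" for p q :: "nat \<Rightarrow> nat"
    using that by (simp add: o_inv_distrib permutes_bij)
  show ?thesis
  proof (rule groupI)
    fix x y assume "x \<in> carrier (wreath G n)" "y \<in> carrier (wreath G n)"
    then show "x \<otimes>\<^bsub>wreath G n\<^esub> y \<in> carrier (wreath G n)"
      using inv_in by (auto simp: wreath_def permute_tuple_def sym_group_def PiE_iff permutes_compose)
  next
    show "\<one>\<^bsub>wreath G n\<^esub> \<in> carrier (wreath G n)"
      by (auto simp: wreath_def sym_group_def permutes_id)
  next
    fix x y z
    assume "x \<in> carrier (wreath G n)" "y \<in> carrier (wreath G n)" "z \<in> carrier (wreath G n)"
    then show "x \<otimes>\<^bsub>wreath G n\<^esub> y \<otimes>\<^bsub>wreath G n\<^esub> z = x \<otimes>\<^bsub>wreath G n\<^esub> (y \<otimes>\<^bsub>wreath G n\<^esub> z)"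
      using inv_in
      by (auto simp: wreath_def permute_tuple_def sym_group_def PiE_iff comp m_assoc fun_eq_iff)
  next
    fix x assume "x \<in> carrier (wreath G n)"
    then show "\<one>\<^bsub>wreath G n\<^esub> \<otimes>\<^bsub>wreath G n\<^esub> x = x"
      by (auto simp: wreath_def permute_tuple_def sym_group_def PiE_iff extensional_def fun_eq_iff)
  next
    fix x assume "x \<in> carrier (wreath G n)"
    then obtain g p where x: "x = (g, p)" and g: "g \<in> {1..n} \<rightarrow>\<^sub>E carrier G" and p: "p permutes {1..n}"
      by (auto simp: wreath_def sym_group_def)
    define y where "y = ((\<lambda>i\<in>{1..n}. inv\<^bsub>G\<^esub> (g (p i))), inv' p)"
    have pin: "p i \<in> {1..n}" if "i \<in> {1..n}" for i
      using permutes_in_image [OF p] that by simp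
    have "y \<in> carrier (wreath G n)"
      using g p pin by (auto simp: y_def wreath_def sym_group_def PiE_iff permutes_inv)
    moreover have "y \<otimes>\<^bsub>wreath G n\<^esub> x = \<one>\<^bsub>wreath G n\<^esub>"
      using g p pin
      by (auto simp: y_def x wreath_def sym_group_def permute_tuple_def PiE_iff fun_eq_iff
          permutes_inv_o inv_inv_eq permutes_bij l_inv permutes_inverses)
    ultimately show "\<exists>y\<in>carrier (wreath G n). y \<otimes>\<^bsub>wreath G n\<^esub> x = \<one>\<^bsub>wreath G n\<^esub>"
      by blast
  qed
qed

lemma finite_sym_group: "finite (carrier (sym_group n))"
  by (simp add: sym_group_def finite_permutations)

lemma finite_wreath: "finite (carrier G) \<Longrightarrow> finite (carrier (wreath G n))"
  by (auto simp: wreath_def finite_sym_group intro!: finite_PiE)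

lemma subgroup_sym_emb:
  assumes "group G"
  shows "subgroup (sym_emb G n ` carrier (sym_group n)) (wreath G n)"
proof -
  interpret W: group "wreath G n" by (rule group_wreath) fact
  interpret S: group "sym_group n" by (rule sym_group_is_group)
  interpret G: group G by fact
  have "sym_emb G n \<in> hom (sym_group n) (wreath G n)"
    by (auto simp: permutes_in_image [OF permutes_inv] hom_def sym_emb_def wreath_def permute_tuple_def sym_group_def
        permutes_compose fun_eq_iff simp del: One_nat_def atLeastAtMost_iff)
  then interpret group_hom "sym_group n" "wreath G n" "sym_emb G n"
    by unfold_locales
  show ?thesis
    using img_is_subgroup by simp
qed

lemma snd_hom_wreath: "snd \<in> hom (wreath G n) (sym_group n)"
  by (auto simp: hom_def wreath_def)

lemma unitary_perm_rep:
  fixes H :: "('g, 'm) monoid_scheme" and X :: "'x set"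
  assumes "group H" "finite (carrier H)" "finite X"
    and closed: "\<And>h x. h \<in> carrier H \<Longrightarrow> x \<in> X \<Longrightarrow> \<phi> h x \<in> X"
    and one: "\<And>x. x \<in> X \<Longrightarrow> \<phi> \<one>\<^bsub>H\<^esub> x = x"
    and mult: "\<And>g h x. g \<in> carrier H \<Longrightarrow> h \<in> carrier H \<Longrightarrow> x \<in> X \<Longrightarrow> \<phi> (g \<otimes>\<^bsub>H\<^esub> h) x = \<phi> g (\<phi> h x)"
  shows "unitary_rep H (perm_rep H X \<phi>)"
proof -
  interpret group H by fact
  let ?s = "\<lambda>(c::complex) (f::'x \<Rightarrow> complex) x. c * f x"
  interpret vs: vector_space ?s
    by unfold_locales (auto simp: fun_eq_iff algebra_simps)
  have fin: "{f :: 'x \<Rightarrow> complex. \<forall>x. x \<notin> X \<longrightarrow> f x = 0} \<subseteq> vs.span ((\<lambda>x y. if y = x then 1 else 0) ` X)"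
  proof
    fix f :: "'x \<Rightarrow> complex" assume f: "f \<in> {f. \<forall>x. x \<notin> X \<longrightarrow> f x = 0}"
    have app: "(\<Sum>x\<in>A. F x) y = (\<Sum>x\<in>A. F x y)" for F :: "'x \<Rightarrow> 'x \<Rightarrow> complex" and A y
      by (induction A rule: infinite_finite_induct) auto
    have "f = (\<Sum>x\<in>X. ?s (f x) (\<lambda>y. if y = x then 1 else 0))"
      using f \<open>finite X\<close> by (auto simp: fun_eq_iff app if_distrib [of "\<lambda>z. _ * z"] cong: if_cong)
    also have "\<dots> \<in> vs.span ((\<lambda>x y. if y = x then 1 else 0) ` X)"
      by (intro vs.span_sum vs.span_scale vs.span_base) auto
    finally show "f \<in> vs.span ((\<lambda>x y. if y = x then 1 else 0) ` X)" .
  qed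
  have bij: "bij_betw (\<phi> h) X X" if h: "h \<in> carrier H" for h
  proof (rule bij_betw_byWitness [where f' = "\<phi> (inv\<^bsub>H\<^esub> h)"])
    show "\<forall>x\<in>X. \<phi> (inv\<^bsub>H\<^esub> h) (\<phi> h x) = x" "\<forall>x\<in>X. \<phi> h (\<phi> (inv\<^bsub>H\<^esub> h) x) = x"
      using h mult [of "inv\<^bsub>H\<^esub> h" h] mult [of h "inv\<^bsub>H\<^esub> h"] one by auto
  qed (use closed h in auto)
  have vs: "vector_space (scl (perm_rep H X \<phi>))"
    using vs.vector_space_axioms by (simp add: perm_rep_def)
  show ?thesis
  proof (rule unitary_rep.intro [OF \<open>group H\<close> vs], rule unitary_rep_axioms.intro, goal_cases)
    case 1
    show ?case by fact
  next
    case 2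
    show ?case by (simp add: perm_rep_def vs.subspace_def)
  next
    case 3
    show ?case
      using fin \<open>finite X\<close> by (auto simp: perm_rep_def)
  next
    case (4 u v x)
    show ?case by (simp add: perm_rep_def distrib_right sum.distrib)
  next
    case (5 u v c)
    show ?case by (simp add: perm_rep_def sum_distrib_left mult.assoc)
  next
    case (6 u v)
    show ?case by (simp add: perm_rep_def mult.commute)
  next
    case (7 u)
    then obtain x where x: "x \<in> X" "u x \<noteq> 0"
      by (auto simp: perm_rep_def fun_eq_iff)
    have "0 < (\<Sum>x\<in>X. (cmod (u x))\<^sup>2)"
      using x \<open>finite X\<close> by (intro sum_pos2 [of X x]) auto
    then show ?case
      by (simp add: perm_rep_def complex_mult_cnj cmod_power2)
  next
    case (8 h u)
    show ?case by (simp add: perm_rep_def)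
  next
    case (9 h u v)
    show ?case by (simp add: perm_rep_def fun_eq_iff)
  next
    case (10 h u c)
    show ?case by (simp add: perm_rep_def fun_eq_iff)
  next
    case (11 u)
    then show ?case by (auto simp: perm_rep_def fun_eq_iff one)
  next
    case (12 g h u)
    then show ?case by (simp add: perm_rep_def fun_eq_iff inv_mult_group mult closed)
  next
    case (13 h u v)
    have "(\<Sum>x\<in>X. u (\<phi> (inv\<^bsub>H\<^esub> h) x) * cnj (v (\<phi> (inv\<^bsub>H\<^esub> h) x))) = (\<Sum>x\<in>X. u x * cnj (v x))"
      by (rule sum.reindex_bij_betw [OF bij]) (use 13 in auto)
    then show ?case
      by (simp add: perm_rep_def)
  qed
qed

lemma unitary_regular_rep:
  assumes "group H" "finite (carrier H)"
  shows "unitary_rep H (regular_rep H)"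
proof -
  interpret group H by fact
  show ?thesis
    unfolding regular_rep_def by (rule unitary_perm_rep) (use assms m_assoc in auto)
qed

lemma unitary_quasi_regular_rep:
  assumes "group H" "finite (carrier H)" "subgroup K H"
  shows "unitary_rep H (quasi_regular_rep H K)"
proof -
  interpret group H by fact
  have K: "K \<subseteq> carrier H"
    using assms(3) subgroup.subset by blast
  show ?thesis
    unfolding quasi_regular_rep_def
    by (rule unitary_perm_rep)
      (use assms K in \<open>auto simp: LCOSETS_def m_assoc lcos_m_assoc lcos_mult_one l_coset_subset_G\<close>)
qed

context unitary_rep
begin

lemma unitary_sub_rep:
  assumes "subspace U" "U \<subseteq> vecs V" "\<And>h u. h \<in> carrier H \<Longrightarrow> u \<in> U \<Longrightarrow> act V h u \<in> U"
  shows "unitary_rep H (sub_rep V U)"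
proof -
  obtain B where "finite B" "vecs V \<subseteq> span B"
    using finite_dim by blast
  then have B: "finite B \<and> U \<subseteq> span B"
    using assms(2) by blast
  have vs: "vector_space (scl (sub_rep V U))"
    using vector_space_axioms by (simp add: sub_rep_def)
  have U: "u \<in> vecs V" if "u \<in> U" for u
    using that assms(2) by blast
  show ?thesis
  proof (rule unitary_rep.intro [OF group_axioms vs], rule unitary_rep_axioms.intro, goal_cases)
    case 3
    then show ?case using B by (auto simp: sub_rep_def)
  next
    case (6 u v)
    then show ?case using ip_cnj [of u v] U by (simp add: sub_rep_def)
  qed (simp_all add: sub_rep_def U assms finite_group ip_add ip_scl ip_pos act_add act_scl act_one
      act_mult act_unitary)
qed

lemma ip_zero: "v \<in> vecs V \<Longrightarrow> ip V 0 v = 0"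
  using ip_scl [of 0 v 0] subspace_vecs by (simp add: subspace_0)

lemma unitary_orth_compl_fixed: "unitary_rep H (sub_rep V (orth_compl V (fixed_space H V)))"
proof (rule unitary_sub_rep)
  show "subspace (orth_compl V (fixed_space H V))"
    using subspace_vecs
    by (auto simp: subspace_def orth_compl_def fixed_space_def ip_zero ip_add ip_scl)
  show "orth_compl V (fixed_space H V) \<subseteq> vecs V"
    by (auto simp: orth_compl_def)
  fix h v assume h: "h \<in> carrier H" and v: "v \<in> orth_compl V (fixed_space H V)"
  have "ip V (act V h v) u = 0" if u: "u \<in> fixed_space H V" for u
  proof -
    have "act V h u = u" "ip V v u = 0" "u \<in> vecs V" "v \<in> vecs V"
      using h u v by (auto simp: orth_compl_def fixed_space_def)
    then show ?thesis
      using act_unitary [OF h, of v u] by simp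
  qed
  then show "act V h v \<in> orth_compl V (fixed_space H V)"
    using h v by (simp add: act_closed orth_compl_def)
qed

lemma unitary_pullback_rep:
  assumes "group K" "finite (carrier K)" "\<theta> \<in> hom K H"
  shows "unitary_rep K (pullback_rep \<theta> V)"
proof -
  interpret K: group K by fact
  interpret group_hom K H \<theta>
    using assms by unfold_locales
  have vs: "vector_space (scl (pullback_rep \<theta> V))"
    using vector_space_axioms by (simp add: pullback_rep_def)
  show ?thesis
  proof (rule unitary_rep.intro [OF K.group_axioms vs], rule unitary_rep_axioms.intro, goal_cases)
    case (6 u v)
    then show ?case using ip_cnj [of u v] by (simp add: pullback_rep_def)
  qed (simp_all add: pullback_rep_def assms subspace_vecs finite_dim ip_add ip_scl ip_pos
      act_closed act_add act_scl act_one act_mult act_unitary)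
qed

end

lemma unitary_direct_sum_rep:
  assumes "unitary_rep H V" "unitary_rep H U"
  shows "unitary_rep H (V \<oplus>\<^sub>R U)"
proof -
  interpret V: unitary_rep H V by fact
  interpret U: unitary_rep H U by fact
  interpret S: vector_space "scl (V \<oplus>\<^sub>R U)"
    by unfold_locales
      (auto simp: direct_sum_rep_def V.scale_right_distrib U.scale_right_distrib
        V.scale_left_distrib U.scale_left_distrib)
  obtain B C where B: "finite B" "vecs V \<subseteq> V.span B" and C: "finite C" "vecs U \<subseteq> U.span C"
    using V.finite_dim U.finite_dim by blast
  let ?D = "(\<lambda>v. (v, 0)) ` B \<union> (\<lambda>u. (0, u)) ` C"
  have 1: "(v, 0) \<in> S.span ?D" if "v \<in> V.span B" for v
    using that
  proof (induction rule: V.span_induct_alt)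
    case base
    show ?case using S.span_zero by (simp add: zero_prod_def)
  next
    case (step c x y)
    have "scl (V \<oplus>\<^sub>R U) c (x, 0) + (y, 0) \<in> S.span ?D"
      using step by (intro S.span_add S.span_scale) (auto intro: S.span_base)
    then show ?case by (simp add: direct_sum_rep_def)
  qed
  have 2: "(0, u) \<in> S.span ?D" if "u \<in> U.span C" for u
    using that
  proof (induction rule: U.span_induct_alt)
    case base
    show ?case using S.span_zero by (simp add: zero_prod_def)
  next
    case (step c x y)
    have "scl (V \<oplus>\<^sub>R U) c (0, x) + (0, y) \<in> S.span ?D"
      using step by (intro S.span_add S.span_scale) (auto intro: S.span_base)
    then show ?case by (simp add: direct_sum_rep_def)
  qed
  have "vecs (V \<oplus>\<^sub>R U) \<subseteq> S.span ?D"
  proof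
    fix x assume "x \<in> vecs (V \<oplus>\<^sub>R U)"
    then obtain v u where x: "x = (v, 0) + (0, u)" "v \<in> vecs V" "u \<in> vecs U"
      by (auto simp: direct_sum_rep_def)
    then show "x \<in> S.span ?D"
      using 1 2 B C by (auto simp del: add_Pair intro!: S.span_add)
  qed
  then have fd: "\<exists>D. finite D \<and> vecs (V \<oplus>\<^sub>R U) \<subseteq> S.span D"
    using B C by (intro exI [of _ ?D]) auto
  have pos: "0 < Re (ip V v v + ip U u u)"
    if "v \<in> vecs V" "u \<in> vecs U" "(v, u) \<noteq> 0" for v u
    using that V.ip_pos [of v] U.ip_pos [of u] V.ip_zero [of 0] U.ip_zero [of 0]
    by (cases "v = 0"; cases "u = 0") (auto simp: zero_prod_def)
  have sub: "S.subspace (vecs (V \<oplus>\<^sub>R U))"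
    unfolding S.subspace_def using V.subspace_vecs U.subspace_vecs
    by (auto simp: direct_sum_rep_def V.subspace_def U.subspace_def zero_prod_def)
  show ?thesis
  proof (unfold_locales, goal_cases)
    case 2
    then show ?case using sub .
  next
    case 3
    then show ?case using fd by blast
  next
    case (6 u v)
    then show ?case
      using V.ip_cnj [of "fst u" "fst v"] U.ip_cnj [of "snd u" "snd v"]
      by (auto simp: direct_sum_rep_def)
  next
    case (7 u)
    then show ?case using pos by (auto simp: direct_sum_rep_def)
  qed (use V.finite_group in
      \<open>auto simp: direct_sum_rep_def
        V.ip_add U.ip_add V.ip_scl U.ip_scl V.act_closed U.act_closed V.act_add U.act_add
        V.act_scl U.act_scl V.act_one U.act_one V.act_mult U.act_mult V.act_unitary U.act_unitary
        algebra_simps\<close>)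
qed

lemma unitary_std_rep_sym: "unitary_rep (sym_group n) (std_rep_sym n)"
proof -
  let ?V = "perm_rep (sym_group n) {1..n} (\<lambda>\<pi> i. \<pi> i)"
  have "unitary_rep (sym_group n) ?V"
    by (rule unitary_perm_rep [OF sym_group_is_group finite_sym_group])
      (auto simp: sym_group_def dest: permutes_in_image)
  then interpret unitary_rep "sym_group n" ?V .
  have inv: "(\<Sum>i\<in>{1..n}. f ((inv\<^bsub>sym_group n\<^esub> p) i)) = (\<Sum>i\<in>{1..n}. f i)"
    if "p \<in> carrier (sym_group n)" for p and f :: "nat \<Rightarrow> complex"
    by (rule sum.reindex_bij_betw) (use that inv_closed [OF that] in
        \<open>simp add: sym_group_carrier permutes_imp_bij\<close>)
  show ?thesis
    unfolding std_rep_sym_def Let_def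
  proof (rule unitary_sub_rep, goal_cases)
    case 1
    have scl: "sum (scl ?V c f) {1..n} = c * sum f {1..n}" for c f
      by (simp add: perm_rep_def sum_distrib_left)
    show ?case
      using subspace_vecs unfolding subspace_def
      by (auto simp: sum.distrib scl simp del: One_nat_def)
  next
    case (3 h u)
    then show ?case
      using act_closed [of h u] inv [of h u] by (simp add: perm_rep_def)
  qed auto
qed

lemma unitary_std_rep:
  assumes "group G" "finite (carrier G)"
  shows "unitary_rep (wreath G n) (std_rep n)"
  unfolding std_rep_def
  by (rule unitary_rep.unitary_pullback_rep [OF unitary_std_rep_sym])
    (use assms in \<open>auto simp: group_wreath finite_wreath snd_hom_wreath\<close>)

lemma unitary_P0_rep:
  assumes "group G" "finite (carrier G)"
  shows "unitary_rep (wreath G n) (P0_rep G n)"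
  unfolding P0_rep_def P_rep_def
  by (intro unitary_rep.unitary_orth_compl_fixed unitary_quasi_regular_rep subgroup_sym_emb
      group_wreath finite_wreath assms)

end

theory Submission
  imports Defs "HOL-Analysis.Function_Topology"
begin

text \<open>Let \<open>f\<close> be an eigenvector of the Laplacian in the regular representation, with sum zero.
  Right translates of \<open>f\<close>, averaged over right multiplication by the symmetric group, are eigenvectors in
  \<open>P0_rep\<close> with the same eigenvalue.  If all of them vanish then \<open>f\<close> has sum zero on each orbit of the
  symmetric group under left multiplication (Frobenius reciprocity), and then the transposition part of the
  Laplacian alone bounds the eigenvalue below by the gap of \<open>std_rep\<close>: this is the theorem of
  Caputo, Liggett and Richthammer (Aldous' conjecture).

  That theorem is proved by induction on the number of points.  An eigenvector either projects to a
  one-particle eigenvector, or has sum zero on the cosets of every point stabiliser; in the latter case the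
  octopus inequality removes a point and replaces the weights \<open>a i j\<close> by
  \<open>a i j + a z i * a z j / (\<Sum>k. a z k)\<close>, which does not decrease the one-particle gap.

  The octopus inequality says that \<open>M = (\<Sum>i j. x i * x j * transpose i j)\<close> is positive semidefinite if
  \<open>\<Sum>i. x i = 0\<close> and at most one \<open>x i\<close> is negative.  It follows from \<open>M\<^sup>2 \<le> 2 * (\<Sum>i. (x i)\<^sup>2) * M\<close>.  The
  difference of the two sides is a combination, over four-element sets \<open>J\<close> and with coefficients
  proportional to \<open>- (\<Prod>i\<in>J. x i)\<close>, of the projections \<open>\<Pi> J\<close> onto the vectors that are invariant under the
  Klein four-group of \<open>J\<close> and orthogonal to the invariants of its alternating group.  In a five-element set the
  four projections \<open>\<Pi> J\<close> with \<open>z \<in> J\<close> have a sum that dominates the fifth one, which compensates the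
  negative coefficients.\<close>

section \<open>The octopus inequality\<close>

definition perm_ip :: "'a set \<Rightarrow> (('a \<Rightarrow> 'a) \<Rightarrow> real) \<Rightarrow> (('a \<Rightarrow> 'a) \<Rightarrow> real) \<Rightarrow> real"
  where "perm_ip A u v = (\<Sum>q | q permutes A. u q * v q)"

lemma perm_ip_commute: "perm_ip A u v = perm_ip A v u"
  by (simp add: perm_ip_def mult.commute)

lemma perm_ip_nonneg: "perm_ip A u u \<ge> 0"
  by (simp add: perm_ip_def sum_nonneg)

lemma perm_ip_add_left: "perm_ip A (\<lambda>q. u q + v q) x = perm_ip A u x + perm_ip A v x"
  by (simp add: perm_ip_def sum.distrib algebra_simps)

lemma perm_ip_diff_left: "perm_ip A (\<lambda>q. u q - v q) x = perm_ip A u x - perm_ip A v x"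
  by (simp add: perm_ip_def sum_subtractf algebra_simps)

lemma perm_ip_scale_left: "perm_ip A (\<lambda>q. c * u q) x = c * perm_ip A u x"
  by (simp add: perm_ip_def sum_distrib_left algebra_simps)

lemma perm_ip_divide_left: "perm_ip A (\<lambda>q. u q / c) x = perm_ip A u x / c"
  by (simp add: perm_ip_def sum_divide_distrib)

lemma perm_ip_sum_left: "perm_ip A (\<lambda>q. \<Sum>i\<in>I. u i q) x = (\<Sum>i\<in>I. perm_ip A (u i) x)"
  by (simp add: perm_ip_def sum_distrib_right sum.swap [of _ I])

lemmas perm_ip_left = perm_ip_add_left perm_ip_diff_left perm_ip_scale_left perm_ip_divide_left
  perm_ip_sum_left

lemma perm_ip_add_right: "perm_ip A x (\<lambda>q. u q + v q) = perm_ip A x u + perm_ip A x v"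
  and perm_ip_diff_right: "perm_ip A x (\<lambda>q. u q - v q) = perm_ip A x u - perm_ip A x v"
  and perm_ip_scale_right: "perm_ip A x (\<lambda>q. c * u q) = c * perm_ip A x u"
  and perm_ip_divide_right: "perm_ip A x (\<lambda>q. u q / c) = perm_ip A x u / c"
  and perm_ip_sum_right: "perm_ip A x (\<lambda>q. \<Sum>i\<in>I. w i q) = (\<Sum>i\<in>I. perm_ip A x (w i))"
  by (simp_all add: perm_ip_commute [of A x] perm_ip_left)

lemmas perm_ip_right = perm_ip_add_right perm_ip_diff_right perm_ip_scale_right
  perm_ip_divide_right perm_ip_sum_right

text \<open>Reindexing the sum by \<open>p\<close> shows that the adjoint of a translation is
  translation by the inverse. The inverse is a separate \<open>p'\<close>, so that a product of
  transpositions can be inverted by writing it backwards.\<close>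

lemma perm_ip_shift:
  fixes p p' :: "'a \<Rightarrow> 'a"
  assumes "p permutes A" "p' \<circ> p = id"
  shows "perm_ip A (\<lambda>q. u (p \<circ> q)) v = perm_ip A u (\<lambda>q. v (p' \<circ> q))"
proof -
  have "p' \<circ> (p \<circ> q) = q" for q :: "'a \<Rightarrow> 'a"
    using assms(2) by (metis comp_assoc id_comp)
  then show ?thesis
    using setum_permutations_compose_left [OF assms(1), of "\<lambda>q. u q * v (p' \<circ> q)"]
    by (simp add: perm_ip_def)
qed

section \<open>Klein four-group and alternating group on four points\<close>

definition klein_sum :: "'a \<Rightarrow> 'a \<Rightarrow> 'a \<Rightarrow> 'a \<Rightarrow> (('a \<Rightarrow> 'a) \<Rightarrow> real) \<Rightarrow> ('a \<Rightarrow> 'a) \<Rightarrow> real"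
  where "klein_sum a b c d u q = u q
    + u (transpose a b \<circ> transpose c d \<circ> q)
    + u (transpose a c \<circ> transpose b d \<circ> q)
    + u (transpose a d \<circ> transpose b c \<circ> q)"

text \<open>Six times the orthogonal projection onto the functions that are invariant under the Klein
  four-group of \<open>{a, b, c, d}\<close> and have average zero under its alternating group; the predicate
  \<open>alt4_range\<close> below describes the range.\<close>

definition alt4_op :: "'a \<Rightarrow> 'a \<Rightarrow> 'a \<Rightarrow> 'a \<Rightarrow> (('a \<Rightarrow> 'a) \<Rightarrow> real) \<Rightarrow> ('a \<Rightarrow> 'a) \<Rightarrow> real"
  where "alt4_op a b c d u q = klein_sum a b c d u q
    - (klein_sum a b c d u (transpose a b \<circ> transpose b c \<circ> q)
     + klein_sum a b c d u (transpose b c \<circ> transpose a b \<circ> q)) / 2"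

definition alt4_range :: "'a \<Rightarrow> 'a \<Rightarrow> 'a \<Rightarrow> 'a \<Rightarrow> (('a \<Rightarrow> 'a) \<Rightarrow> real) \<Rightarrow> bool"
  where "alt4_range a b c d g \<longleftrightarrow> (\<forall>q.
      g (transpose a b \<circ> transpose c d \<circ> q) = g q \<and>
      g (transpose a c \<circ> transpose b d \<circ> q) = g q \<and>
      g (transpose a d \<circ> transpose b c \<circ> q) = g q \<and>
      g q + g (transpose a b \<circ> transpose b c \<circ> q) + g (transpose b c \<circ> transpose a b \<circ> q) = 0)"

text \<open>Each inequality is listed in both directions, so that after \<open>elim conjE\<close>
  the simplifier can evaluate every transposition.\<close>

lemma distinct4_iff: "distinct [a, b, c, d] \<longleftrightarrow>
    a \<noteq> b \<and> a \<noteq> c \<and> a \<noteq> d \<and> b \<noteq> a \<and> b \<noteq> c \<and> b \<noteq> d \<and>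
    c \<noteq> a \<and> c \<noteq> b \<and> c \<noteq> d \<and> d \<noteq> a \<and> d \<noteq> b \<and> d \<noteq> c"
  by auto

lemma distinct3_iff: "distinct [a, b, c] \<longleftrightarrow>
    a \<noteq> b \<and> a \<noteq> c \<and> b \<noteq> a \<and> b \<noteq> c \<and> c \<noteq> a \<and> c \<noteq> b"
  by auto

text \<open>The multiplication table of the Klein four-group. The trailing \<open>q\<close> matches
  the arguments of translated functions; evaluation at \<open>x\<close> leaves a case distinction on
  \<open>q x\<close>.\<close>

lemma klein_mult:
  assumes "distinct [a, b, c, d]"
  shows "transpose a b \<circ> transpose c d \<circ> (transpose a b \<circ> transpose c d \<circ> q) = q"
    "transpose a c \<circ> transpose b d \<circ> (transpose a c \<circ> transpose b d \<circ> q) = q"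
    "transpose a d \<circ> transpose b c \<circ> (transpose a d \<circ> transpose b c \<circ> q) = q"
    "transpose a b \<circ> transpose c d \<circ> (transpose a c \<circ> transpose b d \<circ> q) = transpose a d \<circ> transpose b c \<circ> q"
    "transpose a b \<circ> transpose c d \<circ> (transpose a d \<circ> transpose b c \<circ> q) = transpose a c \<circ> transpose b d \<circ> q"
    "transpose a c \<circ> transpose b d \<circ> (transpose a b \<circ> transpose c d \<circ> q) = transpose a d \<circ> transpose b c \<circ> q"
    "transpose a c \<circ> transpose b d \<circ> (transpose a d \<circ> transpose b c \<circ> q) = transpose a b \<circ> transpose c d \<circ> q"
    "transpose a d \<circ> transpose b c \<circ> (transpose a b \<circ> transpose c d \<circ> q) = transpose a c \<circ> transpose b d \<circ> q"
    "transpose a d \<circ> transpose b c \<circ> (transpose a c \<circ> transpose b d \<circ> q) = transpose a b \<circ> transpose c d \<circ> q"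
  by - (insert assms, unfold distinct4_iff, elim conjE, rule ext, rename_tac x,
      case_tac "q x = a"; case_tac "q x = b"; case_tac "q x = c"; case_tac "q x = d"; simp)+

lemma cycle_mult:
  assumes "distinct [a, b, c]"
  shows "transpose a b \<circ> transpose b c \<circ> (transpose a b \<circ> transpose b c \<circ> q) = transpose b c \<circ> transpose a b \<circ> q"
    "transpose b c \<circ> transpose a b \<circ> (transpose b c \<circ> transpose a b \<circ> q) = transpose a b \<circ> transpose b c \<circ> q"
    "transpose a b \<circ> transpose b c \<circ> (transpose b c \<circ> transpose a b \<circ> q) = q"
    "transpose b c \<circ> transpose a b \<circ> (transpose a b \<circ> transpose b c \<circ> q) = q"
  by - (insert assms, unfold distinct3_iff, elim conjE, rule ext, rename_tac x,
      case_tac "q x = a"; case_tac "q x = b"; case_tac "q x = c"; simp)+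

text \<open>Normality of the Klein four-group: conjugation by a 3-cycle permutes the three double
  transpositions. Used from left to right, it moves the Klein element to the front.\<close>

lemma cycle_klein:
  assumes "distinct [a, b, c, d]"
  shows "transpose a b \<circ> transpose b c \<circ> (transpose a b \<circ> transpose c d \<circ> q) = transpose a d \<circ> transpose b c \<circ> (transpose a b \<circ> transpose b c \<circ> q)"
    "transpose a b \<circ> transpose b c \<circ> (transpose a c \<circ> transpose b d \<circ> q) = transpose a b \<circ> transpose c d \<circ> (transpose a b \<circ> transpose b c \<circ> q)"
    "transpose a b \<circ> transpose b c \<circ> (transpose a d \<circ> transpose b c \<circ> q) = transpose a c \<circ> transpose b d \<circ> (transpose a b \<circ> transpose b c \<circ> q)"
    "transpose b c \<circ> transpose a b \<circ> (transpose a b \<circ> transpose c d \<circ> q) = transpose a c \<circ> transpose b d \<circ> (transpose b c \<circ> transpose a b \<circ> q)"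
    "transpose b c \<circ> transpose a b \<circ> (transpose a c \<circ> transpose b d \<circ> q) = transpose a d \<circ> transpose b c \<circ> (transpose b c \<circ> transpose a b \<circ> q)"
    "transpose b c \<circ> transpose a b \<circ> (transpose a d \<circ> transpose b c \<circ> q) = transpose a b \<circ> transpose c d \<circ> (transpose b c \<circ> transpose a b \<circ> q)"
  by - (insert assms, unfold distinct4_iff, elim conjE, rule ext, rename_tac x,
      case_tac "q x = a"; case_tac "q x = b"; case_tac "q x = c"; case_tac "q x = d"; simp)+

lemma klein_sum_invariant:
  assumes "distinct [a, b, c, d]"
  shows "klein_sum a b c d u (transpose a b \<circ> transpose c d \<circ> q) = klein_sum a b c d u q"
    "klein_sum a b c d u (transpose a c \<circ> transpose b d \<circ> q) = klein_sum a b c d u q"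
    "klein_sum a b c d u (transpose a d \<circ> transpose b c \<circ> q) = klein_sum a b c d u q"
  unfolding klein_sum_def klein_mult [OF assms] by simp_all

text \<open>By normality all translates of \<open>klein_sum\<close> by 3-cycles are Klein-invariant.
  The coefficients 1, -1/2, -1/2 add up to 0, hence so do the values along an orbit of the
  3-cycle.\<close>

lemma alt4_range_alt4_op:
  assumes "distinct [a, b, c, d]"
  shows "alt4_range a b c d (alt4_op a b c d u)"
proof -
  have d: "distinct [a, b, c]"
    using assms by simp
  show ?thesis
    unfolding alt4_range_def alt4_op_def
    unfolding cycle_klein [OF assms] klein_sum_invariant [OF assms] cycle_mult [OF d]
    by (simp add: field_simps)
qed

text \<open>The factor is 4 times 3/2: \<open>klein_sum\<close> multiplies an invariant function by
  4, and the two cyclic translates add up to \<open>- g\<close>.\<close>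

lemma alt4_op_eq_6:
  assumes "alt4_range a b c d g"
  shows "alt4_op a b c d g q = 6 * g q"
proof -
  have k: "klein_sum a b c d g y = 4 * g y" for y
    using assms by (simp add: klein_sum_def alt4_range_def)
  have "g q + g (transpose a b \<circ> transpose b c \<circ> q) + g (transpose b c \<circ> transpose a b \<circ> q) = 0"
    using assms by (simp add: alt4_range_def)
  then show ?thesis
    unfolding alt4_op_def k by (simp add: field_simps)
qed

lemma permutes_transpose2:
  assumes "{a, b, c, d} \<subseteq> A"
  shows "transpose a b \<circ> transpose c d permutes A"
  using assms by (intro permutes_compose permutes_swap_id) auto

lemma perm_ip_klein_sum:
  assumes "distinct [a, b, c, d]" "{a, b, c, d} \<subseteq> A"
  shows "perm_ip A (klein_sum a b c d u) v = perm_ip A u (klein_sum a b c d v)"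
proof -
  have inv: "transpose a b \<circ> transpose c d \<circ> (transpose a b \<circ> transpose c d) = id"
    "transpose a c \<circ> transpose b d \<circ> (transpose a c \<circ> transpose b d) = id"
    "transpose a d \<circ> transpose b c \<circ> (transpose a d \<circ> transpose b c) = id"
    using klein_mult(1-3) [OF assms(1), of id] by simp_all
  have perm: "transpose a b \<circ> transpose c d permutes A"
    "transpose a c \<circ> transpose b d permutes A" "transpose a d \<circ> transpose b c permutes A"
    using assms(2) by (auto intro!: permutes_transpose2)
  show ?thesis
    unfolding klein_sum_def [abs_def] perm_ip_left perm_ip_right
    by (simp add: perm_ip_shift [OF perm(1) inv(1)] perm_ip_shift [OF perm(2) inv(2)]
        perm_ip_shift [OF perm(3) inv(3)])
qed

text \<open>Taking adjoints fixes the double transpositions and exchanges the two 3-cycles; by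
  \<open>cycle_klein\<close> translation by a 3-cycle commutes with
  \<open>klein_sum\<close>.\<close>

lemma perm_ip_alt4_op:
  assumes "distinct [a, b, c, d]" "{a, b, c, d} \<subseteq> A"
  shows "perm_ip A (alt4_op a b c d u) v = perm_ip A u (alt4_op a b c d v)"
proof -
  let ?K = "klein_sum a b c d" and ?r = "transpose a b \<circ> transpose b c" and ?r' = "transpose b c \<circ> transpose a b"
  have d: "distinct [a, b, c]"
    using assms by simp
  have inv: "?r' \<circ> ?r = id" "?r \<circ> ?r' = id"
    using cycle_mult(3,4) [OF d, of id] by simp_all
  have perm: "?r permutes A" "?r' permutes A"
    using assms(2) by (auto intro!: permutes_transpose2)
  have K: "?K (\<lambda>q. v (?r' \<circ> q)) = (\<lambda>q. ?K v (?r' \<circ> q))" "?K (\<lambda>q. v (?r \<circ> q)) = (\<lambda>q. ?K v (?r \<circ> q))" for v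
    unfolding klein_sum_def fun_eq_iff cycle_klein [OF assms(1)] by simp_all
  have "perm_ip A (\<lambda>q. ?K u (?r \<circ> q)) v = perm_ip A u (\<lambda>q. ?K v (?r' \<circ> q))"
    unfolding perm_ip_shift [OF perm(1) inv(1)] perm_ip_klein_sum [OF assms] K ..
  moreover have "perm_ip A (\<lambda>q. ?K u (?r' \<circ> q)) v = perm_ip A u (\<lambda>q. ?K v (?r \<circ> q))"
    unfolding perm_ip_shift [OF perm(2) inv(2)] perm_ip_klein_sum [OF assms] K ..
  ultimately show ?thesis
    unfolding alt4_op_def [abs_def] perm_ip_left perm_ip_right perm_ip_klein_sum [OF assms] by simp
qed

text \<open>The operator is self-adjoint and its square is 6 times itself. Its quadratic form is
  therefore nonnegative.\<close>

lemma perm_ip_alt4_op_alt4_op: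
  assumes "distinct [a, b, c, d]" "{a, b, c, d} \<subseteq> A"
  shows "perm_ip A (alt4_op a b c d u) (alt4_op a b c d u) = 6 * perm_ip A u (alt4_op a b c d u)"
  unfolding perm_ip_alt4_op [OF assms] alt4_op_eq_6 [OF alt4_range_alt4_op [OF assms(1)], abs_def] perm_ip_right
  by simp

lemma perm_ip_alt4_op_nonneg:
  assumes "distinct [a, b, c, d]" "{a, b, c, d} \<subseteq> A"
  shows "0 \<le> perm_ip A u (alt4_op a b c d u)"
  using perm_ip_alt4_op_alt4_op [OF assms, of u] perm_ip_nonneg [of A "alt4_op a b c d u"] by simp

section \<open>Four-element subsets of a five-element set\<close>

lemma distinct5_iff: "distinct [z, a, b, c, d] \<longleftrightarrow>
    z \<noteq> a \<and> z \<noteq> b \<and> z \<noteq> c \<and> z \<noteq> d \<and>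
    a \<noteq> z \<and> a \<noteq> b \<and> a \<noteq> c \<and> a \<noteq> d \<and>
    b \<noteq> z \<and> b \<noteq> a \<and> b \<noteq> c \<and> b \<noteq> d \<and>
    c \<noteq> z \<and> c \<noteq> a \<and> c \<noteq> b \<and> c \<noteq> d \<and>
    d \<noteq> z \<and> d \<noteq> a \<and> d \<noteq> b \<and> d \<noteq> c"
  by auto

lemma cycle_rotate:
  assumes "distinct [a, b, c]"
  shows "transpose a b \<circ> transpose b c \<circ> q = transpose b c \<circ> transpose c a \<circ> q"
    "transpose b c \<circ> transpose a b \<circ> q = transpose a c \<circ> transpose c b \<circ> q"
  by - (insert assms, unfold distinct3_iff, elim conjE, rule ext, rename_tac x,
      case_tac "q x = a"; case_tac "q x = b"; case_tac "q x = c"; simp)+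

text \<open>Multiplying the two cycles of \<open>{a, b, c}\<close> by the Klein four-group gives the
  six other 3-cycles on \<open>{a, b, c, d}\<close>. This expands \<open>alt4_op\<close> into
  translates by the whole alternating group.\<close>

lemma klein_cycle:
  assumes "distinct [a, b, c, d]"
  shows "transpose a b \<circ> transpose c d \<circ> (transpose a b \<circ> transpose b c \<circ> q) = transpose c d \<circ> transpose b c \<circ> q"
    "transpose a c \<circ> transpose b d \<circ> (transpose a b \<circ> transpose b c \<circ> q) = transpose a d \<circ> transpose d b \<circ> q"
    "transpose a d \<circ> transpose b c \<circ> (transpose a b \<circ> transpose b c \<circ> q) = transpose a c \<circ> transpose c d \<circ> q"
    "transpose a b \<circ> transpose c d \<circ> (transpose b c \<circ> transpose a b \<circ> q) = transpose a d \<circ> transpose d c \<circ> q"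
    "transpose a c \<circ> transpose b d \<circ> (transpose b c \<circ> transpose a b \<circ> q) = transpose b c \<circ> transpose c d \<circ> q"
    "transpose a d \<circ> transpose b c \<circ> (transpose b c \<circ> transpose a b \<circ> q) = transpose a b \<circ> transpose b d \<circ> q"
  by - (insert assms, unfold distinct4_iff, elim conjE, rule ext, rename_tac x,
      case_tac "q x = a"; case_tac "q x = b"; case_tac "q x = c"; case_tac "q x = d"; simp)+

lemma klein_commute:
  assumes "distinct [a, b, c, d]"
  shows "transpose c d \<circ> transpose a b \<circ> q = transpose a b \<circ> transpose c d \<circ> q"
    "transpose b d \<circ> transpose a c \<circ> q = transpose a c \<circ> transpose b d \<circ> q"
    "transpose b c \<circ> transpose a d \<circ> q = transpose a d \<circ> transpose b c \<circ> q"
  by - (insert assms, unfold distinct4_iff, elim conjE, rule ext, rename_tac x,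
      case_tac "q x = a"; case_tac "q x = b"; case_tac "q x = c"; case_tac "q x = d"; simp)+

lemma cycle_bcd:
  assumes "distinct [a, b, c, d]"
  shows "transpose b c \<circ> transpose c d \<circ> q = transpose a c \<circ> transpose b d \<circ> (transpose b c \<circ> transpose a b \<circ> q)"
    "transpose c d \<circ> transpose b c \<circ> q = transpose a b \<circ> transpose c d \<circ> (transpose a b \<circ> transpose b c \<circ> q)"
  by - (insert assms, unfold distinct4_iff, elim conjE, rule ext, rename_tac x,
      case_tac "q x = a"; case_tac "q x = b"; case_tac "q x = c"; case_tac "q x = d"; simp)+

text \<open>Permutations moving \<open>z\<close> are factored as an element of the alternating group
  of \<open>{a, b, c, d}\<close> times one fixed permutation, so that the conditions in
  \<open>alt4_range\<close> apply to them.\<close>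

lemma five_shift:
  assumes "distinct [z, a, b, c, d]"
  shows "transpose z a \<circ> transpose b d \<circ> q = transpose c d \<circ> transpose b c \<circ> (transpose z a \<circ> transpose c d \<circ> q)"
    "transpose z a \<circ> transpose b c \<circ> q = transpose b c \<circ> transpose c d \<circ> (transpose z a \<circ> transpose c d \<circ> q)"
    "transpose z c \<circ> transpose c a \<circ> q = transpose a b \<circ> transpose b c \<circ> (transpose z b \<circ> transpose b a \<circ> q)"
    "transpose z d \<circ> transpose d a \<circ> q = transpose a d \<circ> transpose b c \<circ> (transpose b c \<circ> transpose a b \<circ> (transpose z b \<circ> transpose b a \<circ> q))"
  by - (insert assms, unfold distinct5_iff, elim conjE, rule ext, rename_tac x,
      case_tac "q x = z"; case_tac "q x = a"; case_tac "q x = b"; case_tac "q x = c"; case_tac "q x = d"; simp)+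

lemma cycle_swap:
  assumes "distinct [a, b, c]"
  shows "transpose b a \<circ> transpose a c \<circ> q = transpose b c \<circ> transpose a b \<circ> q"
    "transpose a c \<circ> transpose b a \<circ> q = transpose a b \<circ> transpose b c \<circ> q"
    "transpose c a \<circ> transpose a b \<circ> q = transpose a b \<circ> transpose b c \<circ> q"
    "transpose a b \<circ> transpose c a \<circ> q = transpose b c \<circ> transpose a b \<circ> q"
    "transpose b c \<circ> transpose c a \<circ> q = transpose a b \<circ> transpose b c \<circ> q"
    "transpose c a \<circ> transpose b c \<circ> q = transpose b c \<circ> transpose a b \<circ> q"
  by - (insert assms, unfold distinct3_iff, elim conjE, rule ext, rename_tac x,
      case_tac "q x = a"; case_tac "q x = b"; case_tac "q x = c"; simp)+

lemma alt4_rangeI: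
  assumes "\<And>q. g (transpose a b \<circ> transpose c d \<circ> q) = g q"
    "\<And>q. g (transpose a c \<circ> transpose b d \<circ> q) = g q"
    "\<And>q. g (transpose a d \<circ> transpose b c \<circ> q) = g q"
    "\<And>q. g q + g (transpose a b \<circ> transpose b c \<circ> q) + g (transpose b c \<circ> transpose a b \<circ> q) = 0"
  shows "alt4_range a b c d g"
  using assms by (simp add: alt4_range_def)

lemma alt4_rangeD:
  assumes "alt4_range a b c d g"
  shows "g (transpose a b \<circ> transpose c d \<circ> q) = g q"
    "g (transpose a c \<circ> transpose b d \<circ> q) = g q"
    "g (transpose a d \<circ> transpose b c \<circ> q) = g q"
    "g q + g (transpose a b \<circ> transpose b c \<circ> q) + g (transpose b c \<circ> transpose a b \<circ> q) = 0"
  using assms unfolding alt4_range_def by blast+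

text \<open>The range depends only on the set of the four points: this swap and the rotation in
  \<open>alt4_range_cycle\<close> generate all relabellings.\<close>

lemma alt4_range_swap:
  assumes "distinct [a, b, c, d]" "alt4_range a b c d g"
  shows "alt4_range b a c d g"
proof -
  have d: "distinct [a, b, c]"
    using assms(1) by simp
  show ?thesis
    by (rule alt4_rangeI;
        unfold transpose_commute [of b a] klein_commute [OF assms(1)]
          cycle_swap(1,2) [OF d, unfolded transpose_commute [of b a]] alt4_rangeD(1-3) [OF assms(2)])
      (use alt4_rangeD(4) [OF assms(2)] in \<open>simp_all add: ac_simps\<close>)
qed

lemma alt4_range_cycle:
  assumes "distinct [a, b, c, d]" "alt4_range a b c d g"
  shows "alt4_range b c d a g"
proof (rule alt4_rangeI)
  fix q
  show "g (transpose b c \<circ> transpose d a \<circ> q) = g q" "g (transpose b d \<circ> transpose c a \<circ> q) = g q"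
    "g (transpose b a \<circ> transpose c d \<circ> q) = g q"
    unfolding transpose_commute [of d a] transpose_commute [of c a] transpose_commute [of b a]
      klein_commute [OF assms(1)] alt4_rangeD [OF assms(2)] by simp_all
  show "g q + g (transpose b c \<circ> transpose c d \<circ> q) + g (transpose c d \<circ> transpose b c \<circ> q) = 0"
    unfolding cycle_bcd [OF assms(1)] alt4_rangeD(1-3) [OF assms(2)]
    using alt4_rangeD(4) [OF assms(2), of q] by argo
qed

text \<open>By \<open>five_shift\<close> the three arguments form an orbit of a 3-cycle on
  \<open>{b, c, d}\<close>, and \<open>g\<close> has sum zero on such orbits.\<close>

lemma alt4_range_klein_shift:
  assumes "distinct [z, a, b, c, d]" "alt4_range a b c d g"
  shows "g (transpose z a \<circ> transpose b c \<circ> q) + g (transpose z a \<circ> transpose b d \<circ> q)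
    + g (transpose z a \<circ> transpose c d \<circ> q) = 0"
proof -
  have "alt4_range b c d a g"
    by (rule alt4_range_cycle [OF _ assms(2)]) (use assms(1) in auto)
  then show ?thesis
    unfolding five_shift [OF assms(1)]
    using alt4_rangeD(4) [of b c d a g "transpose z a \<circ> transpose c d \<circ> q"] by argo
qed

text \<open>Up to a Klein element, which \<open>g\<close> ignores, the three arguments form an orbit
  of the 3-cycle on \<open>{a, b, c}\<close>.\<close>

lemma alt4_range_cycle_shift:
  assumes "distinct [z, a, b, c, d]" "alt4_range a b c d g"
  shows "g (transpose z b \<circ> transpose b a \<circ> q) + g (transpose z c \<circ> transpose c a \<circ> q)
    + g (transpose z d \<circ> transpose d a \<circ> q) = 0"
  unfolding five_shift [OF assms(1)] alt4_rangeD(3) [OF assms(2)]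
  using alt4_rangeD(4) [OF assms(2), of "transpose z b \<circ> transpose b a \<circ> q"] by argo

text \<open>The identity and the two 3-cycles that fix \<open>z\<close> combine to
  \<open>3 / 2 * g q\<close> by the second assumption; all other elements of the alternating group
  move \<open>z\<close>.\<close>

lemma alt4_op_expand:
  assumes "distinct [z, a, b, c]"
    and "\<And>q. g q + g (transpose a b \<circ> transpose b c \<circ> q) + g (transpose b c \<circ> transpose a b \<circ> q) = 0"
  shows "alt4_op z a b c g q = 3 / 2 * g q
    + g (transpose z a \<circ> transpose b c \<circ> q) + g (transpose z b \<circ> transpose a c \<circ> q)
    + g (transpose z c \<circ> transpose a b \<circ> q)
    - (g (transpose z b \<circ> transpose b a \<circ> q) + g (transpose z c \<circ> transpose c a \<circ> q)
     + g (transpose z a \<circ> transpose a b \<circ> q) + g (transpose z c \<circ> transpose c b \<circ> q)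
     + g (transpose z a \<circ> transpose a c \<circ> q) + g (transpose z b \<circ> transpose b c \<circ> q)) / 2"
proof -
  have d: "distinct [z, a, b]"
    using assms(1) by auto
  show ?thesis
    using assms(2) [of q]
    unfolding alt4_op_def klein_sum_def klein_cycle [OF assms(1)]
    unfolding cycle_rotate(2) [OF d]
    by argo
qed

lemma alt4_range_cycles:
  assumes "distinct [a, b, c, d]" "alt4_range a b c d g"
  shows "g q + g (transpose a b \<circ> transpose b c \<circ> q) + g (transpose b c \<circ> transpose a b \<circ> q) = 0"
    "g q + g (transpose a b \<circ> transpose b d \<circ> q) + g (transpose b d \<circ> transpose a b \<circ> q) = 0"
    "g q + g (transpose a c \<circ> transpose c d \<circ> q) + g (transpose c d \<circ> transpose a c \<circ> q) = 0"
    "g q + g (transpose b c \<circ> transpose c d \<circ> q) + g (transpose c d \<circ> transpose b c \<circ> q) = 0"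
proof -
  have 1: "alt4_range b c d a g"
    using assms by (rule alt4_range_cycle)
  have 2: "alt4_range c d a b g"
    by (rule alt4_range_cycle [OF _ 1]) (use assms(1) in auto)
  have 3: "alt4_range d a b c g"
    by (rule alt4_range_cycle [OF _ 2]) (use assms(1) in auto)
  have d: "distinct [a, b, d]" "distinct [a, c, d]"
    using assms(1) by auto
  show "g q + g (transpose a b \<circ> transpose b c \<circ> q) + g (transpose b c \<circ> transpose a b \<circ> q) = 0"
    "g q + g (transpose b c \<circ> transpose c d \<circ> q) + g (transpose c d \<circ> transpose b c \<circ> q) = 0"
    using alt4_rangeD(4) [OF assms(2)] alt4_rangeD(4) [OF 1] by simp_all
  show "g q + g (transpose a b \<circ> transpose b d \<circ> q) + g (transpose b d \<circ> transpose a b \<circ> q) = 0"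
    using alt4_rangeD(4) [OF 3, of q] unfolding cycle_swap(3,4) [OF d(1)] by argo
  show "g q + g (transpose a c \<circ> transpose c d \<circ> q) + g (transpose c d \<circ> transpose a c \<circ> q) = 0"
    using alt4_rangeD(4) [OF 2, of q] unfolding cycle_swap(5,6) [OF d(2)] by argo
qed

text \<open>The four terms \<open>3 / 2 * g q\<close> make up the 6. The other translates move
  \<open>z\<close> and cancel in groups of three: double transpositions with the same partner of
  \<open>z\<close>, and 3-cycles \<open>transpose z y \<circ> transpose y x\<close> with the same
  \<open>x\<close>.\<close>

lemma alt4_op_sum_eq_6:
  assumes "distinct [z, a, b, c, d]" "alt4_range a b c d g"
  shows "alt4_op z a b c g q + alt4_op z a b d g q + alt4_op z a c d g q + alt4_op z b c d g q = 6 * g q"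
proof -
  have d: "distinct [a, b, c, d]"
    using assms(1) by auto
  have i2: "alt4_range b a c d g"
    using d assms(2) by (rule alt4_range_swap)
  have i3: "alt4_range c a b d g"
  proof -
    have 1: "alt4_range b c d a g"
      using d assms(2) by (rule alt4_range_cycle)
    have 2: "alt4_range c d a b g"
      by (rule alt4_range_cycle [OF _ 1]) (use d in auto)
    have 3: "alt4_range d c a b g"
      by (rule alt4_range_swap [OF _ 2]) (use d in auto)
    show ?thesis
      by (rule alt4_range_cycle [OF _ 3]) (use d in auto)
  qed
  have i4: "alt4_range d a b c g"
  proof -
    have 1: "alt4_range b c d a g"
      using d assms(2) by (rule alt4_range_cycle)
    have 2: "alt4_range c d a b g"
      by (rule alt4_range_cycle [OF _ 1]) (use d in auto)
    show ?thesis
      by (rule alt4_range_cycle [OF _ 2]) (use d in auto)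
  qed
  note e = alt4_op_expand [OF _ alt4_range_cycles(1) [OF d assms(2)]] alt4_op_expand [OF _ alt4_range_cycles(2) [OF d assms(2)]]
    alt4_op_expand [OF _ alt4_range_cycles(3) [OF d assms(2)]] alt4_op_expand [OF _ alt4_range_cycles(4) [OF d assms(2)]]
  note s = alt4_range_klein_shift [OF _ assms(2)] alt4_range_klein_shift [OF _ i2] alt4_range_klein_shift [OF _ i3]
    alt4_range_klein_shift [OF _ i4]
    alt4_range_cycle_shift [OF _ assms(2)] alt4_range_cycle_shift [OF _ i2] alt4_range_cycle_shift [OF _ i3]
    alt4_range_cycle_shift [OF _ i4]
  have z: "distinct [z, a, b, c]" "distinct [z, a, b, d]" "distinct [z, a, c, d]" "distinct [z, b, c, d]"
    "distinct [z, b, a, c, d]" "distinct [z, c, a, b, d]" "distinct [z, d, a, b, c]"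
    using assms(1) by auto
  show ?thesis
    using s(1) [of z q, OF assms(1)] s(2) [of z q, OF z(5)] s(3) [of z q, OF z(6)] s(4) [of z q, OF z(7)]
      s(5) [of z q, OF assms(1)] s(6) [of z q, OF z(5)] s(7) [of z q, OF z(6)] s(8) [of z q, OF z(7)]
    unfolding e(1) [OF z(1)] e(2) [OF z(2)] e(3) [OF z(3)] e(4) [OF z(4)]
    by argo
qed

text \<open>By \<open>alt4_op_sum_eq_6\<close> the operator \<open>L\<close> is 6 on the range of \<open>alt4_op a b c d\<close>; the claim is the
  positivity of \<open>L\<close> at \<open>6 u - g\<close>.\<close>

lemma perm_ip_alt4_op_five:
  assumes "distinct [z, a, b, c, d]" "{z, a, b, c, d} \<subseteq> A"
  shows "perm_ip A u (alt4_op a b c d u) \<le> perm_ip A u (alt4_op z a b c u) + perm_ip A u (alt4_op z a b d u)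
    + perm_ip A u (alt4_op z a c d u) + perm_ip A u (alt4_op z b c d u)"
proof -
  define g where "g = alt4_op a b c d u"
  define L where "L v = (\<lambda>q. alt4_op z a b c v q + alt4_op z a b d v q + alt4_op z a c d v q + alt4_op z b c d v q)" for v
  have d: "distinct [a, b, c, d]" "distinct [z, a, b, c]" "distinct [z, a, b, d]"
    "distinct [z, a, c, d]" "distinct [z, b, c, d]"
    and A: "{a, b, c, d} \<subseteq> A" "{z, a, b, c} \<subseteq> A" "{z, a, b, d} \<subseteq> A" "{z, a, c, d} \<subseteq> A" "{z, b, c, d} \<subseteq> A"
    using assms by auto
  note sym = perm_ip_alt4_op [OF d(2) A(2)] perm_ip_alt4_op [OF d(3) A(3)] perm_ip_alt4_op [OF d(4) A(4)]
    perm_ip_alt4_op [OF d(5) A(5)]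
  have L_sym: "perm_ip A (L v) x = perm_ip A v (L x)" for v x
    by (simp add: L_def perm_ip_left perm_ip_right sym)
  have L_pos: "0 \<le> perm_ip A v (L v)" for v
    using perm_ip_alt4_op_nonneg [OF d(2) A(2), of v] perm_ip_alt4_op_nonneg [OF d(3) A(3), of v]
      perm_ip_alt4_op_nonneg [OF d(4) A(4), of v] perm_ip_alt4_op_nonneg [OF d(5) A(5), of v]
    by (simp add: L_def perm_ip_right)
  have Lg: "L g = (\<lambda>q. 6 * g q)"
    unfolding L_def g_def using alt4_op_sum_eq_6 [OF assms(1) alt4_range_alt4_op [OF d(1)]] by blast
  have gg: "perm_ip A g g = 6 * perm_ip A u g"
    unfolding g_def by (rule perm_ip_alt4_op_alt4_op [OF d(1) A(1)])
  have "0 \<le> perm_ip A (\<lambda>q. 6 * u q - g q) (L (\<lambda>q. 6 * u q - g q))"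
    by (rule L_pos)
  also have "\<dots> = 36 * perm_ip A u (L u) - 12 * perm_ip A u (L g) + perm_ip A g (L g)"
  proof -
    have "L (\<lambda>q. 6 * u q - g q) = (\<lambda>q. 6 * L u q - L g q)"
      by (simp add: L_def alt4_op_def klein_sum_def fun_eq_iff field_simps)
    moreover have "perm_ip A g (L u) = perm_ip A u (L g)"
      by (metis L_sym perm_ip_commute)
    ultimately show ?thesis
      by (simp add: perm_ip_left perm_ip_right)
  qed
  also have "\<dots> = 36 * perm_ip A u (L u) - 36 * perm_ip A u g"
    by (simp add: Lg perm_ip_right gg)
  finally show ?thesis
    by (simp add: g_def L_def perm_ip_right)
qed

text \<open>Translations are orthogonal, so \<open>h\<close> agrees at a permutation and its
  inverse. The eight 3-cycles fall into four inverse pairs, which cancels the division by 2.\<close>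

lemma perm_ip_alt4_op_expand:
  fixes u :: "('a \<Rightarrow> 'a) \<Rightarrow> real"
  assumes "distinct [a, b, c, d]" "{a, b, c, d} \<subseteq> A"
  defines "h \<equiv> \<lambda>p. perm_ip A u (\<lambda>q. u (p \<circ> q))"
  shows "perm_ip A u (alt4_op a b c d u) = h id
    + h (transpose a b \<circ> transpose c d) + h (transpose a c \<circ> transpose b d) + h (transpose a d \<circ> transpose b c)
    - h (transpose a b \<circ> transpose b c) - h (transpose a b \<circ> transpose b d)
    - h (transpose a c \<circ> transpose c d) - h (transpose b c \<circ> transpose c d)"
proof -
  have sym: "h (transpose x y \<circ> transpose y z) = h (transpose y z \<circ> transpose x y)" if "{x, y, z} \<subseteq> A" for x y z
    unfolding h_def using that
    by (subst perm_ip_commute, intro perm_ip_shift permutes_compose permutes_swap_id) (auto simp: fun_eq_iff)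
  have d: "distinct [a, b, d]" "distinct [a, c, d]"
    using assms by auto
  have r: "transpose a d \<circ> transpose d b = transpose b d \<circ> transpose a b"
    "transpose a d \<circ> transpose d c = transpose c d \<circ> transpose a c"
    using cycle_rotate(2) [OF d(1), of id] cycle_rotate(2) [OF d(2), of id] by simp_all
  have "perm_ip A u (alt4_op a b c d u) = h id
    + h (transpose a b \<circ> transpose c d) + h (transpose a c \<circ> transpose b d) + h (transpose a d \<circ> transpose b c)
    - (h (transpose a b \<circ> transpose b c) + h (transpose c d \<circ> transpose b c)
     + h (transpose b d \<circ> transpose a b) + h (transpose a c \<circ> transpose c d)
     + h (transpose b c \<circ> transpose a b) + h (transpose c d \<circ> transpose a c)
     + h (transpose b c \<circ> transpose c d) + h (transpose a b \<circ> transpose b d)) / 2"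
    unfolding alt4_op_def [abs_def] klein_sum_def perm_ip_right klein_cycle [OF assms(1)] h_def r by simp
  then show ?thesis
    using sym [of a b c] sym [of a b d] sym [of a c d] sym [of b c d] assms(2)
    by (simp add: field_simps)
qed

section \<open>Quartic sums over tuples of points\<close>

definition sum4 :: "'a set \<Rightarrow> ('a \<Rightarrow> real) \<Rightarrow> ('a \<Rightarrow> 'a \<Rightarrow> 'a \<Rightarrow> 'a \<Rightarrow> real) \<Rightarrow> real"
  where "sum4 A x F = (\<Sum>i\<in>A. \<Sum>j\<in>A. \<Sum>k\<in>A. \<Sum>l\<in>A. x i * x j * x k * x l * F i j k l)"

lemma sum4_add: "sum4 A x (\<lambda>i j k l. F i j k l + F' i j k l) = sum4 A x F + sum4 A x F'"
  and sum4_diff: "sum4 A x (\<lambda>i j k l. F i j k l - F' i j k l) = sum4 A x F - sum4 A x F'"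
  by (simp_all add: sum4_def distrib_left right_diff_distrib sum.distrib sum_subtractf)

lemma sum4_swap: "sum4 A x F = sum4 A x (\<lambda>i j k l. F j i k l)"
  "sum4 A x F = sum4 A x (\<lambda>i j k l. F i k j l)"
  "sum4 A x F = sum4 A x (\<lambda>i j k l. F i j l k)"
proof -
  show "sum4 A x F = sum4 A x (\<lambda>i j k l. F j i k l)"
    unfolding sum4_def by (subst sum.swap) (simp add: mult_ac)
  show "sum4 A x F = sum4 A x (\<lambda>i j k l. F i k j l)"
    unfolding sum4_def by (rule sum.cong [OF refl], subst sum.swap) (simp add: mult_ac)
  show "sum4 A x F = sum4 A x (\<lambda>i j k l. F i j l k)"
    unfolding sum4_def by (rule sum.cong [OF refl], rule sum.cong [OF refl], subst sum.swap) (simp add: mult_ac)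
qed

text \<open>The weight of the index that \<open>F\<close> does not see factors out, and the weights
  have sum zero.\<close>

lemma sum4_indep:
  assumes "(\<Sum>i\<in>A. x i) = 0"
  shows "sum4 A x (\<lambda>i j k l. F i j k) = 0"
    "sum4 A x (\<lambda>i j k l. F i j l) = 0"
    "sum4 A x (\<lambda>i j k l. F i k l) = 0"
    "sum4 A x (\<lambda>i j k l. F j k l) = 0"
proof -
  have *: "sum4 A x (\<lambda>i j k l. F i j k) = 0" for F
    using assms by (simp add: sum4_def sum_distrib_left [symmetric] sum_distrib_right [symmetric])
  show "sum4 A x (\<lambda>i j k l. F i j k) = 0" by (rule *)
  show l: "sum4 A x (\<lambda>i j k l. F i j l) = 0" for F
    by (subst sum4_swap(3)) (rule *)
  show k: "sum4 A x (\<lambda>i j k l. F i k l) = 0" for F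
    by (subst sum4_swap(2)) (rule l)
  show "sum4 A x (\<lambda>i j k l. F j k l) = 0"
    by (subst sum4_swap(1)) (rule k)
qed

text \<open>The two coinciding indices contribute a factor of squared weights; the cases after the
  first follow by permuting indices.\<close>

lemma sum4_diag:
  assumes "finite A"
  shows "sum4 A x (\<lambda>i j k l. if i = j then F k l else 0) = (\<Sum>i\<in>A. (x i)\<^sup>2) * (\<Sum>i\<in>A. \<Sum>j\<in>A. x i * x j * F i j)"
    "sum4 A x (\<lambda>i j k l. if i = k then F j l else 0) = (\<Sum>i\<in>A. (x i)\<^sup>2) * (\<Sum>i\<in>A. \<Sum>j\<in>A. x i * x j * F i j)"
    "sum4 A x (\<lambda>i j k l. if i = l then F j k else 0) = (\<Sum>i\<in>A. (x i)\<^sup>2) * (\<Sum>i\<in>A. \<Sum>j\<in>A. x i * x j * F i j)"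
    "sum4 A x (\<lambda>i j k l. if j = k then F i l else 0) = (\<Sum>i\<in>A. (x i)\<^sup>2) * (\<Sum>i\<in>A. \<Sum>j\<in>A. x i * x j * F i j)"
    "sum4 A x (\<lambda>i j k l. if j = l then F i k else 0) = (\<Sum>i\<in>A. (x i)\<^sup>2) * (\<Sum>i\<in>A. \<Sum>j\<in>A. x i * x j * F i j)"
    "sum4 A x (\<lambda>i j k l. if k = l then F i j else 0) = (\<Sum>i\<in>A. (x i)\<^sup>2) * (\<Sum>i\<in>A. \<Sum>j\<in>A. x i * x j * F i j)"
proof -
  have "sum4 A x (\<lambda>i j k l. if i = j then F k l else 0)
      = (\<Sum>i\<in>A. \<Sum>j\<in>A. if i = j then (x i)\<^sup>2 * (\<Sum>k\<in>A. \<Sum>l\<in>A. x k * x l * F k l) else 0)"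
    unfolding sum4_def
    by (intro sum.cong refl) (simp add: sum_distrib_left power2_eq_square mult_ac)
  then show 1: "sum4 A x (\<lambda>i j k l. if i = j then F k l else 0) = (\<Sum>i\<in>A. (x i)\<^sup>2) * (\<Sum>i\<in>A. \<Sum>j\<in>A. x i * x j * F i j)"
    using assms by (simp add: sum.delta sum_distrib_right)
  show 2: "sum4 A x (\<lambda>i j k l. if i = k then F j l else 0) = (\<Sum>i\<in>A. (x i)\<^sup>2) * (\<Sum>i\<in>A. \<Sum>j\<in>A. x i * x j * F i j)"
    by (subst sum4_swap(2)) (rule 1)
  show 3: "sum4 A x (\<lambda>i j k l. if i = l then F j k else 0) = (\<Sum>i\<in>A. (x i)\<^sup>2) * (\<Sum>i\<in>A. \<Sum>j\<in>A. x i * x j * F i j)"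
    by (subst sum4_swap(3)) (rule 2)
  show 4: "sum4 A x (\<lambda>i j k l. if j = k then F i l else 0) = (\<Sum>i\<in>A. (x i)\<^sup>2) * (\<Sum>i\<in>A. \<Sum>j\<in>A. x i * x j * F i j)"
    by (subst sum4_swap(1)) (rule 2)
  show 5: "sum4 A x (\<lambda>i j k l. if j = l then F i k else 0) = (\<Sum>i\<in>A. (x i)\<^sup>2) * (\<Sum>i\<in>A. \<Sum>j\<in>A. x i * x j * F i j)"
    by (subst sum4_swap(1)) (rule 3)
  show "sum4 A x (\<lambda>i j k l. if k = l then F i j else 0) = (\<Sum>i\<in>A. (x i)\<^sup>2) * (\<Sum>i\<in>A. \<Sum>j\<in>A. x i * x j * F i j)"
    by (subst sum4_swap(2)) (rule 5)
qed

text \<open>On degenerate triples \<open>tri\<close> takes the value at the identity, which makes it a function of three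
  indices only and so annihilates it in \<open>sum4\<close> when the weights have sum zero.\<close>

definition tri :: "(('a \<Rightarrow> 'a) \<Rightarrow> real) \<Rightarrow> 'a \<Rightarrow> 'a \<Rightarrow> 'a \<Rightarrow> real"
  where "tri h i j k = (if distinct [i, j, k] then h (transpose i j \<circ> transpose j k) else h id)"

text \<open>For distinct points of \<open>A\<close> and
  \<open>h p = perm_ip A u (\<lambda>q. u (p \<circ> q))\<close> this is the quadratic form of
  \<open>alt4_op\<close>, by \<open>perm_ip_alt4_op_expand\<close>.\<close>

definition quad :: "(('a \<Rightarrow> 'a) \<Rightarrow> real) \<Rightarrow> 'a \<Rightarrow> 'a \<Rightarrow> 'a \<Rightarrow> 'a \<Rightarrow> real"
  where "quad h i j k l = h id + h (transpose i j \<circ> transpose k l)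
    + h (transpose i k \<circ> transpose j l) + h (transpose i l \<circ> transpose j k)
    - tri h i j k - tri h i j l - tri h i k l - tri h j k l"

definition quad0 :: "(('a \<Rightarrow> 'a) \<Rightarrow> real) \<Rightarrow> 'a \<Rightarrow> 'a \<Rightarrow> 'a \<Rightarrow> 'a \<Rightarrow> real"
  where "quad0 h i j k l = (if distinct [i, j, k, l] then quad h i j k l else 0)"

context
  fixes h :: "('a \<Rightarrow> 'a) \<Rightarrow> real"
  assumes sym: "\<And>i j k l. h (transpose i j \<circ> transpose k l) = h (transpose k l \<circ> transpose i j)"
begin

text \<open>Exchanging neighbouring indices inverts the 3-cycle, that is, reverses the order of its
  two transpositions.\<close>

lemma tri_swap: "tri h i k j = tri h i j k" "tri h j i k = tri h i j k"
proof -
  have *: "h (transpose i k \<circ> transpose k j) = h (transpose i j \<circ> transpose j k)"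
    "h (transpose j i \<circ> transpose i k) = h (transpose i j \<circ> transpose j k)" if "distinct [i, j, k]"
  proof -
    have 1: "transpose j i \<circ> transpose i k = transpose j k \<circ> transpose i j"
      using cycle_swap(1) [OF that, of id] by simp
    have 2: "transpose i k \<circ> transpose k j = transpose j k \<circ> transpose i j"
      using cycle_rotate(2) [OF that, of id] by simp
    show "h (transpose i k \<circ> transpose k j) = h (transpose i j \<circ> transpose j k)"
      "h (transpose j i \<circ> transpose i k) = h (transpose i j \<circ> transpose j k)"
      unfolding 1 2 by (rule sym)+
  qed
  show "tri h i k j = tri h i j k" "tri h j i k = tri h i j k"
    using * by (auto simp: tri_def)
qed

lemma tri_eq:
  assumes "a \<noteq> b" "a \<noteq> c" "b \<noteq> c"
  shows "h (transpose a b \<circ> transpose b c) = tri h a b c"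
    "h (transpose a b \<circ> transpose c b) = tri h a b c"
    "h (transpose b a \<circ> transpose b c) = tri h a b c"
    "h (transpose b a \<circ> transpose c b) = tri h a b c"
  using assms by (simp_all add: tri_def transpose_commute [of b a] transpose_commute [of c b])

lemma tri_degenerate: "tri h a a b = h id" "tri h a b a = h id" "tri h b a a = h id"
  by (simp_all add: tri_def)

text \<open>If only \<open>i = j\<close>, two of the double transpositions turn into 3-cycles on
  \<open>i, k, l\<close> and cancel against \<open>tri\<close>, which leaves
  \<open>h (transpose k l) - h id\<close>. With more coincidences these corrections add up.\<close>

lemma quad0_eq:
  "quad0 h i j k l = quad h i j k l
    - (if i = j then h (transpose k l) - h id else 0) - (if i = k then h (transpose j l) - h id else 0)
    - (if i = l then h (transpose j k) - h id else 0) - (if j = k then h (transpose i l) - h id else 0)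
    - (if j = l then h (transpose i k) - h id else 0) - (if k = l then h (transpose i j) - h id else 0)"
  by (cases "i = j"; cases "i = k"; cases "i = l"; cases "j = k"; cases "j = l"; cases "k = l")
    (simp_all add: quad0_def quad_def tri_degenerate tri_eq tri_swap transpose_commute)

text \<open>With \<open>h p = \<langle>u, u (p \<circ> \<cdot>)\<rangle>\<close> and \<open>M = (\<Sum>i j. x i * x j * transpose i j)\<close>, the right-hand side is
  \<open>3 * \<langle>u, (M\<^sup>2 - 2 * (\<Sum>i. (x i)\<^sup>2) * M) u\<rangle>\<close>, so that a nonpositive left-hand side makes \<open>M\<close> positive semidefinite.\<close>

lemma sum4_quad0:
  assumes "finite A" "(\<Sum>i\<in>A. x i) = 0"
  shows "sum4 A x (quad0 h) = 3 * sum4 A x (\<lambda>i j k l. h (transpose i j \<circ> transpose k l))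
    - 6 * (\<Sum>i\<in>A. (x i)\<^sup>2) * (\<Sum>i\<in>A. \<Sum>j\<in>A. x i * x j * h (transpose i j))"
proof -
  have z: "(\<Sum>i\<in>A. \<Sum>j\<in>A. x i * x j * (h (transpose i j) - h id)) = (\<Sum>i\<in>A. \<Sum>j\<in>A. x i * x j * h (transpose i j))"
    using assms(2)
    by (simp add: right_diff_distrib sum_subtractf sum_distrib_left [symmetric] sum_distrib_right [symmetric])
  have p1: "sum4 A x (\<lambda>i j k l. h (transpose i k \<circ> transpose j l)) = sum4 A x (\<lambda>i j k l. h (transpose i j \<circ> transpose k l))"
    by (subst sum4_swap(2)) (rule refl)
  have p2: "sum4 A x (\<lambda>i j k l. h (transpose i l \<circ> transpose j k)) = sum4 A x (\<lambda>i j k l. h (transpose i j \<circ> transpose k l))"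
    by (subst sum4_swap(3)) (rule p1)
  have q: "sum4 A x (quad h) = 3 * sum4 A x (\<lambda>i j k l. h (transpose i j \<circ> transpose k l))"
    unfolding quad_def [abs_def] sum4_add sum4_diff p1 p2
    by (simp add: sum4_indep [OF assms(2)])
  show ?thesis
    unfolding quad0_eq [abs_def] sum4_diff q
    by (simp add: sum4_diag [OF assms(1)] z)
qed

lemma quad_front:
  "quad h j i k l = quad h i j k l" "quad h j k i l = quad h i j k l" "quad h j k l i = quad h i j k l"
  by (simp_all add: quad_def tri_swap sym transpose_commute)

end

text \<open>Terms with \<open>z\<close> twice vanish, as \<open>quad0\<close> does on repeated
  indices. A single factor \<open>x z\<close> is minus a sum over \<open>B\<close>, so each term
  with \<open>z\<close> becomes a sum over a fourth index in \<open>B\<close>. The weights are then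
  nonnegative, and the combined term is nonpositive by \<open>five\<close>, or by \<open>pos\<close>
  if two indices agree.\<close>

lemma sum4_quad0_nonpos:
  fixes h :: "('a \<Rightarrow> 'a) \<Rightarrow> real"
  assumes "finite B" "z \<notin> B"
    and sym: "\<And>i j k l. h (transpose i j \<circ> transpose k l) = h (transpose k l \<circ> transpose i j)"
    and pos: "\<And>i j k l. distinct [i, j, k, l] \<Longrightarrow> {i, j, k, l} \<subseteq> insert z B \<Longrightarrow> 0 \<le> quad h i j k l"
    and five: "\<And>i j k l. distinct [i, j, k, l] \<Longrightarrow> {i, j, k, l} \<subseteq> B \<Longrightarrow>
      quad h i j k l \<le> quad h z i j k + quad h z i j l + quad h z i k l + quad h z j k l"
    and x: "\<And>i. i \<in> B \<Longrightarrow> 0 \<le> x i" and xz: "x z = - (\<Sum>i\<in>B. x i)"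
  shows "sum4 (insert z B) x (quad0 h) \<le> 0"
proof -
  define S3 where "S3 F = (\<Sum>i\<in>B. \<Sum>j\<in>B. \<Sum>k\<in>B. x i * x j * x k * F i j k)" for F
  let ?Q = "\<lambda>i j k l. if distinct [i, j, k, l] then quad h z i j k else 0"
  have "sum4 (insert z B) x (quad0 h) = sum4 B x (quad0 h) + x z * S3 (\<lambda>j k l. quad0 h z j k l)
      + x z * S3 (\<lambda>i k l. quad0 h i z k l) + x z * S3 (\<lambda>i j l. quad0 h i j z l) + x z * S3 (\<lambda>i j k. quad0 h i j k z)"
    using assms(1,2)
    by (simp add: sum4_def S3_def sum.distrib sum_distrib_left mult_ac quad0_def cong: if_cong)
  also have "\<dots> = sum4 B x (\<lambda>i j k l. quad0 h i j k l - quad0 h z j k l - quad0 h i z k l - quad0 h i j z l - quad0 h i j k z)"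
  proof -
    have 4: "sum4 B x (\<lambda>i j k l. F i j k) = - x z * S3 F" for F
      by (simp add: sum4_def S3_def xz sum_distrib_left sum_distrib_right mult_ac)
    have 3: "sum4 B x (\<lambda>i j k l. F i j l) = - x z * S3 F" for F
      by (subst sum4_swap(3)) (rule 4)
    have 2: "sum4 B x (\<lambda>i j k l. F i k l) = - x z * S3 F" for F
      by (subst sum4_swap(2)) (rule 3)
    have 1: "sum4 B x (\<lambda>i j k l. F j k l) = - x z * S3 F" for F
      by (subst sum4_swap(1)) (rule 2)
    show ?thesis
      unfolding sum4_diff 1 2 3 4 by simp
  qed
  also have "\<dots> \<le> 0"
  proof -
    have q0: "0 \<le> quad0 h i j k l" if "{i, j, k, l} \<subseteq> insert z B" for i j k l
      using pos [of i j k l] that by (simp add: quad0_def)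
    have "quad0 h i j k l - quad0 h z j k l - quad0 h i z k l - quad0 h i j z l - quad0 h i j k z \<le> 0"
      if B: "i \<in> B" "j \<in> B" "k \<in> B" "l \<in> B" for i j k l
    proof (cases "distinct [i, j, k, l]")
      case True
      have "z \<noteq> i" "z \<noteq> j" "z \<noteq> k" "z \<noteq> l"
        using assms(2) B by auto
      then have "quad0 h z j k l = quad h z j k l" "quad0 h i z k l = quad h z i k l"
        "quad0 h i j z l = quad h z i j l" "quad0 h i j k z = quad h z i j k" "quad0 h i j k l = quad h i j k l"
        using True quad_front(1) [where h = h and j = i and i = z and k = k and l = l, OF sym]
          quad_front(2) [where h = h and j = i and k = j and i = z and l = l, OF sym]
          quad_front(3) [where h = h and j = i and k = j and l = k and i = z, OF sym]
        by (auto simp: quad0_def)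
      then show ?thesis
        using five [OF True] B by simp
    next
      case False
      then have "quad0 h i j k l = 0"
        unfolding quad0_def by (rule if_not_P)
      then show ?thesis
        using q0 [of z j k l] q0 [of i z k l] q0 [of i j z l] q0 [of i j k z] B by simp
    qed
    then show ?thesis
      unfolding sum4_def by (intro sum_nonpos mult_nonneg_nonpos mult_nonneg_nonneg x)
  qed
  finally show ?thesis .
qed

text \<open>The octopus inequality is half of the positivity of \<open>M\<close> for the weights \<open>y\<close>, which are \<open>x\<close>
  extended by minus their sum at the centre \<open>z\<close>.\<close>

theorem octopus:
  fixes u :: "('a \<Rightarrow> 'a) \<Rightarrow> real" and x :: "'a \<Rightarrow> real"
  assumes "finite B" "z \<notin> B" and x: "\<And>i. i \<in> B \<Longrightarrow> 0 \<le> x i"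
  defines "A \<equiv> insert z B"
  defines "h \<equiv> \<lambda>p. perm_ip A u (\<lambda>q. u (p \<circ> q))"
  shows "(\<Sum>i\<in>B. \<Sum>j\<in>B. x i * x j * (h id - h (transpose i j)))
    \<le> 2 * (\<Sum>i\<in>B. x i) * (\<Sum>i\<in>B. x i * (h id - h (transpose z i)))"
proof -
  define s where "s = (\<Sum>i\<in>B. x i)"
  define y where "y = x(z := - s)"
  define m where "m = (\<Sum>i\<in>A. \<Sum>j\<in>A. y i * y j * h (transpose i j))"
  define v where "v = (\<lambda>q. \<Sum>i\<in>A. \<Sum>j\<in>A. y i * y j * u (transpose i j \<circ> q))"
  have yB: "y i = x i" if "i \<in> B" for i
    using that assms(2) by (auto simp: y_def)
  have yz: "y z = - s"
    by (simp add: y_def)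
  have finA: "finite A" and zA: "z \<in> A" and BA: "B \<subseteq> A"
    using assms(1) by (auto simp: A_def)
  have y0: "(\<Sum>i\<in>A. y i) = 0"
    using assms(1,2) by (simp add: A_def yz yB s_def)
  have hh: "h p = perm_ip A u (\<lambda>q. u (p \<circ> q))" for p
    by (simp add: h_def)
  have hinv: "h p = h p'" if "p permutes A" "p' \<circ> p = id" for p p'
    unfolding h_def using that by (subst perm_ip_commute) (rule perm_ip_shift)
  have hip: "perm_ip A (\<lambda>q. u (transpose i j \<circ> q)) (\<lambda>q. u (transpose k l \<circ> q)) = h (transpose k l \<circ> transpose i j)"
    if "i \<in> A" "j \<in> A" for i j k l
    unfolding h_def using that
    by (subst perm_ip_shift [where p' = "transpose i j"]) (simp_all add: permutes_swap_id comp_assoc)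
  \<comment> \<open>The symmetry assumption on \<open>h\<close> ranges over all indices, but
    inverses are available only for permutations of \<open>A\<close>; hence the extension by
    0.\<close>
  define h' where "h' = (\<lambda>p. if p permutes A then h p else 0)"
  have h': "h' (transpose i j) = h (transpose i j)" "h' (transpose i j \<circ> transpose k l) = h (transpose i j \<circ> transpose k l)"
    if "i \<in> A" "j \<in> A" "k \<in> A" "l \<in> A" for i j k l
    using that by (auto simp: h'_def permutes_swap_id intro!: permutes_compose)
  have h'_id: "h' id = h id"
    by (simp add: h'_def permutes_id)
  have sym: "h' (transpose i j \<circ> transpose k l) = h' (transpose k l \<circ> transpose i j)" for i j k l
  proof -
    have 1: "transpose k l \<circ> transpose i j \<circ> (transpose i j \<circ> transpose k l) = id" for i j k l :: 'a
      by (simp add: fun_eq_iff)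
    have 2: "transpose k l \<circ> transpose i j permutes A" if "transpose i j \<circ> transpose k l permutes A" for i j k l
      using permutes_inv [OF that] inv_unique_comp [OF 1 1] by simp
    show ?thesis
      using 2 hinv [OF _ 1] by (auto simp: h'_def)
  qed
  \<comment> \<open>Here \<open>v\<close> is \<open>M u\<close>, so its square norm is the quadratic
    form of the square of \<open>M\<close>.\<close>
  have "perm_ip A v v = sum4 A y (\<lambda>i j k l. h' (transpose k l \<circ> transpose i j))"
    by (simp add: v_def perm_ip_left perm_ip_right sum4_def hip h' sum_distrib_left mult_ac)
  then have vv: "perm_ip A v v = sum4 A y (\<lambda>i j k l. h' (transpose i j \<circ> transpose k l))"
    using sym by simp
  have quad: "quad h' i j k l = perm_ip A u (alt4_op i j k l u)" if d: "distinct [i, j, k, l]" "{i, j, k, l} \<subseteq> A" for i j k l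
    unfolding perm_ip_alt4_op_expand [OF that] quad_def hh [symmetric]
    using that by (simp add: tri_def h' h'_id)
  have m': "m = (\<Sum>i\<in>A. \<Sum>j\<in>A. y i * y j * h' (transpose i j))"
    by (simp add: m_def h')
  have "sum4 A y (quad0 h') \<le> 0"
    unfolding A_def
  proof (rule sum4_quad0_nonpos [where h = h', OF assms(1,2) sym], unfold A_def [symmetric])
    fix i j k l
    assume "distinct [i, j, k, l]" "{i, j, k, l} \<subseteq> A"
    then show "0 \<le> quad h' i j k l"
      by (simp only: quad perm_ip_alt4_op_nonneg)
  next
    fix i j k l
    assume B: "distinct [i, j, k, l]" "{i, j, k, l} \<subseteq> B"
    have "distinct [z, i, j, k, l]" "{z, i, j, k, l} \<subseteq> A"
      using B assms(2) by (auto simp: A_def)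
    then show "quad h' i j k l \<le> quad h' z i j k + quad h' z i j l + quad h' z i k l + quad h' z j k l"
      using perm_ip_alt4_op_five [of z i j k l A u] by (simp add: quad)
  qed (simp_all add: yB x yz s_def)
  \<comment> \<open>By \<open>sum4_quad0\<close>, three times the square norm of \<open>v\<close> is
    at most \<open>6 * (\<Sum>i\<in>A. (y i)\<^sup>2) * m\<close>.\<close>
  then have 1: "0 \<le> (\<Sum>i\<in>A. (y i)\<^sup>2) * m"
    using perm_ip_nonneg [of A v] unfolding vv sum4_quad0 [where h = h', OF sym finA y0] m' by simp
  have "0 \<le> m"
  proof (cases "(\<Sum>i\<in>A. (y i)\<^sup>2) = 0")
    case True
    then have "\<forall>i\<in>A. y i = 0"
      using finA by (simp add: sum_nonneg_eq_0_iff)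
    then show ?thesis
      by (simp add: m_def)
  next
    case False
    then have "0 < (\<Sum>i\<in>A. (y i)\<^sup>2)"
      by (simp add: order_less_le sum_nonneg)
    then show ?thesis
      using 1 by (simp add: zero_le_mult_iff)
  qed
  \<comment> \<open>The pair of \<open>z\<close> with itself gives the first term, since
    \<open>transpose z z = id\<close>; the pairs with \<open>z\<close> once give the two middle
    terms.\<close>
  also have "m = s\<^sup>2 * h id - s * (\<Sum>i\<in>B. x i * h (transpose z i))
    - s * (\<Sum>i\<in>B. x i * h (transpose z i)) + (\<Sum>i\<in>B. \<Sum>j\<in>B. x i * x j * h (transpose i j))"
    using assms(1,2)
    by (simp add: m_def A_def yB yz sum.distrib sum_distrib_left power2_eq_square transpose_commute mult_ac
        sum_negf sum_subtractf)
  finally show ?thesis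
    by (simp add: s_def [symmetric] right_diff_distrib sum_subtractf sum_distrib_left [symmetric]
        sum_distrib_right [symmetric] power2_eq_square algebra_simps)
qed

section \<open>Minimal eigenvectors of Laplacians\<close>

text \<open>Generators \<open>s\<close> with rates \<open>\<alpha> s\<close> act through
  \<open>\<phi>\<close>. The particle and the permutation Laplacian are both instances, so that one
  existence result for eigenvectors serves them.\<close>

definition lap :: "'s set \<Rightarrow> ('s \<Rightarrow> real) \<Rightarrow> ('s \<Rightarrow> 'x \<Rightarrow> 'x) \<Rightarrow> ('x \<Rightarrow> real) \<Rightarrow> 'x \<Rightarrow> real"
  where "lap S \<alpha> \<phi> f x = (\<Sum>s\<in>S. \<alpha> s * (f x - f (\<phi> s x)))"

lemma linear_coeff_zero:
  fixes b q :: real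
  assumes "\<And>t. 0 \<le> 2 * t * b + t\<^sup>2 * q"
  shows "b = 0"
proof (rule ccontr)
  assume b: "b \<noteq> 0"
  \<comment> \<open>Chosen with \<open>e * q < 2\<close>: at \<open>t = - e * b\<close> the
    quadratic term cannot outweigh the linear one.\<close>
  define e where "e = 1 / (\<bar>q\<bar> + 1)"
  have e: "e > 0" "e * q < 2"
    by (simp_all add: e_def field_simps)
  have "0 \<le> e * b\<^sup>2 * (e * q - 2)"
    using assms [of "- e * b"] by (simp add: power2_eq_square algebra_simps)
  moreover have "e * b\<^sup>2 * (e * q - 2) < 0"
    using b e by (intro mult_pos_neg) auto
  ultimately show False by simp
qed

context
  fixes X :: "'x set" and S :: "'s set" and \<alpha> :: "'s \<Rightarrow> real" and \<phi> :: "'s \<Rightarrow> 'x \<Rightarrow> 'x"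
  assumes closed: "\<And>s x. s \<in> S \<Longrightarrow> x \<in> X \<Longrightarrow> \<phi> s x \<in> X"
    and invol: "\<And>s x. s \<in> S \<Longrightarrow> x \<in> X \<Longrightarrow> \<phi> s (\<phi> s x) = x"
begin

lemma sum_involution:
  fixes F :: "'x \<Rightarrow> real"
  assumes "s \<in> S"
  shows "(\<Sum>x\<in>X. F (\<phi> s x)) = (\<Sum>x\<in>X. F x)"
  by (rule sum.reindex_bij_witness [where i = "\<phi> s" and j = "\<phi> s"]) (use assms closed invol in auto)

lemma sum_lap: "(\<Sum>x\<in>X. lap S \<alpha> \<phi> f x) = 0"
  unfolding lap_def
  by (subst sum.swap) (simp add: sum_distrib_left [symmetric] sum_subtractf sum_involution)

text \<open>Each \<open>\<phi> s\<close> is an involution of \<open>X\<close>, so composition with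
  it is its own adjoint.\<close>

lemma lap_symmetric: "(\<Sum>x\<in>X. g x * lap S \<alpha> \<phi> f x) = (\<Sum>x\<in>X. lap S \<alpha> \<phi> g x * f x)"
proof -
  have "(\<Sum>x\<in>X. g x * (f x - f (\<phi> s x))) = (\<Sum>x\<in>X. (g x - g (\<phi> s x)) * f x)" if "s \<in> S" for s
  proof -
    have "(\<Sum>x\<in>X. g x * f (\<phi> s x)) = (\<Sum>x\<in>X. g (\<phi> s x) * f (\<phi> s (\<phi> s x)))"
      by (rule sum_involution [OF that, symmetric])
    also have "\<dots> = (\<Sum>x\<in>X. g (\<phi> s x) * f x)"
      using invol [OF that] by simp
    finally show ?thesis
      by (simp add: right_diff_distrib left_diff_distrib sum_subtractf)
  qed
  then have "(\<Sum>s\<in>S. \<alpha> s * (\<Sum>x\<in>X. g x * (f x - f (\<phi> s x)))) = (\<Sum>s\<in>S. \<alpha> s * (\<Sum>x\<in>X. (g x - g (\<phi> s x)) * f x))"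
    by (intro sum.cong) simp_all
  then show ?thesis
    unfolding lap_def sum_distrib_left sum_distrib_right
    by (subst (1 2) sum.swap) (simp add: mult_ac)
qed

text \<open>The energy attains its minimum on the compact unit sphere of functions with sum zero,
  and the first variation shows that a minimiser is an eigenvector. The two points \<open>a\<close>
  and \<open>b\<close> make the sphere nonempty.\<close>

lemma lap_min_eigenvector:
  assumes fin: "finite X" and ab: "a \<in> X" "b \<in> X" "a \<noteq> b"
  obtains u r where "\<And>x. x \<notin> X \<Longrightarrow> u x = 0" "(\<Sum>x\<in>X. u x) = 0" "\<exists>x\<in>X. u x \<noteq> 0"
    "\<And>x. x \<in> X \<Longrightarrow> lap S \<alpha> \<phi> u x = r * u x"
    "\<And>v. (\<Sum>x\<in>X. v x) = 0 \<Longrightarrow> r * (\<Sum>x\<in>X. (v x)\<^sup>2) \<le> (\<Sum>x\<in>X. v x * lap S \<alpha> \<phi> v x)"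
proof -
  define E where "E f = (\<Sum>x\<in>X. f x * lap S \<alpha> \<phi> f x)" for f
  \<comment> \<open>A box that is trivial outside \<open>X\<close>: it is compact by Tychonoff's
    theorem, although the functions live on the whole type.\<close>
  define P where "P = PiE UNIV (\<lambda>x. if x \<in> X then {-1..1} else {0::real})"
  define K where "K = {f\<in>P. (\<Sum>x\<in>X. f x) = 0 \<and> (\<Sum>x\<in>X. (f x)\<^sup>2) = 1}"
  have "compactin (product_topology (\<lambda>_. euclidean) UNIV) P"
    unfolding P_def by (subst compactin_PiE) auto
  then have P: "compact P"
    by (simp add: euclidean_product_topology)
  have cont: "continuous_on T (\<lambda>f::'x \<Rightarrow> real. f x)" for T x
    by (rule continuous_on_subset [OF continuous_on_product_coordinates]) simp
  have "closed ((\<lambda>f. \<Sum>x\<in>X. f x) -` {0::real} \<inter> UNIV)" "closed ((\<lambda>f. \<Sum>x\<in>X. (f x)\<^sup>2) -` {1::real} \<inter> UNIV)"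
    by (intro continuous_closed_vimage closed_vimage_Int continuous_intros cont closed_UNIV; simp)+
  then have "compact (P \<inter> ((\<lambda>f. \<Sum>x\<in>X. f x) -` {0::real} \<inter> UNIV) \<inter> ((\<lambda>f. \<Sum>x\<in>X. (f x)\<^sup>2) -` {1::real} \<inter> UNIV))"
    using P by (intro compact_Int_closed)
  also have "P \<inter> ((\<lambda>f. \<Sum>x\<in>X. f x) -` {0::real} \<inter> UNIV) \<inter> ((\<lambda>f. \<Sum>x\<in>X. (f x)\<^sup>2) -` {1::real} \<inter> UNIV) = K"
    by (auto simp: K_def)
  finally have K: "compact K" .
  have scale: "(\<lambda>x. if x \<in> X then v x / sqrt (\<Sum>x\<in>X. (v x)\<^sup>2) else 0) \<in> K"
    if v: "(\<Sum>x\<in>X. v x) = 0" "(\<Sum>x\<in>X. (v x)\<^sup>2) \<noteq> 0" for v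
  proof -
    define N where "N = (\<Sum>x\<in>X. (v x)\<^sup>2)"
    have N: "N > 0"
      using v(2) by (simp add: N_def order_less_le sum_nonneg)
    have "\<bar>v x\<bar> \<le> sqrt N" if "x \<in> X" for x
      using member_le_sum [OF that, of "\<lambda>x. (v x)\<^sup>2"] fin by (simp add: N_def real_le_rsqrt)
    then have "\<bar>v x / sqrt N\<bar> \<le> 1" if "x \<in> X" for x
      using that N by simp
    then have "- 1 \<le> v x / sqrt N \<and> v x / sqrt N \<le> 1" if "x \<in> X" for x
      using that by (simp only: abs_le_iff minus_le_iff)
    then have "(\<lambda>x. if x \<in> X then v x / sqrt N else 0) \<in> P"
      by (auto simp: P_def)
    moreover have "(\<Sum>x\<in>X. v x / sqrt N) = 0" "(\<Sum>x\<in>X. (v x / sqrt N)\<^sup>2) = 1"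
      using v N by (simp_all add: sum_divide_distrib [symmetric] power_divide N_def [symmetric])
    ultimately show ?thesis
      unfolding N_def [symmetric] by (simp add: K_def)
  qed
  \<comment> \<open>The difference of two point masses; after scaling it lies in
    \<open>K\<close>.\<close>
  define d where "d x = (if x = a then 1 else if x = b then - 1 else 0 :: real)" for x
  have "(\<Sum>x\<in>X. d x) = (\<Sum>x\<in>{a, b}. d x)" "(\<Sum>x\<in>X. (d x)\<^sup>2) = (\<Sum>x\<in>{a, b}. (d x)\<^sup>2)"
    by (rule sum.mono_neutral_right; use fin ab in \<open>auto simp: d_def\<close>)+
  moreover have "(\<Sum>x\<in>{a, b}. d x) = 0" "(\<Sum>x\<in>{a, b}. (d x)\<^sup>2) \<noteq> 0"
    using ab by (simp_all add: d_def)
  ultimately have "K \<noteq> {}"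
    using scale [of d] by auto
  moreover have "continuous_on K E"
    unfolding E_def lap_def by (intro continuous_intros cont)
  ultimately obtain u where u: "u \<in> K" "\<And>v. v \<in> K \<Longrightarrow> E u \<le> E v"
    using continuous_attains_inf [OF K] by metis
  have E_scale: "E (\<lambda>x. if x \<in> X then v x / c else 0) = E v / c\<^sup>2" for v c
    using closed
    by (simp add: E_def lap_def sum_divide_distrib power2_eq_square diff_divide_distrib sum_distrib_left right_diff_distrib)
  have min: "E u * (\<Sum>x\<in>X. (v x)\<^sup>2) \<le> E v" if v: "(\<Sum>x\<in>X. v x) = 0" for v
  proof (cases "(\<Sum>x\<in>X. (v x)\<^sup>2) = 0")
    case True
    then have "v x = 0" if "x \<in> X" for x
      using fin that by (simp add: sum_nonneg_eq_0_iff)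
    then show ?thesis
      by (simp add: E_def)
  next
    case False
    then have "0 < (\<Sum>x\<in>X. (v x)\<^sup>2)"
      by (simp add: order_less_le sum_nonneg)
    then show ?thesis
      using u(2) [OF scale [OF v False]] by (simp add: E_scale field_simps)
  qed
  have u0: "(\<Sum>x\<in>X. u x) = 0" and u1: "(\<Sum>x\<in>X. (u x)\<^sup>2) = 1"
    using u(1) by (auto simp: K_def)
  \<comment> \<open>The residual has sum zero, so \<open>u x + t * v x\<close> is admissible for
    every \<open>t\<close>. In the resulting quadratic inequality the linear coefficient is twice
    the square sum of \<open>v\<close>, which must therefore vanish.\<close>
  define v where "v x = lap S \<alpha> \<phi> u x - E u * u x" for x
  have lapu: "lap S \<alpha> \<phi> u x = v x + E u * u x" for x
    by (simp add: v_def)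
  have v0: "(\<Sum>x\<in>X. v x) = 0"
    by (simp add: v_def sum_subtractf sum_lap sum_distrib_left [symmetric] u0)
  have "0 \<le> 2 * t * (\<Sum>x\<in>X. v x * v x) + t\<^sup>2 * (E v - E u * (\<Sum>x\<in>X. (v x)\<^sup>2))" for t
  proof -
    have l: "lap S \<alpha> \<phi> (\<lambda>x. u x + t * v x) x = lap S \<alpha> \<phi> u x + t * lap S \<alpha> \<phi> v x" for x
      by (simp add: lap_def sum.distrib [symmetric] sum_distrib_left algebra_simps)
    have "E (\<lambda>x. u x + t * v x) = E u + t * (\<Sum>x\<in>X. v x * lap S \<alpha> \<phi> u x) + t * (\<Sum>x\<in>X. u x * lap S \<alpha> \<phi> v x) + t\<^sup>2 * E v"
      unfolding E_def l by (simp add: sum_distrib_left sum.distrib algebra_simps power2_eq_square)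
    also have "(\<Sum>x\<in>X. u x * lap S \<alpha> \<phi> v x) = (\<Sum>x\<in>X. v x * lap S \<alpha> \<phi> u x)"
      unfolding lap_symmetric [of u v] by (simp add: mult.commute)
    also have "(\<Sum>x\<in>X. v x * lap S \<alpha> \<phi> u x) = (\<Sum>x\<in>X. v x * v x) + E u * (\<Sum>x\<in>X. v x * u x)"
      by (simp add: lapu algebra_simps sum.distrib sum_distrib_left)
    finally have "E (\<lambda>x. u x + t * v x)
        = E u + 2 * t * ((\<Sum>x\<in>X. v x * v x) + E u * (\<Sum>x\<in>X. v x * u x)) + t\<^sup>2 * E v"
      by simp
    moreover have "(\<Sum>x\<in>X. (u x + t * v x)\<^sup>2) = (\<Sum>x\<in>X. (u x)\<^sup>2) + 2 * t * (\<Sum>x\<in>X. v x * u x) + t\<^sup>2 * (\<Sum>x\<in>X. (v x)\<^sup>2)"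
      by (simp add: power2_eq_square algebra_simps sum.distrib sum_distrib_left)
    moreover have "E u * (\<Sum>x\<in>X. (u x + t * v x)\<^sup>2) \<le> E (\<lambda>x. u x + t * v x)"
      by (rule min) (simp add: sum.distrib u0 v0 sum_distrib_left [symmetric])
    ultimately show ?thesis
      by (simp add: u1 algebra_simps)
  qed
  then have "(\<Sum>x\<in>X. v x * v x) = 0"
    by (rule linear_coeff_zero)
  then have "lap S \<alpha> \<phi> u x = E u * u x" if "x \<in> X" for x
    using fin that by (simp add: sum_nonneg_eq_0_iff v_def)
  moreover have "u x = 0" if "x \<notin> X" for x
  proof -
    have "u x \<in> (if x \<in> X then {-1..1} else {0})"
      using u(1) by (auto simp only: K_def P_def PiE_iff)
    then show ?thesis
      using that by simp
  qed
  moreover have "\<exists>x\<in>X. u x \<noteq> 0"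
  proof (rule ccontr)
    assume "\<not> (\<exists>x\<in>X. u x \<noteq> 0)"
    then show False using u1 by simp
  qed
  ultimately show thesis
    using that [of u "E u"] u0 min by (simp add: E_def)
qed

end

section \<open>The interchange process\<close>

text \<open>All ordered pairs are summed, so with symmetric rates an unordered pair counts twice;
  the weights \<open>b\<close> of the wreath product are halved accordingly.\<close>

definition point_lap :: "'a set \<Rightarrow> ('a \<Rightarrow> 'a \<Rightarrow> real) \<Rightarrow> ('a \<Rightarrow> real) \<Rightarrow> 'a \<Rightarrow> real"
  where "point_lap A a = lap (A \<times> A) (\<lambda>(i, j). a i j) (\<lambda>(i, j). transpose i j)"

definition perm_lap :: "'a set \<Rightarrow> ('a \<Rightarrow> 'a \<Rightarrow> real) \<Rightarrow> (('a \<Rightarrow> 'a) \<Rightarrow> real) \<Rightarrow> ('a \<Rightarrow> 'a) \<Rightarrow> real"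
  where "perm_lap A a = lap (A \<times> A) (\<lambda>(i, j). a i j) (\<lambda>(i, j) p. transpose i j \<circ> p)"

lemma point_lap_eq: "point_lap A a u x = (\<Sum>i\<in>A. \<Sum>j\<in>A. a i j * (u x - u (transpose i j x)))"
  by (simp add: point_lap_def lap_def sum.cartesian_product case_prod_unfold)

lemma perm_lap_eq: "perm_lap A a f p = (\<Sum>i\<in>A. \<Sum>j\<in>A. a i j * (f p - f (transpose i j \<circ> p)))"
  by (simp add: perm_lap_def lap_def sum.cartesian_product case_prod_unfold)

text \<open>For a pair \<open>i, j\<close> only the points \<open>i\<close> and \<open>j\<close>
  contribute, and together they give the square.\<close>

lemma point_energy:
  assumes "finite A"
  shows "(\<Sum>x\<in>A. u x * point_lap A a u x) = (\<Sum>i\<in>A. \<Sum>j\<in>A. a i j * (u i - u j)\<^sup>2)"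
proof -
  have *: "(\<Sum>x\<in>A. u x * (u x - u (transpose i j x))) = (u i - u j)\<^sup>2" if "i \<in> A" "j \<in> A" for i j
  proof -
    have "(\<Sum>x\<in>A. u x * (u x - u (transpose i j x))) = (\<Sum>x\<in>{i, j}. u x * (u x - u (transpose i j x)))"
      using assms that by (intro sum.mono_neutral_right) auto
    then show ?thesis
      by (cases "i = j") (simp_all add: power2_eq_square algebra_simps)
  qed
  have "(\<Sum>x\<in>A. u x * point_lap A a u x) = (\<Sum>x\<in>A. \<Sum>i\<in>A. \<Sum>j\<in>A. a i j * (u x * (u x - u (transpose i j x))))"
    by (simp add: point_lap_eq sum_distrib_left mult_ac)
  also have "\<dots> = (\<Sum>i\<in>A. \<Sum>j\<in>A. \<Sum>x\<in>A. a i j * (u x * (u x - u (transpose i j x))))"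
    by (subst sum.swap, rule sum.cong [OF refl], rule sum.swap)
  also have "\<dots> = (\<Sum>i\<in>A. \<Sum>j\<in>A. a i j * (u i - u j)\<^sup>2)"
    by (intro sum.cong refl) (simp add: sum_distrib_left [symmetric] *)
  finally show ?thesis .
qed

text \<open>The generators come from \<open>B\<close>, the functions live on permutations of
  \<open>A\<close>: the energies before and after the removal of a point are thus compared on the
  same space.\<close>

lemma perm_energy:
  "(\<Sum>p | p permutes A. f p * perm_lap B a f p)
    = (\<Sum>i\<in>B. \<Sum>j\<in>B. a i j * (perm_ip A f f - perm_ip A f (\<lambda>p. f (transpose i j \<circ> p))))"
proof -
  have "(\<Sum>p | p permutes A. f p * perm_lap B a f p)
      = (\<Sum>p | p permutes A. \<Sum>i\<in>B. \<Sum>j\<in>B. a i j * (f p * (f p - f (transpose i j \<circ> p))))"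
    by (simp add: perm_lap_eq sum_distrib_left mult_ac)
  also have "\<dots> = (\<Sum>i\<in>B. \<Sum>j\<in>B. \<Sum>p | p permutes A. a i j * (f p * (f p - f (transpose i j \<circ> p))))"
    by (subst sum.swap, rule sum.cong [OF refl], rule sum.swap)
  finally show ?thesis
    by (simp add: sum_distrib_left [symmetric] perm_ip_def right_diff_distrib sum_subtractf)
qed

text \<open>The network reduction: eliminating a vertex by harmonic extension of functions.
  If \<open>z\<close> is isolated then \<open>s = 0\<close>, so that the quotients by \<open>s\<close> vanish.\<close>

lemma gap_reduction:
  fixes a :: "'a \<Rightarrow> 'a \<Rightarrow> real"
  assumes B: "finite B" "z \<notin> B" and "0 \<le> \<gamma>"
    and nonneg: "\<And>i j. i \<in> insert z B \<Longrightarrow> j \<in> insert z B \<Longrightarrow> 0 \<le> a i j"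
    and sym: "\<And>i j. a i j = a j i"
    and gap: "\<And>u. (\<Sum>x\<in>insert z B. u x) = 0 \<Longrightarrow>
      \<gamma> * (\<Sum>x\<in>insert z B. (u x)\<^sup>2) \<le> (\<Sum>i\<in>insert z B. \<Sum>j\<in>insert z B. a i j * (u i - u j)\<^sup>2)"
    and v: "(\<Sum>x\<in>B. v x) = 0"
  defines "s \<equiv> \<Sum>i\<in>B. a z i"
  shows "\<gamma> * (\<Sum>x\<in>B. (v x)\<^sup>2) \<le> (\<Sum>i\<in>B. \<Sum>j\<in>B. (a i j + a z i * a z j / s) * (v i - v j)\<^sup>2)"
proof -
  \<comment> \<open>The harmonic value at \<open>z\<close>: the mean of \<open>v\<close> with
    weights \<open>a z i\<close>, or 0 if \<open>s = 0\<close>.\<close>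
  define t where "t = (\<Sum>i\<in>B. a z i * v i) / s"
  define n where "n = real (card (insert z B))"
  \<comment> \<open>Since \<open>v\<close> has sum zero, \<open>t / n\<close> is the mean of the
    extension; subtracting it makes \<open>gap\<close> applicable.\<close>
  define w where "w = (\<lambda>x. (if x = z then t else v x) - t / n)"
  have n: "n \<ge> 1" "n = 1 + real (card B)"
    using B by (simp_all add: n_def)
  have wB: "w i = v i - t / n" if "i \<in> B" for i
    using that B by (auto simp: w_def)
  have wz: "w z = t - t / n"
    by (simp add: w_def)
  have w0: "(\<Sum>x\<in>insert z B. w x) = 0"
  proof -
    have "(\<Sum>x\<in>insert z B. w x) = (t - t / n) + ((\<Sum>x\<in>B. v x) - real (card B) * (t / n))"
      using B by (simp add: wB wz sum_subtractf)
    also have "\<dots> = 0"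
      using v n by (simp add: field_simps)
    finally show ?thesis .
  qed
  have "(\<Sum>x\<in>insert z B. (w x)\<^sup>2) = (t - t / n)\<^sup>2 + (\<Sum>x\<in>B. (v x)\<^sup>2) - 2 * (t / n) * (\<Sum>x\<in>B. v x) + (n - 1) * (t / n)\<^sup>2"
  proof -
    have "(\<Sum>x\<in>B. (v x - c)\<^sup>2) = (\<Sum>x\<in>B. (v x)\<^sup>2) - 2 * c * (\<Sum>x\<in>B. v x) + real (card B) * c\<^sup>2" for c
      by (simp add: power2_diff sum.distrib sum_subtractf sum_distrib_left sum_distrib_right mult_ac)
    then show ?thesis
      using B n by (simp add: wB wz)
  qed
  also have "\<dots> = (\<Sum>x\<in>B. (v x)\<^sup>2) + t\<^sup>2 * (1 - 1 / n)"
    using n(1) v by (simp add: power2_eq_square field_simps)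
  \<comment> \<open>Extension and recentring together add \<open>t\<^sup>2 * (1 - 1 / n)\<close>,
    which is nonnegative.\<close>
  finally have w2: "(\<Sum>x\<in>B. (v x)\<^sup>2) \<le> (\<Sum>x\<in>insert z B. (w x)\<^sup>2)"
    using n by simp
  \<comment> \<open>The star-mesh identity. The half compensates for counting ordered pairs in the
    mesh.\<close>
  have azz: "(\<Sum>i\<in>B. a z i * (t - v i)\<^sup>2) = (\<Sum>i\<in>B. \<Sum>j\<in>B. a z i * a z j / s * (v i - v j)\<^sup>2) / 2"
  proof (cases "s = 0")
    case True
    then have "a z i = 0" if "i \<in> B" for i
      using that B nonneg by (simp add: s_def sum_nonneg_eq_0_iff)
    then show ?thesis by simp
  next
    case False
    have "(\<Sum>i\<in>B. a z i * (t - v i)\<^sup>2) = t\<^sup>2 * s - 2 * t * (\<Sum>i\<in>B. a z i * v i) + (\<Sum>i\<in>B. a z i * (v i)\<^sup>2)"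
      by (simp add: s_def power2_diff algebra_simps sum.distrib sum_subtractf sum_distrib_left sum_distrib_right)
    also have "(\<Sum>i\<in>B. a z i * v i) = s * t"
      using False by (simp add: t_def)
    finally have 1: "(\<Sum>i\<in>B. a z i * (t - v i)\<^sup>2) = (\<Sum>i\<in>B. a z i * (v i)\<^sup>2) - s * t\<^sup>2"
      by (simp add: power2_eq_square)
    have "(\<Sum>i\<in>B. \<Sum>j\<in>B. a z i * a z j * (v i - v j)\<^sup>2)
        = s * (\<Sum>i\<in>B. a z i * (v i)\<^sup>2) - 2 * ((\<Sum>i\<in>B. a z i * v i) * (\<Sum>i\<in>B. a z i * v i)) + s * (\<Sum>i\<in>B. a z i * (v i)\<^sup>2)"
      unfolding s_def sum_product
      by (subst (3) sum.swap)
        (simp add: power2_diff power2_eq_square algebra_simps sum.distrib sum_subtractf sum_distrib_left)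
    also have "\<dots> = 2 * s * ((\<Sum>i\<in>B. a z i * (v i)\<^sup>2) - s * t\<^sup>2)"
      using False by (simp add: t_def power2_eq_square algebra_simps)
    finally have "(\<Sum>i\<in>B. \<Sum>j\<in>B. a z i * a z j / s * (v i - v j)\<^sup>2) = 2 * ((\<Sum>i\<in>B. a z i * (v i)\<^sup>2) - s * t\<^sup>2)"
      using False by (simp add: sum_divide_distrib [symmetric] field_simps)
    then show ?thesis
      using 1 by simp
  qed
  have "\<gamma> * (\<Sum>x\<in>B. (v x)\<^sup>2) \<le> \<gamma> * (\<Sum>x\<in>insert z B. (w x)\<^sup>2)"
    by (rule mult_left_mono [OF w2 \<open>0 \<le> \<gamma>\<close>])
  also have "\<dots> \<le> (\<Sum>i\<in>insert z B. \<Sum>j\<in>insert z B. a i j * (w i - w j)\<^sup>2)"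
    by (rule gap [OF w0])
  also have "\<dots> = (\<Sum>i\<in>B. \<Sum>j\<in>B. a i j * (v i - v j)\<^sup>2) + 2 * (\<Sum>i\<in>B. a z i * (t - v i)\<^sup>2)"
  proof -
    have "a i z = a z i" "(w i - w z)\<^sup>2 = (t - v i)\<^sup>2" "(w z - w i)\<^sup>2 = (t - v i)\<^sup>2" if "i \<in> B" for i
      using that sym [of i z] power2_commute [of "v i" t] by (simp_all add: wB wz)
    then show ?thesis
      using B by (simp add: wB sum.distrib)
  qed
  also have "\<dots> = (\<Sum>i\<in>B. \<Sum>j\<in>B. (a i j + a z i * a z j / s) * (v i - v j)\<^sup>2)"
    unfolding azz by (simp add: distrib_right sum.distrib)
  finally show ?thesis .
qed

section \<open>One-particle projections and cosets of point stabilisers\<close>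

text \<open>The function \<open>g\<close> is the push-forward of \<open>u\<close> along
  \<open>p \<mapsto> p k\<close>. Since
  \<open>(transpose l m \<circ> p) k = transpose l m (p k)\<close>, the push-forward intertwines the
  two Laplacians.\<close>

lemma point_projection:
  fixes u :: "('a \<Rightarrow> 'a) \<Rightarrow> real"
  assumes "finite A" "k \<in> A"
  defines "g \<equiv> \<lambda>i. \<Sum>p | p permutes A. if p k = i then u p else 0"
  shows "(\<Sum>i\<in>A. g i) = (\<Sum>p | p permutes A. u p)"
    "point_lap A a g i = (\<Sum>p | p permutes A. if p k = i then perm_lap A a u p else 0)"
proof -
  show "(\<Sum>i\<in>A. g i) = (\<Sum>p | p permutes A. u p)"
    unfolding g_def using assms(1,2)
    by (subst sum.swap) (auto simp: sum.delta permutes_in_image intro!: sum.cong)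
  have *: "g (transpose l m i) = (\<Sum>p | p permutes A. if p k = i then u (transpose l m \<circ> p) else 0)"
    if "l \<in> A" "m \<in> A" for l m
  proof -
    have "g (transpose l m i) = (\<Sum>p | p permutes A. if (transpose l m \<circ> p) k = transpose l m i then u (transpose l m \<circ> p) else 0)"
      unfolding g_def by (rule setum_permutations_compose_left) (simp add: permutes_swap_id that)
    also have "\<dots> = (\<Sum>p | p permutes A. if p k = i then u (transpose l m \<circ> p) else 0)"
      by (rule sum.cong [OF refl]) (auto dest: transpose_eq_imp_eq)
    finally show ?thesis .
  qed
  have d: "g i - g (transpose l m i) = (\<Sum>p | p permutes A. if p k = i then u p - u (transpose l m \<circ> p) else 0)"
    if "l \<in> A" "m \<in> A" for l m
    unfolding * [OF that] unfolding g_def sum_subtractf [symmetric]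
    by (rule sum.cong) auto
  have "point_lap A a g i = (\<Sum>l\<in>A. \<Sum>m\<in>A. \<Sum>p | p permutes A. if p k = i then a l m * (u p - u (transpose l m \<circ> p)) else 0)"
    unfolding point_lap_eq
    by (intro sum.cong refl, simp only: d sum_distrib_left, intro sum.cong refl) simp
  also have "\<dots> = (\<Sum>p | p permutes A. \<Sum>l\<in>A. \<Sum>m\<in>A. if p k = i then a l m * (u p - u (transpose l m \<circ> p)) else 0)"
    by (subst (2) sum.swap, subst sum.swap) (rule refl)
  also have "\<dots> = (\<Sum>p | p permutes A. if p k = i then perm_lap A a u p else 0)"
    by (intro sum.cong refl) (simp add: perm_lap_eq)
  finally show "point_lap A a g i = (\<Sum>p | p permutes A. if p k = i then perm_lap A a u p else 0)" .
qed

text \<open>The coset through \<open>q\<close> consists of the permutations that send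
  \<open>inv' q z\<close> to \<open>z\<close>, so its sum is a value of a one-particle
  projection.\<close>

lemma sum_stabilizer_coset:
  assumes "q permutes insert z B" "z \<notin> B"
  shows "(\<Sum>p | p permutes B. u (p \<circ> q)) = (\<Sum>p | p permutes insert z B \<and> p (inv' q z) = z. u p)"
proof (rule sum.reindex_bij_witness [where i = "\<lambda>p. p \<circ> inv' q" and j = "\<lambda>p. p \<circ> q"])
  have q: "q \<circ> inv' q = id" "inv' q \<circ> q = id"
    using permutes_inv_o [OF assms(1)] by simp_all
  show "p \<circ> q \<circ> inv' q = p" "p \<circ> inv' q \<circ> q = p" for p
    using q by (simp_all add: comp_assoc)
  show "p \<circ> q \<in> {p. p permutes insert z B \<and> p (inv' q z) = z}" if "p \<in> {p. p permutes B}" for p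
  proof -
    have "p permutes insert z B" "p z = z"
      using that assms(2) by (auto intro: permutes_subset dest: permutes_not_in)
    then show ?thesis
      using assms(1) by (simp add: permutes_compose permutes_inverses)
  qed
  show "p \<circ> inv' q \<in> {p. p permutes B}" if "p \<in> {p. p permutes insert z B \<and> p (inv' q z) = z}" for p
  proof -
    have "p \<circ> inv' q permutes insert z B" "(p \<circ> inv' q) z = z"
      using that assms(1) by (simp_all add: permutes_compose permutes_inv)
    then have "p \<circ> inv' q permutes B"
      by (auto intro: permutes_superset)
    then show ?thesis by simp
  qed
qed simp

lemma sum_perm_average:
  fixes F :: "('a \<Rightarrow> 'a) \<Rightarrow> real"
  assumes "B \<subseteq> A"
  shows "(\<Sum>q | q permutes A. \<Sum>p | p permutes B. F (p \<circ> q)) = real (card {p. p permutes B}) * (\<Sum>q | q permutes A. F q)"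
proof -
  have "(\<Sum>q | q permutes A. F (p \<circ> q)) = (\<Sum>q | q permutes A. F q)" if "p permutes B" for p
    using setum_permutations_compose_left [OF permutes_subset [OF that assms], of F] by simp
  then show ?thesis
    by (subst sum.swap) simp
qed

text \<open>The bound is stated for any \<gamma> below the one-particle gap, so that the induction
  hypothesis applies to the reduced weights with the same \<gamma>.\<close>

theorem caputo_liggett_richthammer:
  fixes a :: "'a \<Rightarrow> 'a \<Rightarrow> real"
  assumes "finite A" "0 \<le> \<gamma>"
    and "\<And>i j. i \<in> A \<Longrightarrow> j \<in> A \<Longrightarrow> 0 \<le> a i j"
    and "\<And>i j. a i j = a j i"
    and "\<And>u. (\<Sum>x\<in>A. u x) = 0 \<Longrightarrow>
      \<gamma> * (\<Sum>x\<in>A. (u x)\<^sup>2) \<le> (\<Sum>i\<in>A. \<Sum>j\<in>A. a i j * (u i - u j)\<^sup>2)"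
    and "(\<Sum>p | p permutes A. f p) = 0"
  shows "\<gamma> * (\<Sum>p | p permutes A. (f p)\<^sup>2) \<le> (\<Sum>p | p permutes A. f p * perm_lap A a f p)"
  using assms(1,3-)
proof (induction A arbitrary: a f rule: finite_induct)
  case empty
  then show ?case by (simp add: perm_lap_eq)
next
  case (insert z B)
  let ?A = "insert z B"
  show ?case
  proof (cases "B = {}")
    case True
    then show ?thesis
      using insert.prems(4) by (simp add: perm_lap_eq)
  next
    case False
    then obtain b where b: "b \<in> B" by blast
    have closed: "\<And>s p. s \<in> ?A \<times> ?A \<Longrightarrow> p \<in> {p. p permutes ?A} \<Longrightarrow> (case s of (i, j) \<Rightarrow> \<lambda>p. transpose i j \<circ> p) p \<in> {p. p permutes ?A}"
      by (auto intro!: permutes_compose permutes_swap_id)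
    have invol: "\<And>s p. s \<in> ?A \<times> ?A \<Longrightarrow> p \<in> {p. p permutes ?A} \<Longrightarrow>
        (case s of (i, j) \<Rightarrow> \<lambda>p. transpose i j \<circ> p) ((case s of (i, j) \<Rightarrow> \<lambda>p. transpose i j \<circ> p) p) = p"
      by (auto simp: fun_eq_iff)
    have fin: "finite {p. p permutes ?A}"
      using insert.hyps by (simp add: finite_permutations)
    have ids: "id \<in> {p. p permutes ?A}" "transpose z b \<in> {p. p permutes ?A}" "id \<noteq> transpose z b"
      using insert.hyps b by (auto simp: permutes_id permutes_swap_id dest!: fun_cong [of id _ z])
    note eigenvector = lap_min_eigenvector [where a = id and b = "transpose z b" and \<alpha> = "\<lambda>(i, j). a i j"
        and \<phi> = "\<lambda>(i, j) p. transpose i j \<circ> p" and S = "?A \<times> ?A" and X = "{p. p permutes ?A}",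
        OF closed invol fin ids, folded perm_lap_def]
    obtain u r where u0: "(\<Sum>p | p permutes ?A. u p) = 0" and u: "\<exists>p\<in>{p. p permutes ?A}. u p \<noteq> 0"
      and eig': "\<And>p. p \<in> {p. p permutes ?A} \<Longrightarrow> perm_lap ?A a u p = r * u p"
      and min: "\<And>v. (\<Sum>p | p permutes ?A. v p) = 0 \<Longrightarrow>
        r * (\<Sum>p | p permutes ?A. (v p)\<^sup>2) \<le> (\<Sum>p | p permutes ?A. v p * perm_lap ?A a v p)"
      by (rule eigenvector; (assumption | (rule that; assumption)))
    then have eig: "\<And>p. p permutes ?A \<Longrightarrow> perm_lap ?A a u p = r * u p"
      by simp
    have u2: "(\<Sum>p | p permutes ?A. (u p)\<^sup>2) > 0"
      using u fin by (auto intro!: sum_pos2)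
    \<comment> \<open>By \<open>min\<close> it suffices to bound the eigenvalue \<open>r\<close> of
      the minimiser \<open>u\<close>.\<close>
    have "\<gamma> \<le> r"
    proof (cases "\<exists>k\<in>?A. \<exists>i\<in>?A. (\<Sum>p | p permutes ?A. if p k = i then u p else 0) \<noteq> 0")
      case True
      then obtain k i where k: "k \<in> ?A" and i: "i \<in> ?A" "(\<Sum>p | p permutes ?A. if p k = i then u p else 0) \<noteq> 0"
        by blast
      \<comment> \<open>A nonzero one-particle projection is an eigenvector of the particle
        Laplacian for the same \<open>r\<close>.\<close>
      define g where "g = (\<lambda>i. \<Sum>p | p permutes ?A. if p k = i then u p else 0)"
      have finA: "finite ?A"
        using insert.hyps by simp
      have g0: "(\<Sum>i\<in>?A. g i) = 0"
        unfolding g_def using point_projection(1) [OF finA k] u0 by simp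
      have lapg: "point_lap ?A a g i = r * g i" for i
        unfolding g_def point_projection(2) [OF finA k] sum_distrib_left
        by (intro sum.cong refl) (simp add: eig)
      have "\<gamma> * (\<Sum>x\<in>?A. (g x)\<^sup>2) \<le> (\<Sum>x\<in>?A. g x * point_lap ?A a g x)"
        unfolding point_energy [OF finA] by (rule insert.prems(3) [OF g0])
      also have "\<dots> = r * (\<Sum>x\<in>?A. (g x)\<^sup>2)"
        by (simp only: lapg) (simp add: sum_distrib_left power2_eq_square mult_ac)
      finally have "\<gamma> * (\<Sum>x\<in>?A. (g x)\<^sup>2) \<le> r * (\<Sum>x\<in>?A. (g x)\<^sup>2)" .
      moreover have "(\<Sum>x\<in>?A. (g x)\<^sup>2) > 0"
        using i finA by (intro sum_pos2 [of _ i]) (auto simp: g_def)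
      ultimately show ?thesis by simp
    next
      case False
      define s where "s = (\<Sum>i\<in>B. a z i)"
      define a' where "a' i j = a i j + a z i * a z j / s" for i j
      define h where "h = (\<lambda>p. perm_ip ?A u (\<lambda>q. u (p \<circ> q)))"
      have h: "perm_ip ?A u (\<lambda>q. u (p \<circ> q)) = h p" for p
        by (simp add: h_def)
      have h_id: "perm_ip ?A u u = h id"
        by (simp add: h_def)
      define N where "N = real (card {p. p permutes B})"
      have N: "N > 0"
        using insert.hyps by (auto simp: N_def card_gt_0_iff finite_permutations intro: exI [of _ id] permutes_id)
      have s: "0 \<le> s" "\<And>i. i \<in> B \<Longrightarrow> 0 \<le> a z i"
        using insert.prems(1) by (auto simp: s_def intro: sum_nonneg)
      \<comment> \<open>The octopus inequality divided by \<open>s\<close>; if \<open>s = 0\<close>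
        then all weights at \<open>z\<close> vanish.\<close>
      have star: "(\<Sum>i\<in>B. \<Sum>j\<in>B. a z i * a z j / s * (h id - h (transpose i j))) \<le> 2 * (\<Sum>i\<in>B. a z i * (h id - h (transpose z i)))"
      proof (cases "s = 0")
        case True
        then have "a z i = 0" if "i \<in> B" for i
          using that insert.hyps s by (simp add: s_def sum_nonneg_eq_0_iff)
        then show ?thesis by simp
      next
        case False
        then have "0 < s" using s by simp
        moreover have "(\<Sum>i\<in>B. \<Sum>j\<in>B. a z i * a z j * (h id - h (transpose i j))) \<le> 2 * s * (\<Sum>i\<in>B. a z i * (h id - h (transpose z i)))"
          unfolding s_def h_def by (rule octopus) (use insert.hyps s in auto)
        ultimately have "(\<Sum>i\<in>B. \<Sum>j\<in>B. a z i * a z j * (h id - h (transpose i j))) / s \<le> 2 * (\<Sum>i\<in>B. a z i * (h id - h (transpose z i)))"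
          by (simp add: field_simps)
        then show ?thesis
          by (simp add: sum_divide_distrib)
      qed
      \<comment> \<open>All one-particle projections vanish in this case, so \<open>u\<close> has
        sum zero on every coset of the stabiliser of \<open>z\<close>, and the induction hypothesis
        applies with the reduced weights.\<close>
      have coset: "\<gamma> * (\<Sum>p | p permutes B. (u (p \<circ> q))\<^sup>2) \<le> (\<Sum>p | p permutes B. u (p \<circ> q) * perm_lap B a' (\<lambda>p. u (p \<circ> q)) p)"
        if q: "q permutes ?A" for q
      proof (rule insert.IH)
        show "0 \<le> a' i j" if "i \<in> B" "j \<in> B" for i j
          using that insert.prems(1) s by (simp add: a'_def)
        show "a' i j = a' j i" for i j
          by (simp add: a'_def insert.prems(2) [of i j] mult.commute)
        show "\<gamma> * (\<Sum>x\<in>B. (v x)\<^sup>2) \<le> (\<Sum>i\<in>B. \<Sum>j\<in>B. a' i j * (v i - v j)\<^sup>2)" if "(\<Sum>x\<in>B. v x) = 0" for v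
          unfolding a'_def s_def
          by (rule gap_reduction [OF insert.hyps(1,2) assms(2) insert.prems(1-3) that])
        have "inv' q z \<in> ?A"
          using permutes_in_image [OF permutes_inv [OF q]] by simp
        then have "(\<Sum>p | p permutes ?A. if p (inv' q z) = z then u p else 0) = 0"
          using False by blast
        then show "(\<Sum>p | p permutes B. u (p \<circ> q)) = 0"
          unfolding sum_stabilizer_coset [OF q insert.hyps(2)] using fin
          by (simp add: sum.inter_filter [symmetric])
      qed
      \<comment> \<open>Summing \<open>coset\<close> over all \<open>q\<close> counts each
        permutation \<open>N\<close> times on both sides.\<close>
      have "N * (\<gamma> * (\<Sum>p | p permutes ?A. (u p)\<^sup>2)) = (\<Sum>q | q permutes ?A. \<gamma> * (\<Sum>p | p permutes B. (u (p \<circ> q))\<^sup>2))"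
        using sum_perm_average [of B ?A "\<lambda>p. (u p)\<^sup>2"] by (simp add: N_def sum_distrib_left [symmetric] subset_insertI)
      also have "\<dots> \<le> (\<Sum>q | q permutes ?A. \<Sum>p | p permutes B. u (p \<circ> q) * perm_lap B a' (\<lambda>p. u (p \<circ> q)) p)"
        by (rule sum_mono) (simp add: coset)
      also have "\<dots> = (\<Sum>q | q permutes ?A. \<Sum>p | p permutes B. u (p \<circ> q) * perm_lap B a' u (p \<circ> q))"
        by (simp add: perm_lap_eq comp_assoc)
      also have "\<dots> = N * (\<Sum>q | q permutes ?A. u q * perm_lap B a' u q)"
        unfolding N_def by (rule sum_perm_average [where F = "\<lambda>q. u q * perm_lap B a' u q"]) (rule subset_insertI)
      also have "(\<Sum>q | q permutes ?A. u q * perm_lap B a' u q) = (\<Sum>i\<in>B. \<Sum>j\<in>B. a' i j * (h id - h (transpose i j)))"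
        unfolding perm_energy h h_id ..
      \<comment> \<open>The mesh weights in \<open>a'\<close> are paid for by the edges at
        \<open>z\<close>, through \<open>star\<close>.\<close>
      also have "\<dots> \<le> (\<Sum>i\<in>?A. \<Sum>j\<in>?A. a i j * (h id - h (transpose i j)))"
      proof -
        have "(\<Sum>i\<in>?A. \<Sum>j\<in>?A. a i j * (h id - h (transpose i j)))
            = (\<Sum>i\<in>B. \<Sum>j\<in>B. a i j * (h id - h (transpose i j))) + 2 * (\<Sum>i\<in>B. a z i * (h id - h (transpose z i)))"
        proof -
          have "a i z = a z i" "transpose i z = transpose z i" if "i \<in> B" for i
            by (fact insert.prems(2) transpose_commute)+
          then show ?thesis
            using insert.hyps by (simp add: sum.distrib)
        qed
        then show ?thesis
          using star by (simp add: a'_def distrib_right sum.distrib)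
      qed
      also have "\<dots> = r * (\<Sum>p | p permutes ?A. (u p)\<^sup>2)"
      proof -
        have "(\<Sum>p | p permutes ?A. u p * perm_lap ?A a u p) = (\<Sum>p | p permutes ?A. u p * (r * u p))"
          by (rule sum.cong) (simp_all add: eig)
        then show ?thesis
          unfolding perm_energy h h_id by (simp add: sum_distrib_left power2_eq_square mult_ac)
      qed
      finally show ?thesis
        using N u2 by (simp add: mult_le_cancel_left)
    qed
    have "\<gamma> * (\<Sum>p | p permutes ?A. (f p)\<^sup>2) \<le> r * (\<Sum>p | p permutes ?A. (f p)\<^sup>2)"
      using \<open>\<gamma> \<le> r\<close> by (simp add: mult_right_mono sum_nonneg)
    also have "\<dots> \<le> (\<Sum>p | p permutes ?A. f p * perm_lap ?A a f p)"
      by (rule min [OF insert.prems(4)])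
    finally show ?thesis .
  qed
qed

section \<open>Spectral gaps of representations\<close>

context unitary_rep
begin

lemma zero_vec: "0 \<in> vecs V"
  by (rule subspace_0 [OF subspace_vecs])

lemma ip_zero_right: "v \<in> vecs V \<Longrightarrow> ip V v 0 = 0"
  using ip_cnj [of 0 v] ip_zero zero_vec by simp

lemma ip_self_eq_0: "v \<in> vecs V \<Longrightarrow> ip V v v = 0 \<Longrightarrow> v = 0"
  using ip_pos [of v] by fastforce

lemma ip_diff: "u \<in> vecs V \<Longrightarrow> v \<in> vecs V \<Longrightarrow> x \<in> vecs V \<Longrightarrow> ip V (u - v) x = ip V u x - ip V v x"
  using ip_add [of "u - v" v x] subspace_diff [OF subspace_vecs] by simp

lemma ip_sum:
  assumes "\<And>i. i \<in> I \<Longrightarrow> f i \<in> vecs V" "x \<in> vecs V"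
  shows "ip V (\<Sum>i\<in>I. f i) x = (\<Sum>i\<in>I. ip V (f i) x)"
  using assms(1)
proof (induction I rule: infinite_finite_induct)
  case (insert i I)
  then show ?case
    using ip_add [of "f i" "sum f I" x] assms(2) by (simp add: subspace_sum [OF subspace_vecs])
qed (simp_all add: ip_zero assms(2))

lemma ip_scl_right: "u \<in> vecs V \<Longrightarrow> v \<in> vecs V \<Longrightarrow> ip V u (scl V c v) = cnj c * ip V u v"
  using ip_cnj [of "scl V c v" u] ip_cnj [of v u] ip_scl [of v u c] subspace_scale [OF subspace_vecs]
  by simp

lemma laplacian_closed: "v \<in> vecs V \<Longrightarrow> laplacian H w V v \<in> vecs V"
  unfolding laplacian_def
  by (intro subspace_sum subspace_scale subspace_diff subspace_vecs act_closed)

text \<open>By unitarity the actions of \<open>h\<close> and \<open>inv h\<close> are adjoint, and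
  \<open>w\<close> gives them the same weight.\<close>

lemma laplacian_self_adjoint:
  assumes w: "\<And>h. h \<in> carrier H \<Longrightarrow> Poly_Mapping.lookup w (inv h) = Poly_Mapping.lookup w h"
    and u: "u \<in> vecs V" and v: "v \<in> vecs V"
  shows "ip V (laplacian H w V u) v = ip V u (laplacian H w V v)"
proof -
  let ?w = "\<lambda>h. complex_of_real (Poly_Mapping.lookup w h)"
  have d: "x - act V h x \<in> vecs V" "scl V (?w h) (x - act V h x) \<in> vecs V"
    if "h \<in> carrier H" "x \<in> vecs V" for h x
    using that by (auto intro!: subspace_diff subspace_scale subspace_vecs act_closed)
  have l: "ip V (laplacian H w V x) y = (\<Sum>h\<in>carrier H. ?w h * (ip V x y - ip V (act V h x) y))"
    if "x \<in> vecs V" "y \<in> vecs V" for x y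
    unfolding laplacian_def using that
    by (subst ip_sum) (simp_all add: d ip_scl ip_diff act_closed)
  have adj: "ip V (act V h u) v = cnj (ip V (act V (inv h) v) u)" if "h \<in> carrier H" for h
  proof -
    have "ip V (act V (inv h) (act V h u)) (act V (inv h) v) = ip V (act V h u) v"
      using that u v by (intro act_unitary) (simp_all add: act_closed)
    moreover have "act V (inv h) (act V h u) = u"
      using that u act_mult [of "inv h" h u] by (simp add: act_one)
    moreover have "ip V u (act V (inv h) v) = cnj (ip V (act V (inv h) v) u)"
      using that u v by (intro ip_cnj) (simp_all add: act_closed)
    ultimately show ?thesis
      by simp
  qed
  have "ip V (laplacian H w V u) v = (\<Sum>h\<in>carrier H. ?w (inv h) * (ip V u v - cnj (ip V (act V (inv h) v) u)))"
    unfolding l [OF u v] by (intro sum.cong) (simp_all add: adj w)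
  also have "\<dots> = (\<Sum>h\<in>carrier H. ?w h * (ip V u v - cnj (ip V (act V h v) u)))"
    by (rule sum.reindex_bij_witness [where i = "\<lambda>h. inv h" and j = "\<lambda>h. inv h"]) auto
  also have "\<dots> = cnj (ip V (laplacian H w V v) u)"
    unfolding l [OF v u] using ip_cnj [OF v u] by simp
  also have "\<dots> = ip V u (laplacian H w V v)"
    using ip_cnj [of "laplacian H w V v" u] laplacian_closed u v by simp
  finally show ?thesis .
qed

text \<open>Eigenvectors for distinct eigenvalues are orthogonal, hence independent, so the
  dimension bounds their number. Finiteness gives \<open>Min\<close> in \<open>spectral_gap\<close>
  its meaning.\<close>

lemma finite_eigenvalues:
  assumes w: "\<And>h. h \<in> carrier H \<Longrightarrow> Poly_Mapping.lookup w (inv h) = Poly_Mapping.lookup w h"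
  shows "finite {r. \<exists>v\<in>vecs V. v \<noteq> 0 \<and> laplacian H w V v = scl V (complex_of_real r) v}"
proof -
  define E where "E = {r. \<exists>v\<in>vecs V. v \<noteq> 0 \<and> laplacian H w V v = scl V (complex_of_real r) v}"
  have "\<forall>r\<in>E. \<exists>v. v \<in> vecs V \<and> v \<noteq> 0 \<and> laplacian H w V v = scl V (complex_of_real r) v"
    unfolding E_def by blast
  from bchoice [OF this] obtain e where
    e: "\<forall>r\<in>E. e r \<in> vecs V \<and> e r \<noteq> 0 \<and> laplacian H w V (e r) = scl V (complex_of_real r) (e r)" ..
  have e: "e r \<in> vecs V" "e r \<noteq> 0" "laplacian H w V (e r) = scl V (complex_of_real r) (e r)" if "r \<in> E" for r
    using bspec [OF e that] by simp_all
  have orth: "ip V (e r) (e s) = 0" if "r \<in> E" "s \<in> E" "r \<noteq> s" for r s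
    using laplacian_self_adjoint [OF w, of "e r" "e s"] e [OF that(1)] e [OF that(2)] that(3)
    by (simp add: ip_scl ip_scl_right)
  have inj: "inj_on e E"
  proof (rule inj_onI, rule ccontr)
    fix r s assume rs: "r \<in> E" "s \<in> E" "e r = e s" "r \<noteq> s"
    then show False
      using orth [OF rs(1,2)] e(1,2) [OF rs(1)] ip_self_eq_0 [of "e r"] by simp
  qed
  have "independent (e ` E)"
    unfolding dependent_explicit
  proof clarify
    fix T c b
    assume T: "finite T" "T \<subseteq> e ` E" and sum: "(\<Sum>v\<in>T. scl V (c v) v) = 0" and b: "b \<in> T" "c b \<noteq> 0"
    have Tv: "v \<in> vecs V" if "v \<in> T" for v
      using that T(2) e(1) by blast
    have o: "ip V v b = 0" if v: "v \<in> T" "v \<noteq> b" for v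
    proof -
      obtain r s where rs: "r \<in> E" "s \<in> E" "v = e r" "b = e s"
        using T(2) v b by blast
      then show ?thesis
        using orth [of r s] v by blast
    qed
    have "0 = ip V (\<Sum>v\<in>T. scl V (c v) v) b"
      using sum ip_zero [OF Tv [OF b(1)]] by simp
    also have "\<dots> = (\<Sum>v\<in>T. c v * ip V v b)"
      using Tv b by (subst ip_sum) (auto simp: ip_scl intro: subspace_scale [OF subspace_vecs])
    also have "\<dots> = c b * ip V b b"
      using T(1) b(1) by (subst sum.remove [of _ b]) (auto simp: o intro!: sum.neutral)
    finally have "ip V b b = 0"
      using b by simp
    then have "b = 0"
      by (rule ip_self_eq_0 [OF Tv [OF b(1)]])
    moreover obtain r where "r \<in> E" "b = e r"
      using b(1) T(2) by blast
    ultimately show False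
      using e(2) by simp
  qed
  moreover have "e ` E \<subseteq> vecs V"
    using e(1) by blast
  ultimately have "finite (e ` E)"
    using finite_dim independent_span_bound by (meson subset_trans)
  then show ?thesis
    unfolding E_def [symmetric] by (rule finite_imageD [OF _ inj])
qed

end

text \<open>The orthogonality condition in \<open>spectral_gap\<close> is left out here; it enters
  by passing to a \<open>sub_rep\<close>.\<close>

definition eigenvalues ::
    "('g, 'm) monoid_scheme \<Rightarrow> ('g \<Rightarrow>\<^sub>0 real) \<Rightarrow> ('g, 'v :: ab_group_add) rep \<Rightarrow> real set"
  where "eigenvalues H w V = {r. \<exists>v\<in>vecs V. v \<noteq> 0 \<and> laplacian H w V v = scl V (complex_of_real r) v}"

lemma fixed_space_direct_sum:
  "fixed_space H (V \<oplus>\<^sub>R U) = fixed_space H V \<times> fixed_space H U"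
  by (auto simp: fixed_space_def direct_sum_rep_def)

lemma laplacian_direct_sum:
  "laplacian H w (V \<oplus>\<^sub>R U) (v, u) = (laplacian H w V v, laplacian H w U u)"
  by (simp add: laplacian_def direct_sum_rep_def prod_eq_iff fst_sum snd_sum)

text \<open>A nonzero component of an eigenvector is an eigenvector; conversely, eigenvectors are
  extended by 0.\<close>

lemma eigenvalues_direct_sum:
  assumes "unitary_rep H V" "unitary_rep H U"
  shows "eigenvalues H w (V \<oplus>\<^sub>R U) = eigenvalues H w V \<union> eigenvalues H w U"
proof -
  interpret V: unitary_rep H V by fact
  interpret U: unitary_rep H U by fact
  have act0: "act V h 0 = 0" "act U h 0 = 0" if "h \<in> carrier H" for h
    using that V.act_scl [of h 0 0] U.act_scl [of h 0 0] V.zero_vec U.zero_vec by simp_all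
  then have lap0: "laplacian H w V 0 = 0" "laplacian H w U 0 = 0"
    by (simp_all add: laplacian_def)
  have "r \<in> eigenvalues H w (V \<oplus>\<^sub>R U) \<longleftrightarrow> (\<exists>v\<in>vecs V. \<exists>u\<in>vecs U. (v \<noteq> 0 \<or> u \<noteq> 0) \<and>
      laplacian H w V v = scl V (complex_of_real r) v \<and> laplacian H w U u = scl U (complex_of_real r) u)" for r
    by (auto simp: eigenvalues_def direct_sum_rep_def laplacian_direct_sum [unfolded direct_sum_rep_def] zero_prod_def)
  moreover have "r \<in> eigenvalues H w V \<union> eigenvalues H w U \<longleftrightarrow> (\<exists>v\<in>vecs V. \<exists>u\<in>vecs U. (v \<noteq> 0 \<or> u \<noteq> 0) \<and>
      laplacian H w V v = scl V (complex_of_real r) v \<and> laplacian H w U u = scl U (complex_of_real r) u)" for r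
  proof -
    have 0: "laplacian H w V 0 = scl V (complex_of_real r) 0" "laplacian H w U 0 = scl U (complex_of_real r) 0"
      using lap0 by simp_all
    show ?thesis
      unfolding eigenvalues_def Un_iff mem_Collect_eq
      using 0 V.zero_vec U.zero_vec by blast
  qed
  ultimately show ?thesis
    by blast
qed

lemma spectral_gap_no_fixed:
  assumes "unitary_rep H V" "fixed_space H V = {0}" "v \<in> vecs V" "v \<noteq> 0"
  shows "spectral_gap H w V = ereal (Min (eigenvalues H w V))"
proof -
  interpret unitary_rep H V by fact
  have "orth_compl V {0} = vecs V"
    by (auto simp: orth_compl_def ip_zero_right)
  then show ?thesis
    using assms(2-) by (auto simp: spectral_gap_def eigenvalues_def)
qed

text \<open>A fixed vector in the complement is orthogonal to itself.\<close>

lemma fixed_space_orth_compl_fixed: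
  assumes "unitary_rep H V"
  shows "fixed_space H (sub_rep V (orth_compl V (fixed_space H V))) = {0}"
proof -
  interpret unitary_rep H V by fact
  interpret S: unitary_rep H "sub_rep V (orth_compl V (fixed_space H V))"
    by (rule unitary_orth_compl_fixed)
  have "act V h 0 = 0" if "h \<in> carrier H" for h
    using that act_scl [of h 0 0] zero_vec by simp
  then have "0 \<in> fixed_space H (sub_rep V (orth_compl V (fixed_space H V)))"
    using S.zero_vec by (simp add: fixed_space_def sub_rep_def)
  moreover have "v = 0" if "v \<in> fixed_space H (sub_rep V (orth_compl V (fixed_space H V)))" for v
    using that ip_self_eq_0 [of v] by (auto simp: fixed_space_def sub_rep_def orth_compl_def)
  ultimately show ?thesis by blast
qed

lemma laplacian_sub_rep: "laplacian H w (sub_rep V U) = laplacian H w V"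
  by (simp add: laplacian_def sub_rep_def fun_eq_iff)

lemma spectral_gap_eq_Min:
  assumes "vecs V \<noteq> fixed_space H V"
  shows "spectral_gap H w V
    = ereal (Min (eigenvalues H w (sub_rep V (orth_compl V (fixed_space H V)))))"
  using assms by (simp add: spectral_gap_def eigenvalues_def laplacian_sub_rep) (simp add: sub_rep_def)

section \<open>Permutation representations in coordinates\<close>

lemma sum_fun_apply: "(\<Sum>i\<in>I. f i) x = (\<Sum>i\<in>I. f i x)"
  by (induction I rule: infinite_finite_induct) auto

lemma laplacian_perm_rep:
  fixes f :: "'x \<Rightarrow> complex"
  shows "laplacian H w (perm_rep H X \<phi>) f x =
    (\<Sum>h\<in>carrier H. complex_of_real (Poly_Mapping.lookup w h) * (f x - (if x \<in> X then f (\<phi> (inv\<^bsub>H\<^esub> h) x) else 0)))"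
  by (simp add: laplacian_def sum_fun_apply perm_rep_def)

text \<open>Transitivity leaves only constant functions as fixed vectors, and orthogonality to the
  constants means sum zero.\<close>

lemma orth_compl_fixed_perm_rep:
  fixes X :: "'x set" and \<phi> :: "'g \<Rightarrow> 'x \<Rightarrow> 'x"
  assumes "group H" and x0: "x0 \<in> X"
    and closed: "\<And>h x. h \<in> carrier H \<Longrightarrow> x \<in> X \<Longrightarrow> \<phi> h x \<in> X"
    and trans: "\<And>x. x \<in> X \<Longrightarrow> \<exists>h\<in>carrier H. \<phi> h x0 = x"
  shows "orth_compl (perm_rep H X \<phi>) (fixed_space H (perm_rep H X \<phi>))
    = {f. (\<forall>x. x \<notin> X \<longrightarrow> f x = 0) \<and> (\<Sum>x\<in>X. f x :: complex) = 0}"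
proof -
  interpret group H by fact
  let ?V = "perm_rep H X \<phi>"
  have one: "(\<lambda>x. if x \<in> X then 1 else 0) \<in> fixed_space H ?V"
    using closed by (auto simp: fixed_space_def perm_rep_def fun_eq_iff)
  have const: "u x = u x0" if u: "u \<in> fixed_space H ?V" and x: "x \<in> X" for u x
  proof -
    obtain h where h: "h \<in> carrier H" "\<phi> h x0 = x"
      using trans x by blast
    then have "act ?V (inv\<^bsub>H\<^esub> h) u x0 = u x0"
      using u by (simp add: fixed_space_def)
    then show ?thesis
      using h x0 by (simp add: perm_rep_def)
  qed
  show ?thesis
  proof (intro equalityI subsetI)
    fix f :: "'x \<Rightarrow> complex" assume f: "f \<in> orth_compl ?V (fixed_space H ?V)"
    then have "ip ?V f (\<lambda>x. if x \<in> X then 1 else 0) = 0"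
      using one by (auto simp: orth_compl_def)
    then have "(\<Sum>x\<in>X. f x) = 0"
      by (simp add: perm_rep_def if_distrib cong: sum.cong)
    then show "f \<in> {f. (\<forall>x. x \<notin> X \<longrightarrow> f x = 0) \<and> (\<Sum>x\<in>X. f x) = 0}"
      using f by (simp add: orth_compl_def perm_rep_def)
  next
    fix f :: "'x \<Rightarrow> complex" assume f: "f \<in> {f. (\<forall>x. x \<notin> X \<longrightarrow> f x = 0) \<and> (\<Sum>x\<in>X. f x) = 0}"
    have "ip ?V f u = 0" if "u \<in> fixed_space H ?V" for u
    proof -
      have "ip ?V f u = (\<Sum>x\<in>X. f x * cnj (u x0))"
        using const [OF that] by (simp add: perm_rep_def)
      also have "\<dots> = 0"
        using f by (simp add: sum_distrib_right [symmetric])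
      finally show ?thesis .
    qed
    then show "f \<in> orth_compl ?V (fixed_space H ?V)"
      using f by (simp add: orth_compl_def perm_rep_def)
  qed
qed

text \<open>Serves the regular and the coset representation alike, as both come from transitive
  actions.\<close>

lemma eigenvalues_orth_compl_perm_rep:
  fixes X :: "'x set" and \<phi> :: "'g \<Rightarrow> 'x \<Rightarrow> 'x"
  assumes "group H" and x0: "x0 \<in> X"
    and closed: "\<And>h x. h \<in> carrier H \<Longrightarrow> x \<in> X \<Longrightarrow> \<phi> h x \<in> X"
    and trans: "\<And>x. x \<in> X \<Longrightarrow> \<exists>h\<in>carrier H. \<phi> h x0 = x"
  defines "V \<equiv> perm_rep H X \<phi>"
  shows "r \<in> eigenvalues H w (sub_rep V (orth_compl V (fixed_space H V))) \<longleftrightarrow>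
    (\<exists>f. (\<forall>x. x \<notin> X \<longrightarrow> f x = 0) \<and> (\<Sum>x\<in>X. f x) = 0 \<and> (\<exists>x\<in>X. f x \<noteq> 0) \<and>
      (\<forall>x\<in>X. (\<Sum>h\<in>carrier H. complex_of_real (Poly_Mapping.lookup w h) * (f x - f (\<phi> (inv\<^bsub>H\<^esub> h) x)))
        = complex_of_real r * f x))"
proof -
  have nz: "f \<noteq> 0 \<longleftrightarrow> (\<exists>x\<in>X. f x \<noteq> 0)" if "\<forall>x. x \<notin> X \<longrightarrow> f x = 0" for f :: "'x \<Rightarrow> complex"
    using that by (auto simp: fun_eq_iff)
  have eig: "laplacian H w V f = scl V (complex_of_real r) f \<longleftrightarrow>
      (\<forall>x\<in>X. (\<Sum>h\<in>carrier H. complex_of_real (Poly_Mapping.lookup w h) * (f x - f (\<phi> (inv\<^bsub>H\<^esub> h) x)))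
        = complex_of_real r * f x)" if "\<forall>x. x \<notin> X \<longrightarrow> f x = 0" for f
  proof -
    have "laplacian H w V f x = (if x \<in> X then
        (\<Sum>h\<in>carrier H. complex_of_real (Poly_Mapping.lookup w h) * (f x - f (\<phi> (inv\<^bsub>H\<^esub> h) x))) else 0)" for x
      using that unfolding V_def laplacian_perm_rep by simp
    moreover have "scl V (complex_of_real r) f x = (if x \<in> X then complex_of_real r * f x else 0)" for x
      using that unfolding V_def by (simp add: perm_rep_def)
    ultimately show ?thesis
      unfolding fun_eq_iff by auto
  qed
  show ?thesis
    unfolding eigenvalues_def laplacian_sub_rep V_def [symmetric]
    using orth_compl_fixed_perm_rep [where \<phi> = \<phi>, OF assms(1-4), folded V_def] nz eig
    by (simp add: sub_rep_def) blast
qed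

section \<open>The wreath product\<close>

lemma sum_lookup_single:
  fixes F :: "'g \<Rightarrow> real"
  assumes "finite S" "k \<in> S"
  shows "(\<Sum>h\<in>S. Poly_Mapping.lookup (Poly_Mapping.single k v) h * F h) = v * F k"
proof -
  have "(\<Sum>h\<in>S. Poly_Mapping.lookup (Poly_Mapping.single k v) h * F h) = (\<Sum>h\<in>S. if k = h then v * F h else 0)"
    by (rule sum.cong) (auto simp: lookup_single when_def)
  then show ?thesis
    using assms by simp
qed

lemma sum_pairs_symmetric:
  fixes a F :: "nat \<Rightarrow> nat \<Rightarrow> real"
  assumes "\<And>i j. F i j = F j i"
  shows "(\<Sum>(i, j)\<in>{(i, j). 1 \<le> i \<and> i < j \<and> j \<le> n}. a i j * F i j)
    = (\<Sum>i\<in>{1..n}. \<Sum>j\<in>{1..n}. (if i < j then a i j else if j < i then a j i else 0) / 2 * F i j)"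
proof -
  let ?T = "\<lambda>i j. if i < j then a i j * F i j else 0"
  have "(\<Sum>i\<in>{1..n}. \<Sum>j\<in>{1..n}. (if i < j then a i j else if j < i then a j i else 0) / 2 * F i j)
      = (\<Sum>i\<in>{1..n}. \<Sum>j\<in>{1..n}. ?T i j / 2 + ?T j i / 2)"
    by (intro sum.cong refl) (auto simp: assms)
  also have "\<dots> = (\<Sum>i\<in>{1..n}. \<Sum>j\<in>{1..n}. ?T i j / 2) + (\<Sum>i\<in>{1..n}. \<Sum>j\<in>{1..n}. ?T j i / 2)"
    by (simp only: sum.distrib)
  also have "(\<Sum>i\<in>{1..n}. \<Sum>j\<in>{1..n}. ?T j i / 2) = (\<Sum>i\<in>{1..n}. \<Sum>j\<in>{1..n}. ?T i j / 2)"
    by (rule sum.swap)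
  also have "(\<Sum>i\<in>{1..n}. \<Sum>j\<in>{1..n}. ?T i j / 2) + (\<Sum>i\<in>{1..n}. \<Sum>j\<in>{1..n}. ?T i j / 2)
      = (\<Sum>p\<in>{1..n} \<times> {1..n}. case p of (i, j) \<Rightarrow> ?T i j)"
    by (simp add: sum.cartesian_product sum_divide_distrib [symmetric] case_prod_unfold)
  also have "\<dots> = (\<Sum>(i, j)\<in>{(i, j). 1 \<le> i \<and> i < j \<and> j \<le> n}. ?T i j)"
    by (rule sum.mono_neutral_right) (auto split: if_splits)
  also have "\<dots> = (\<Sum>(i, j)\<in>{(i, j). 1 \<le> i \<and> i < j \<and> j \<le> n}. a i j * F i j)"
    by (rule sum.cong) auto
  finally show ?thesis ..
qed

locale wreath_walk = group G
  for G :: "('a, 'b) monoid_scheme" (structure) +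
  fixes n :: nat and a :: "nat \<Rightarrow> nat \<Rightarrow> real" and c :: "(nat \<Rightarrow> 'a) \<Rightarrow> real" and w :: "'a wreath_elt \<Rightarrow>\<^sub>0 real"
  assumes finite_G: "finite (carrier G)" and n: "n \<ge> 2"
    and a_nonneg: "\<And>i j. \<lbrakk>1 \<le> i; i < j; j \<le> n\<rbrakk> \<Longrightarrow> a i j \<ge> 0"
    and c_nonneg: "\<And>g. g \<in> carrier (power_group G n) \<Longrightarrow> c g \<ge> 0"
    and c_inv: "\<And>g. g \<in> carrier (power_group G n) \<Longrightarrow> c g = c (inv\<^bsub>power_group G n\<^esub> g)"
    and w_def: "w = (\<Sum>(i, j)\<in>{(i, j). 1 \<le> i \<and> i < j \<and> j \<le> n}.
                Poly_Mapping.single (sym_emb G n (transpose i j)) (a i j))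
           + (\<Sum>g\<in>carrier (power_group G n). Poly_Mapping.single (base_emb n g) (c g))"
begin

abbreviation "W \<equiv> wreath G n"
abbreviation "\<tau> i j \<equiv> sym_emb G n (transpose i j)"

text \<open>The rates as a symmetric function with zero diagonal, halved because the Laplacians of
  the interchange process sum over ordered pairs.\<close>

definition b :: "nat \<Rightarrow> nat \<Rightarrow> real"
  where "b i j = (if i < j then a i j else if j < i then a j i else 0) / 2"

lemma b_sym: "b i j = b j i"
  by (simp add: b_def)

lemma b_nonneg: "i \<in> {1..n} \<Longrightarrow> j \<in> {1..n} \<Longrightarrow> 0 \<le> b i j"
  using a_nonneg by (auto simp: b_def)

sublocale W: group W
  by (rule group_wreath) (rule group_axioms)

sublocale power: group "power_group G n"
  by (rule product_group) (rule group_axioms)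

lemma finite_W: "finite (carrier W)"
  by (rule finite_wreath) (rule finite_G)

lemma sym_emb_closed: "p permutes {1..n} \<Longrightarrow> sym_emb G n p \<in> carrier W"
  by (auto simp: sym_emb_def wreath_def sym_group_def)

lemma \<tau>_closed: "i \<in> {1..n} \<Longrightarrow> j \<in> {1..n} \<Longrightarrow> \<tau> i j \<in> carrier W"
  by (intro sym_emb_closed permutes_swap_id)

lemma sym_emb_mult:
  assumes "p permutes {1..n}"
  shows "sym_emb G n p \<otimes>\<^bsub>W\<^esub> sym_emb G n q = sym_emb G n (p \<circ> q)"
  using permutes_in_image [OF permutes_inv [OF assms]]
  by (auto simp: sym_emb_def wreath_def permute_tuple_def sym_group_def fun_eq_iff
      simp del: One_nat_def atLeastAtMost_iff)

lemma sym_emb_one: "sym_emb G n id = \<one>\<^bsub>W\<^esub>"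
  by (simp add: sym_emb_def wreath_def sym_group_def)

lemma inv_\<tau>: "i \<in> {1..n} \<Longrightarrow> j \<in> {1..n} \<Longrightarrow> inv\<^bsub>W\<^esub> (\<tau> i j) = \<tau> i j"
  by (intro W.inv_equality \<tau>_closed)
    (simp_all add: sym_emb_mult [OF permutes_swap_id] sym_emb_one)

lemma base_emb_closed: "g \<in> carrier (power_group G n) \<Longrightarrow> base_emb n g \<in> carrier W"
  by (auto simp: base_emb_def wreath_def sym_group_def permutes_id)

lemma base_emb_mult:
  assumes "h \<in> carrier (power_group G n)"
  shows "base_emb n g \<otimes>\<^bsub>W\<^esub> base_emb n h = base_emb n (g \<otimes>\<^bsub>power_group G n\<^esub> h)"
proof -
  have "permute_tuple n id h = h"
    using assms by (auto simp: permute_tuple_def fun_eq_iff PiE_iff extensional_def)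
  then show ?thesis
    by (simp add: base_emb_def wreath_def sym_group_def)
qed

lemma inv_base_emb:
  assumes "g \<in> carrier (power_group G n)"
  shows "inv\<^bsub>W\<^esub> (base_emb n g) = base_emb n (inv\<^bsub>power_group G n\<^esub> g)"
proof (rule W.inv_equality)
  show "base_emb n (inv\<^bsub>power_group G n\<^esub> g) \<otimes>\<^bsub>W\<^esub> base_emb n g = \<one>\<^bsub>W\<^esub>"
    unfolding base_emb_mult [OF assms] power.l_inv [OF assms] by (simp add: base_emb_def wreath_def)
qed (use assms power.inv_closed base_emb_closed in auto)

lemma snd_inv:
  assumes "h \<in> carrier W"
  shows "snd (inv\<^bsub>W\<^esub> h) = inv' (snd h)"
proof -
  interpret group_hom W "sym_group n" snd
    by (intro group_hom.intro group_hom_axioms.intro W.group_axioms sym_group_is_group snd_hom_wreath)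
  have "snd h \<in> carrier (sym_group n)"
    using assms by auto
  then show ?thesis
    using hom_inv [OF assms] sym_group_inv_equality by simp
qed

lemma lookup_w: "Poly_Mapping.lookup w h = (\<Sum>(i, j)\<in>{(i, j). 1 \<le> i \<and> i < j \<and> j \<le> n}.
      Poly_Mapping.lookup (Poly_Mapping.single (\<tau> i j) (a i j)) h)
    + (\<Sum>g\<in>carrier (power_group G n). Poly_Mapping.lookup (Poly_Mapping.single (base_emb n g) (c g)) h)"
  by (simp add: w_def lookup_add lookup_sum case_prod_unfold)

text \<open>Expanding \<open>w\<close> into its summands and exchanging sums reduces each inner sum
  to one value of \<open>F\<close>.\<close>

lemma sum_w:
  fixes F :: "'a wreath_elt \<Rightarrow> real"
  shows "(\<Sum>h\<in>carrier W. Poly_Mapping.lookup w h * F h)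
    = (\<Sum>i\<in>{1..n}. \<Sum>j\<in>{1..n}. b i j * F (\<tau> i j)) + (\<Sum>g\<in>carrier (power_group G n). c g * F (base_emb n g))"
proof -
  let ?I = "{(i, j). 1 \<le> i \<and> i < j \<and> j \<le> n}"
  have "(\<Sum>h\<in>carrier W. Poly_Mapping.lookup w h * F h)
      = (\<Sum>(i, j)\<in>?I. \<Sum>h\<in>carrier W. Poly_Mapping.lookup (Poly_Mapping.single (\<tau> i j) (a i j)) h * F h)
      + (\<Sum>g\<in>carrier (power_group G n). \<Sum>h\<in>carrier W. Poly_Mapping.lookup (Poly_Mapping.single (base_emb n g) (c g)) h * F h)"
    unfolding lookup_w case_prod_unfold distrib_right sum.distrib sum_distrib_right
    by (subst (1 2) sum.swap) (rule refl)
  also have "(\<Sum>(i, j)\<in>?I. \<Sum>h\<in>carrier W. Poly_Mapping.lookup (Poly_Mapping.single (\<tau> i j) (a i j)) h * F h)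
      = (\<Sum>(i, j)\<in>?I. a i j * F (\<tau> i j))"
    by (intro sum.cong refl) (auto intro!: sum_lookup_single finite_W \<tau>_closed)
  also have "\<dots> = (\<Sum>i\<in>{1..n}. \<Sum>j\<in>{1..n}. b i j * F (\<tau> i j))"
    unfolding b_def by (rule sum_pairs_symmetric) (simp add: transpose_commute)
  also have "(\<Sum>g\<in>carrier (power_group G n). \<Sum>h\<in>carrier W. Poly_Mapping.lookup (Poly_Mapping.single (base_emb n g) (c g)) h * F h)
      = (\<Sum>g\<in>carrier (power_group G n). c g * F (base_emb n g))"
    by (intro sum.cong refl sum_lookup_single finite_W base_emb_closed)
  finally show ?thesis .
qed

text \<open>Transpositions are their own inverses, and the base group sum is reindexed by inversion,
  which preserves \<open>c\<close>.\<close>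

lemma lookup_w_inv:
  assumes h: "h \<in> carrier W"
  shows "Poly_Mapping.lookup w (inv\<^bsub>W\<^esub> h) = Poly_Mapping.lookup w h"
proof -
  have *: "k = inv\<^bsub>W\<^esub> h \<longleftrightarrow> inv\<^bsub>W\<^esub> k = h" if "k \<in> carrier W" for k
    using that h by auto
  have "(\<Sum>(i, j)\<in>{(i, j). 1 \<le> i \<and> i < j \<and> j \<le> n}. Poly_Mapping.lookup (Poly_Mapping.single (\<tau> i j) (a i j)) (inv\<^bsub>W\<^esub> h))
      = (\<Sum>(i, j)\<in>{(i, j). 1 \<le> i \<and> i < j \<and> j \<le> n}. Poly_Mapping.lookup (Poly_Mapping.single (\<tau> i j) (a i j)) h)"
    by (rule sum.cong) (auto simp: lookup_single * \<tau>_closed inv_\<tau>)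
  moreover have "(\<Sum>g\<in>carrier (power_group G n). Poly_Mapping.lookup (Poly_Mapping.single (base_emb n g) (c g)) (inv\<^bsub>W\<^esub> h))
      = (\<Sum>g\<in>carrier (power_group G n). Poly_Mapping.lookup (Poly_Mapping.single (base_emb n g) (c g)) h)"
  proof (rule sum.reindex_bij_witness [where i = "m_inv (power_group G n)" and j = "m_inv (power_group G n)"])
    fix g assume g: "g \<in> carrier (power_group G n)"
    show "Poly_Mapping.lookup (Poly_Mapping.single (base_emb n (inv\<^bsub>power_group G n\<^esub> g)) (c (inv\<^bsub>power_group G n\<^esub> g))) h
        = Poly_Mapping.lookup (Poly_Mapping.single (base_emb n g) (c g)) (inv\<^bsub>W\<^esub> h)"
      using g by (simp only: lookup_single * base_emb_closed inv_base_emb c_inv [OF g, symmetric])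
  qed (simp_all del: carrier_product_group)
  ultimately show ?thesis
    by (simp add: lookup_w)
qed

end

section \<open>The one-particle gap, and eigenvectors with sum zero on orbits of the symmetric
  group\<close>

context wreath_walk
begin

lemma sum_left_mult:
  fixes F :: "'a wreath_elt \<Rightarrow> real"
  assumes "y \<in> carrier W"
  shows "(\<Sum>x\<in>carrier W. F (y \<otimes>\<^bsub>W\<^esub> x)) = (\<Sum>x\<in>carrier W. F x)"
  by (rule sum.reindex_bij_witness [where i = "\<lambda>x. inv\<^bsub>W\<^esub> y \<otimes>\<^bsub>W\<^esub> x" and j = "\<lambda>x. y \<otimes>\<^bsub>W\<^esub> x"])
    (use assms in \<open>simp_all add: W.m_assoc [symmetric]\<close>)

lemma sum_right_mult:
  fixes F :: "'a wreath_elt \<Rightarrow> 'c :: comm_monoid_add"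
  assumes "y \<in> carrier W"
  shows "(\<Sum>x\<in>carrier W. F (x \<otimes>\<^bsub>W\<^esub> y)) = (\<Sum>x\<in>carrier W. F x)"
  by (rule sum.reindex_bij_witness [where i = "\<lambda>x. x \<otimes>\<^bsub>W\<^esub> inv\<^bsub>W\<^esub> y" and j = "\<lambda>x. x \<otimes>\<^bsub>W\<^esub> y"])
    (use assms in \<open>simp_all add: W.m_assoc\<close>)

text \<open>The base group acts trivially through \<open>snd\<close>, so only the transpositions
  survive.\<close>

lemma sum_w_snd:
  "(\<Sum>h\<in>carrier W. Poly_Mapping.lookup w h * (u x - u (inv' (snd h) x))) = point_lap {1..n} b u x"
proof -
  have "snd (\<tau> i j) = transpose i j" "snd (base_emb n g :: 'a wreath_elt) = id" for i j g
    by (simp_all add: sym_emb_def base_emb_def sym_group_one)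
  then show ?thesis
    unfolding sum_w point_lap_eq by simp
qed

lemma eigenvalues_std:
  "r \<in> eigenvalues W w (std_rep n) \<longleftrightarrow> (\<exists>f. (\<forall>i. i \<notin> {1..n} \<longrightarrow> f i = 0) \<and> (\<Sum>i\<in>{1..n}. f i) = 0 \<and> f \<noteq> 0 \<and>
    (\<forall>i\<in>{1..n}. (\<Sum>h\<in>carrier W. complex_of_real (Poly_Mapping.lookup w h) * (f i - f (inv' (snd h) i)))
      = complex_of_real r * f i))"
proof -
  let ?V = "std_rep n :: ('a wreath_elt, nat \<Rightarrow> complex) rep"
  have vecs: "vecs ?V = {f. (\<forall>i. i \<notin> {1..n} \<longrightarrow> f i = 0) \<and> (\<Sum>i\<in>{1..n}. f i) = 0}"
    by (simp add: std_rep_def std_rep_sym_def pullback_rep_def sub_rep_def perm_rep_def Let_def)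
  have scl: "scl ?V k f i = k * f i" for k f i
    by (simp add: std_rep_def std_rep_sym_def pullback_rep_def sub_rep_def perm_rep_def Let_def)
  have act: "act ?V h f i = (if i \<in> {1..n} then f (inv' (snd h) i) else 0)" if "h \<in> carrier W" for h f i
  proof -
    have "snd h \<in> carrier (sym_group n)"
      using that by (auto simp: wreath_def)
    then show ?thesis
      by (simp add: std_rep_def std_rep_sym_def pullback_rep_def sub_rep_def perm_rep_def Let_def sym_group_inv_equality)
  qed
  have lap: "laplacian W w ?V f i = (if i \<in> {1..n} then
      (\<Sum>h\<in>carrier W. complex_of_real (Poly_Mapping.lookup w h) * (f i - f (inv' (snd h) i))) else 0)"
    if "\<forall>i. i \<notin> {1..n} \<longrightarrow> f i = 0" for f i
  proof -
    have "laplacian W w ?V f i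
        = (\<Sum>h\<in>carrier W. complex_of_real (Poly_Mapping.lookup w h) * (f i - (if i \<in> {1..n} then f (inv' (snd h) i) else 0)))"
      unfolding laplacian_def sum_fun_apply scl by (intro sum.cong refl) (simp add: act)
    then show ?thesis
      using that by (cases "i \<in> {1..n}") (simp_all del: atLeastAtMost_iff One_nat_def)
  qed
  have "laplacian W w ?V f = scl ?V (complex_of_real r) f \<longleftrightarrow>
    (\<forall>i\<in>{1..n}. (\<Sum>h\<in>carrier W. complex_of_real (Poly_Mapping.lookup w h) * (f i - f (inv' (snd h) i)))
      = complex_of_real r * f i)" if supp: "\<forall>i. i \<notin> {1..n} \<longrightarrow> f i = 0" for f
  proof -
    have *: "complex_of_real r * f i = 0" if "i \<notin> {1..n}" for i
      using supp that by simp
    show ?thesis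
      unfolding fun_eq_iff lap [OF supp] scl by (auto simp: * simp del: atLeastAtMost_iff One_nat_def)
  qed
  then show ?thesis
    unfolding eigenvalues_def vecs by auto
qed

text \<open>Provides the \<gamma> for the interchange bound: the least one-particle eigenvalue,
  which occurs in \<open>std_rep\<close>. The points 1 and 2 exist as
  \<open>n \<ge> 2\<close>.\<close>

lemma std_min_eigenvalue:
  obtains r where "r \<in> eigenvalues W w (std_rep n)" "0 \<le> r"
    "\<And>u. (\<Sum>i\<in>{1..n}. u i) = 0 \<Longrightarrow> r * (\<Sum>i\<in>{1..n}. (u i)\<^sup>2) \<le> (\<Sum>i\<in>{1..n}. \<Sum>j\<in>{1..n}. b i j * (u i - u j)\<^sup>2)"
proof -
  have closed: "\<And>s x. s \<in> {1..n} \<times> {1..n} \<Longrightarrow> x \<in> {1..n} \<Longrightarrow> (case s of (i, j) \<Rightarrow> transpose i j) x \<in> {1..n}"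
    by (auto simp: transpose_def)
  have invol: "\<And>s x. s \<in> {1..n} \<times> {1..n} \<Longrightarrow> x \<in> {1..n} \<Longrightarrow>
      (case s of (i, j) \<Rightarrow> transpose i j) ((case s of (i, j) \<Rightarrow> transpose i j) x) = x"
    by auto
  have A: "finite {1..n}" "1 \<in> {1..n}" "2 \<in> {1..n}" "1 \<noteq> (2 :: nat)"
    using n by auto
  note eigenvector = lap_min_eigenvector [where a = 1 and b = 2 and \<alpha> = "\<lambda>(i, j). b i j"
      and \<phi> = "\<lambda>(i, j). transpose i j" and S = "{1..n} \<times> {1..n}" and X = "{1..n}",
      OF closed invol A, folded point_lap_def]
  obtain u r where supp: "\<And>x. x \<notin> {1..n} \<Longrightarrow> u x = 0" and u0: "(\<Sum>x\<in>{1..n}. u x) = 0"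
    and u: "\<exists>x\<in>{1..n}. u x \<noteq> 0"
    and eig: "\<And>x. x \<in> {1..n} \<Longrightarrow> point_lap {1..n} b u x = r * u x"
    and min: "\<And>v. (\<Sum>x\<in>{1..n}. v x) = 0 \<Longrightarrow>
      r * (\<Sum>x\<in>{1..n}. (v x)\<^sup>2) \<le> (\<Sum>x\<in>{1..n}. v x * point_lap {1..n} b v x)"
    by (rule eigenvector; (assumption | (rule that; assumption)))
  let ?f = "\<lambda>x. complex_of_real (u x)"
  have "(\<Sum>h\<in>carrier W. complex_of_real (Poly_Mapping.lookup w h) * (?f x - ?f (inv' (snd h) x))) = complex_of_real r * ?f x"
    if "x \<in> {1..n}" for x
  proof -
    have "(\<Sum>h\<in>carrier W. complex_of_real (Poly_Mapping.lookup w h) * (?f x - ?f (inv' (snd h) x)))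
        = complex_of_real (\<Sum>h\<in>carrier W. Poly_Mapping.lookup w h * (u x - u (inv' (snd h) x)))"
      by simp
    then show ?thesis
      unfolding sum_w_snd eig [OF that] by simp
  qed
  moreover have "(\<Sum>x\<in>{1..n}. ?f x) = 0"
    using u0 by (simp flip: of_real_sum)
  moreover have "?f \<noteq> 0"
    using u by (auto simp: fun_eq_iff)
  ultimately have "r \<in> eigenvalues W w (std_rep n)"
    unfolding eigenvalues_std using supp by (intro exI [of _ ?f]) auto
  moreover have "0 \<le> r"
  proof -
    have "(\<Sum>x\<in>{1..n}. u x * point_lap {1..n} b u x) = r * (\<Sum>x\<in>{1..n}. (u x)\<^sup>2)"
      using eig by (simp add: sum_distrib_left power2_eq_square mult_ac)
    moreover have "0 \<le> (\<Sum>x\<in>{1..n}. u x * point_lap {1..n} b u x)"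
      unfolding point_energy [OF A(1)] by (intro sum_nonneg mult_nonneg_nonneg b_nonneg) auto
    moreover have "0 < (\<Sum>x\<in>{1..n}. (u x)\<^sup>2)"
      using u by (auto intro!: sum_pos2)
    ultimately show ?thesis
      by (simp add: zero_le_mult_iff)
  qed
  ultimately show thesis
    using that min unfolding point_energy [OF A(1)] by blast
qed

text \<open>On each coset of the symmetric group the base group part of the Laplacian can be dropped.\<close>

lemma coset_mean_zero_bound:
  fixes g :: "'a wreath_elt \<Rightarrow> real"
  assumes "0 \<le> \<gamma>"
    and gap: "\<And>u. (\<Sum>i\<in>{1..n}. u i) = 0 \<Longrightarrow>
      \<gamma> * (\<Sum>i\<in>{1..n}. (u i)\<^sup>2) \<le> (\<Sum>i\<in>{1..n}. \<Sum>j\<in>{1..n}. b i j * (u i - u j)\<^sup>2)"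
    and eig: "\<And>x. x \<in> carrier W \<Longrightarrow>
      (\<Sum>h\<in>carrier W. Poly_Mapping.lookup w h * (g x - g (inv\<^bsub>W\<^esub> h \<otimes>\<^bsub>W\<^esub> x))) = r * g x"
    and zero: "\<And>y. y \<in> carrier W \<Longrightarrow> (\<Sum>p | p permutes {1..n}. g (sym_emb G n p \<otimes>\<^bsub>W\<^esub> y)) = 0"
    and nz: "x0 \<in> carrier W" "g x0 \<noteq> 0"
  shows "\<gamma> \<le> r"
proof -
  define N where "N = real (card {p. p permutes {1..n}})"
  have N: "N > 0"
    by (auto simp: N_def card_gt_0_iff finite_permutations intro: exI [of _ id] permutes_id)
  define E where "E x = (\<Sum>i\<in>{1..n}. \<Sum>j\<in>{1..n}. b i j * (g x - g (\<tau> i j \<otimes>\<^bsub>W\<^esub> x)))" for x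
  have average: "N * (\<Sum>x\<in>carrier W. F x) = (\<Sum>y\<in>carrier W. \<Sum>p | p permutes {1..n}. F (sym_emb G n p \<otimes>\<^bsub>W\<^esub> y))"
    for F :: "'a wreath_elt \<Rightarrow> real"
    by (subst sum.swap) (simp add: N_def sum_left_mult sym_emb_closed)
  \<comment> \<open>Translation preserves square sums, so this form is half the square sum of a
    difference.\<close>
  have base: "0 \<le> (\<Sum>x\<in>carrier W. g x * (g x - g (inv\<^bsub>W\<^esub> y \<otimes>\<^bsub>W\<^esub> x)))" if y: "y \<in> carrier W" for y
  proof -
    have "0 \<le> (\<Sum>x\<in>carrier W. (g x - g (inv\<^bsub>W\<^esub> y \<otimes>\<^bsub>W\<^esub> x))\<^sup>2)"
      by (rule sum_nonneg) simp
    also have "\<dots> = 2 * (\<Sum>x\<in>carrier W. g x * (g x - g (inv\<^bsub>W\<^esub> y \<otimes>\<^bsub>W\<^esub> x)))"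
      using sum_left_mult [of "inv\<^bsub>W\<^esub> y" "\<lambda>x. (g x)\<^sup>2"] y
      by (simp add: power2_eq_square algebra_simps sum.distrib sum_subtractf sum_distrib_left)
    finally show ?thesis by simp
  qed
  have "r * (\<Sum>x\<in>carrier W. (g x)\<^sup>2) = (\<Sum>x\<in>carrier W. g x * (r * g x))"
    by (simp add: sum_distrib_left power2_eq_square mult_ac)
  also have "\<dots> = (\<Sum>x\<in>carrier W. g x * (\<Sum>h\<in>carrier W. Poly_Mapping.lookup w h * (g x - g (inv\<^bsub>W\<^esub> h \<otimes>\<^bsub>W\<^esub> x))))"
    by (simp add: eig)
  also have "\<dots> = (\<Sum>x\<in>carrier W. g x * E x)
      + (\<Sum>x\<in>carrier W. \<Sum>y\<in>carrier (power_group G n). c y * (g x * (g x - g (inv\<^bsub>W\<^esub> base_emb n y \<otimes>\<^bsub>W\<^esub> x))))"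
    unfolding sum_w by (simp add: E_def inv_\<tau> distrib_left sum.distrib sum_distrib_left mult_ac)
  also have "(\<Sum>x\<in>carrier W. \<Sum>y\<in>carrier (power_group G n). c y * (g x * (g x - g (inv\<^bsub>W\<^esub> base_emb n y \<otimes>\<^bsub>W\<^esub> x))))
      = (\<Sum>y\<in>carrier (power_group G n). c y * (\<Sum>x\<in>carrier W. g x * (g x - g (inv\<^bsub>W\<^esub> base_emb n y \<otimes>\<^bsub>W\<^esub> x))))"
    unfolding sum_distrib_left by (rule sum.swap)
  finally have 1: "(\<Sum>x\<in>carrier W. g x * E x) \<le> r * (\<Sum>x\<in>carrier W. (g x)\<^sup>2)"
    using sum_nonneg [of "carrier (power_group G n)" "\<lambda>y. c y * (\<Sum>x\<in>carrier W. g x * (g x - g (inv\<^bsub>W\<^esub> base_emb n y \<otimes>\<^bsub>W\<^esub> x)))"]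
    by (simp add: base base_emb_closed c_nonneg del: carrier_product_group)
  \<comment> \<open>Read along the orbit of \<open>y\<close>, the transposition part
    \<open>E\<close> becomes \<open>perm_lap\<close>, and \<open>zero\<close> supplies the sum
    condition of the interchange bound.\<close>
  have coset: "\<gamma> * (\<Sum>p | p permutes {1..n}. (g (sym_emb G n p \<otimes>\<^bsub>W\<^esub> y))\<^sup>2)
      \<le> (\<Sum>p | p permutes {1..n}. g (sym_emb G n p \<otimes>\<^bsub>W\<^esub> y) * E (sym_emb G n p \<otimes>\<^bsub>W\<^esub> y))" if y: "y \<in> carrier W" for y
  proof -
    let ?f = "\<lambda>p. g (sym_emb G n p \<otimes>\<^bsub>W\<^esub> y)"
    have "E (sym_emb G n p \<otimes>\<^bsub>W\<^esub> y) = perm_lap {1..n} b ?f p" if "p permutes {1..n}" for p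
      unfolding E_def perm_lap_eq
    proof (intro sum.cong refl)
      fix i j assume "i \<in> {1..n}" "j \<in> {1..n}"
      then have "\<tau> i j \<otimes>\<^bsub>W\<^esub> (sym_emb G n p \<otimes>\<^bsub>W\<^esub> y) = sym_emb G n (transpose i j \<circ> p) \<otimes>\<^bsub>W\<^esub> y"
        using that y by (simp add: W.m_assoc [symmetric] sym_emb_closed \<tau>_closed sym_emb_mult permutes_swap_id)
      then show "b i j * (g (sym_emb G n p \<otimes>\<^bsub>W\<^esub> y) - g (\<tau> i j \<otimes>\<^bsub>W\<^esub> (sym_emb G n p \<otimes>\<^bsub>W\<^esub> y)))
          = b i j * (?f p - ?f (transpose i j \<circ> p))"
        by simp
    qed
    then have "(\<Sum>p | p permutes {1..n}. ?f p * E (sym_emb G n p \<otimes>\<^bsub>W\<^esub> y)) = (\<Sum>p | p permutes {1..n}. ?f p * perm_lap {1..n} b ?f p)"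
      by simp
    moreover have "\<gamma> * (\<Sum>p | p permutes {1..n}. (?f p)\<^sup>2) \<le> (\<Sum>p | p permutes {1..n}. ?f p * perm_lap {1..n} b ?f p)"
      by (rule caputo_liggett_richthammer) (use assms(1) b_nonneg b_sym gap zero [OF y] in auto)
    ultimately show ?thesis by simp
  qed
  have "N * (\<gamma> * (\<Sum>x\<in>carrier W. (g x)\<^sup>2)) = (\<Sum>y\<in>carrier W. \<gamma> * (\<Sum>p | p permutes {1..n}. (g (sym_emb G n p \<otimes>\<^bsub>W\<^esub> y))\<^sup>2))"
    using average [of "\<lambda>x. (g x)\<^sup>2"] by (simp add: sum_distrib_left [symmetric])
  also have "\<dots> \<le> (\<Sum>y\<in>carrier W. \<Sum>p | p permutes {1..n}. g (sym_emb G n p \<otimes>\<^bsub>W\<^esub> y) * E (sym_emb G n p \<otimes>\<^bsub>W\<^esub> y))"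
    by (rule sum_mono) (rule coset)
  also have "\<dots> = N * (\<Sum>x\<in>carrier W. g x * E x)"
    by (rule average [symmetric])
  finally have "\<gamma> * (\<Sum>x\<in>carrier W. (g x)\<^sup>2) \<le> (\<Sum>x\<in>carrier W. g x * E x)"
    using N by simp
  also note 1
  finally have "\<gamma> * (\<Sum>x\<in>carrier W. (g x)\<^sup>2) \<le> r * (\<Sum>x\<in>carrier W. (g x)\<^sup>2)" .
  moreover have "0 < (\<Sum>x\<in>carrier W. (g x)\<^sup>2)"
    using nz finite_W by (intro sum_pos2 [of _ x0]) auto
  ultimately show ?thesis by simp
qed

end

section \<open>Comparing the eigenvalues of the three representations\<close>

context wreath_walk
begin

abbreviation "K \<equiv> sym_emb G n ` carrier (sym_group n)"
abbreviation "Reg \<equiv> regular_rep W"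
abbreviation "Reg0 \<equiv> sub_rep Reg (orth_compl Reg (fixed_space W Reg))"

lemma subgroup_K: "subgroup K W"
  by (rule subgroup_sym_emb) (rule group_axioms)

lemma K_closed: "K \<subseteq> carrier W"
  by (rule subgroup.subset [OF subgroup_K])

lemma eigenvalues_Reg0:
  "r \<in> eigenvalues W w Reg0 \<longleftrightarrow>
    (\<exists>f. (\<forall>x. x \<notin> carrier W \<longrightarrow> f x = 0) \<and> (\<Sum>x\<in>carrier W. f x) = 0 \<and> (\<exists>x\<in>carrier W. f x \<noteq> 0) \<and>
      (\<forall>x\<in>carrier W. (\<Sum>h\<in>carrier W. complex_of_real (Poly_Mapping.lookup w h) * (f x - f (inv\<^bsub>W\<^esub> h \<otimes>\<^bsub>W\<^esub> x)))
        = complex_of_real r * f x))"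
  unfolding regular_rep_def
  by (rule eigenvalues_orth_compl_perm_rep [OF W.group_axioms W.one_closed]) auto

lemma lcoset_mult:
  "h \<in> carrier W \<Longrightarrow> x \<in> carrier W \<Longrightarrow> (h \<otimes>\<^bsub>W\<^esub> x) <#\<^bsub>W\<^esub> K = h <#\<^bsub>W\<^esub> (x <#\<^bsub>W\<^esub> K)"
  by (simp add: W.lcos_m_assoc K_closed)

lemma lcosets_closed:
  assumes "h \<in> carrier W" "C \<in> lcosets\<^bsub>W\<^esub> K"
  shows "h <#\<^bsub>W\<^esub> C \<in> lcosets\<^bsub>W\<^esub> K"
proof -
  obtain x where "x \<in> carrier W" "C = x <#\<^bsub>W\<^esub> K"
    using assms(2) by (auto simp: LCOSETS_def)
  then show ?thesis
    using assms(1) lcoset_mult [of h x] by (auto simp: LCOSETS_def)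
qed

lemma K_lcoset: "K = \<one>\<^bsub>W\<^esub> <#\<^bsub>W\<^esub> K" "K \<in> lcosets\<^bsub>W\<^esub> K"
proof -
  show "K = \<one>\<^bsub>W\<^esub> <#\<^bsub>W\<^esub> K"
    by (rule W.lcos_mult_one [OF K_closed, symmetric])
  then show "K \<in> lcosets\<^bsub>W\<^esub> K"
    unfolding LCOSETS_def by blast
qed

lemma eigenvalues_P0:
  "r \<in> eigenvalues W w (P0_rep G n) \<longleftrightarrow>
    (\<exists>v. (\<forall>C. C \<notin> lcosets\<^bsub>W\<^esub> K \<longrightarrow> v C = 0) \<and> (\<Sum>C\<in>lcosets\<^bsub>W\<^esub> K. v C) = 0 \<and> (\<exists>C\<in>lcosets\<^bsub>W\<^esub> K. v C \<noteq> 0) \<and>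
      (\<forall>C\<in>lcosets\<^bsub>W\<^esub> K. (\<Sum>h\<in>carrier W. complex_of_real (Poly_Mapping.lookup w h) * (v C - v (inv\<^bsub>W\<^esub> h <#\<^bsub>W\<^esub> C)))
        = complex_of_real r * v C))"
  unfolding P0_rep_def P_rep_def quasi_regular_rep_def
proof (rule eigenvalues_orth_compl_perm_rep [OF W.group_axioms K_lcoset(2)])
  show "\<exists>h\<in>carrier W. h <#\<^bsub>W\<^esub> K = C" if "C \<in> lcosets\<^bsub>W\<^esub> K" for C
    using that by (auto simp: LCOSETS_def)
qed (rule lcosets_closed)

lemma sum_lcosets:
  fixes F :: "'a wreath_elt \<Rightarrow> complex"
  shows "(\<Sum>C\<in>lcosets\<^bsub>W\<^esub> K. \<Sum>x\<in>C. F x) = (\<Sum>x\<in>carrier W. F x)"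
proof -
  have "\<forall>C\<in>lcosets\<^bsub>W\<^esub> K. finite C"
    using W.lcosets_subset_PowG [OF subgroup_K] finite_W by (auto intro: finite_subset)
  moreover have "\<forall>C\<in>lcosets\<^bsub>W\<^esub> K. \<forall>D\<in>lcosets\<^bsub>W\<^esub> K. C \<noteq> D \<longrightarrow> C \<inter> D = {}"
    using W.lcos_disjoint [OF subgroup_K] by blast
  ultimately show ?thesis
    using sum.Union_disjoint [of "lcosets\<^bsub>W\<^esub> K" F] by (simp add: W.lcosets_part_G [OF subgroup_K])
qed

lemma snd_mult: "snd (x \<otimes>\<^bsub>W\<^esub> y) = snd x \<circ> snd y"
  by (simp add: wreath_def sym_group_def case_prod_unfold)

lemma snd_permutes: "x \<in> carrier W \<Longrightarrow> snd x permutes {1..n}"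
  by (auto simp: wreath_def sym_group_def)

lemma snd_sym_emb: "snd (sym_emb G n p) = p"
  by (simp add: sym_emb_def)

lemma one_in: "1 \<in> {1..n}"
  using n by simp

text \<open>The lift \<open>x \<mapsto> u (snd x 1)\<close> commutes with left translations and so
  preserves the eigenvalue.\<close>

lemma eigenvalues_std_subset: "eigenvalues W w (std_rep n) \<subseteq> eigenvalues W w Reg0"
proof
  fix r assume "r \<in> eigenvalues W w (std_rep n)"
  then obtain u where supp: "\<forall>i. i \<notin> {1..n} \<longrightarrow> u i = 0" and u0: "(\<Sum>i\<in>{1..n}. u i) = 0" and nz: "u \<noteq> 0"
    and eig: "\<forall>i\<in>{1..n}. (\<Sum>h\<in>carrier W. complex_of_real (Poly_Mapping.lookup w h) * (u i - u (inv' (snd h) i))) = complex_of_real r * u i"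
    unfolding eigenvalues_std by blast
  \<comment> \<open>\<open>Z 1\<close> is the sum of the lift. Right multiplication by
    \<open>\<tau> 1 i\<close> shows \<open>Z i = Z 1\<close>, while all \<open>Z i\<close> together
    add up to 0.\<close>
  define Z where "Z i = (\<Sum>x\<in>carrier W. u (snd x i))" for i
  have Z1: "Z i = Z 1" if "i \<in> {1..n}" for i
    using sum_right_mult [OF \<tau>_closed [OF one_in that], of "\<lambda>x. u (snd x 1)"]
    by (simp add: Z_def snd_mult snd_sym_emb)
  have "(\<Sum>i\<in>{1..n}. Z i) = (\<Sum>x\<in>carrier W. \<Sum>i\<in>{1..n}. u (snd x i))"
    unfolding Z_def by (rule sum.swap)
  also have "\<dots> = (\<Sum>x\<in>carrier W. 0)"
  proof (rule sum.cong)
    fix x assume "x \<in> carrier W"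
    then show "(\<Sum>i\<in>{1..n}. u (snd x i)) = 0"
      using sum.permute [OF snd_permutes, of x u] u0 by simp
  qed simp
  finally have "of_nat n * Z 1 = 0"
    using sum.cong [OF refl Z1, of "{1..n}"] by simp
  then have Z: "Z 1 = 0"
    using n by simp
  let ?f = "\<lambda>x. if x \<in> carrier W then u (snd x 1) else 0"
  have "(\<Sum>h\<in>carrier W. complex_of_real (Poly_Mapping.lookup w h) * (?f x - ?f (inv\<^bsub>W\<^esub> h \<otimes>\<^bsub>W\<^esub> x))) = complex_of_real r * ?f x"
    if x: "x \<in> carrier W" for x
  proof -
    have "(\<Sum>h\<in>carrier W. complex_of_real (Poly_Mapping.lookup w h) * (?f x - ?f (inv\<^bsub>W\<^esub> h \<otimes>\<^bsub>W\<^esub> x)))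
        = (\<Sum>h\<in>carrier W. complex_of_real (Poly_Mapping.lookup w h) * (u (snd x 1) - u (inv' (snd h) (snd x 1))))"
      by (rule sum.cong) (use x in \<open>simp_all add: snd_mult snd_inv\<close>)
    moreover have "snd x 1 \<in> {1..n}"
      using permutes_in_image [OF snd_permutes [OF x], of 1] one_in by simp
    ultimately show ?thesis
      using eig x by simp
  qed
  moreover have "(\<Sum>x\<in>carrier W. ?f x) = 0"
    using Z by (simp add: Z_def)
  moreover have "\<exists>x\<in>carrier W. ?f x \<noteq> 0"
  proof -
    obtain i where "u i \<noteq> 0" "i \<in> {1..n}"
      using nz supp by (auto simp: fun_eq_iff)
    then show ?thesis
      using \<tau>_closed [OF one_in, of i] by (intro bexI [of _ "\<tau> 1 i"]) (simp_all add: snd_sym_emb)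
  qed
  ultimately show "r \<in> eigenvalues W w Reg0"
    unfolding eigenvalues_Reg0 by (intro exI [of _ ?f]) simp
qed

text \<open>A function on cosets lifts to the group by \<open>x \<mapsto> v (x <# K)\<close>; sums
  are multiplied by \<open>card K\<close>, so sum zero is preserved.\<close>

lemma eigenvalues_P0_subset: "eigenvalues W w (P0_rep G n) \<subseteq> eigenvalues W w Reg0"
proof
  fix r assume "r \<in> eigenvalues W w (P0_rep G n)"
  then obtain v where v0: "(\<Sum>C\<in>lcosets\<^bsub>W\<^esub> K. v C) = 0" and nz: "\<exists>C\<in>lcosets\<^bsub>W\<^esub> K. v C \<noteq> 0"
    and eig: "\<forall>C\<in>lcosets\<^bsub>W\<^esub> K. (\<Sum>h\<in>carrier W. complex_of_real (Poly_Mapping.lookup w h) * (v C - v (inv\<^bsub>W\<^esub> h <#\<^bsub>W\<^esub> C)))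
      = complex_of_real r * v C"
    unfolding eigenvalues_P0 by blast
  have cos: "x <#\<^bsub>W\<^esub> K \<in> lcosets\<^bsub>W\<^esub> K" if "x \<in> carrier W" for x
    using that by (auto simp: LCOSETS_def)
  let ?f = "\<lambda>x. if x \<in> carrier W then v (x <#\<^bsub>W\<^esub> K) else 0"
  have "(\<Sum>h\<in>carrier W. complex_of_real (Poly_Mapping.lookup w h) * (?f x - ?f (inv\<^bsub>W\<^esub> h \<otimes>\<^bsub>W\<^esub> x))) = complex_of_real r * ?f x"
    if x: "x \<in> carrier W" for x
  proof -
    have "(\<Sum>h\<in>carrier W. complex_of_real (Poly_Mapping.lookup w h) * (?f x - ?f (inv\<^bsub>W\<^esub> h \<otimes>\<^bsub>W\<^esub> x)))
        = (\<Sum>h\<in>carrier W. complex_of_real (Poly_Mapping.lookup w h) * (v (x <#\<^bsub>W\<^esub> K) - v (inv\<^bsub>W\<^esub> h <#\<^bsub>W\<^esub> (x <#\<^bsub>W\<^esub> K))))"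
      by (rule sum.cong) (use x in \<open>simp_all add: lcoset_mult\<close>)
    then show ?thesis
      using eig cos [OF x] x by simp
  qed
  moreover have "(\<Sum>x\<in>carrier W. ?f x) = 0"
  proof -
    have "(\<Sum>x\<in>carrier W. ?f x) = (\<Sum>C\<in>lcosets\<^bsub>W\<^esub> K. \<Sum>x\<in>C. v (x <#\<^bsub>W\<^esub> K))"
      unfolding sum_lcosets by simp
    also have "\<dots> = (\<Sum>C\<in>lcosets\<^bsub>W\<^esub> K. of_nat (card K) * v C)"
    proof (rule sum.cong [OF refl])
      fix C assume C: "C \<in> lcosets\<^bsub>W\<^esub> K"
      then obtain y where y: "y \<in> carrier W" "C = y <#\<^bsub>W\<^esub> K"
        by (auto simp: LCOSETS_def)
      have "x <#\<^bsub>W\<^esub> K = C" if "x \<in> C" for x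
        using W.l_repr_independence [OF _ y(1) subgroup_K, of x] that y(2) by simp
      then show "(\<Sum>x\<in>C. v (x <#\<^bsub>W\<^esub> K)) = of_nat (card K) * v C"
        by (simp add: W.l_card_cosets_equal [OF C K_closed finite_W])
    qed
    finally show ?thesis
      by (simp add: sum_distrib_left [symmetric] v0)
  qed
  moreover have "\<exists>x\<in>carrier W. ?f x \<noteq> 0"
    using nz by (auto simp: LCOSETS_def)
  ultimately show "r \<in> eigenvalues W w Reg0"
    unfolding eigenvalues_Reg0 by (intro exI [of _ ?f]) simp
qed

text \<open>Either a right translate of the eigenvector survives summation over the left cosets of
  \<open>K\<close> and gives an eigenvector in \<open>P0_rep\<close>, or the eigenvector has sum
  zero on every orbit of \<open>K\<close> and \<open>coset_mean_zero_bound\<close> applies.\<close>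

lemma eigenvalues_Reg0_cases:
  assumes r: "r \<in> eigenvalues W w Reg0" and "0 \<le> \<gamma>"
    and gap: "\<And>u. (\<Sum>i\<in>{1..n}. u i) = 0 \<Longrightarrow>
      \<gamma> * (\<Sum>i\<in>{1..n}. (u i)\<^sup>2) \<le> (\<Sum>i\<in>{1..n}. \<Sum>j\<in>{1..n}. b i j * (u i - u j)\<^sup>2)"
  shows "r \<in> eigenvalues W w (P0_rep G n) \<or> \<gamma> \<le> r"
proof -
  obtain f where f0: "(\<Sum>x\<in>carrier W. f x) = 0" and nz: "\<exists>x\<in>carrier W. f x \<noteq> 0"
    and eig: "\<forall>x\<in>carrier W. (\<Sum>h\<in>carrier W. complex_of_real (Poly_Mapping.lookup w h) * (f x - f (inv\<^bsub>W\<^esub> h \<otimes>\<^bsub>W\<^esub> x))) = complex_of_real r * f x"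
    using r unfolding eigenvalues_Reg0 by blast
  have inj: "inj_on (sym_emb G n) {p. p permutes {1..n}}"
    by (auto simp: inj_on_def sym_emb_def)
  show ?thesis
  proof (cases "\<exists>y\<in>carrier W. (\<Sum>z\<in>K. f (z \<otimes>\<^bsub>W\<^esub> y)) \<noteq> 0")
    case True
    then obtain y where y: "y \<in> carrier W" "(\<Sum>z\<in>K. f (z \<otimes>\<^bsub>W\<^esub> y)) \<noteq> 0"
      by blast
    \<comment> \<open>Coset sums of the right translate by \<open>y\<close>. The value at
      \<open>K\<close> itself is nonzero by the choice of \<open>y\<close>.\<close>
    let ?v = "\<lambda>C. if C \<in> lcosets\<^bsub>W\<^esub> K then \<Sum>z\<in>C. f (z \<otimes>\<^bsub>W\<^esub> y) else 0"
    have "(\<Sum>C\<in>lcosets\<^bsub>W\<^esub> K. ?v C) = 0"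
      using sum_lcosets [of "\<lambda>z. f (z \<otimes>\<^bsub>W\<^esub> y)"] sum_right_mult [OF y(1), of f] f0 by simp
    moreover have "\<exists>C\<in>lcosets\<^bsub>W\<^esub> K. ?v C \<noteq> 0"
      using y K_lcoset(2) by (intro bexI [of _ K]) simp_all
    moreover have "(\<Sum>h\<in>carrier W. complex_of_real (Poly_Mapping.lookup w h) * (?v C - ?v (inv\<^bsub>W\<^esub> h <#\<^bsub>W\<^esub> C))) = complex_of_real r * ?v C"
      if C: "C \<in> lcosets\<^bsub>W\<^esub> K" for C
    proof -
      have CW: "z \<in> carrier W" if "z \<in> C" for z
        using C that W.lcosets_subset_PowG [OF subgroup_K] by blast
      have shift: "?v (inv\<^bsub>W\<^esub> h <#\<^bsub>W\<^esub> C) = (\<Sum>z\<in>C. f (inv\<^bsub>W\<^esub> h \<otimes>\<^bsub>W\<^esub> (z \<otimes>\<^bsub>W\<^esub> y)))" if h: "h \<in> carrier W" for h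
      proof -
        have "inv\<^bsub>W\<^esub> h <#\<^bsub>W\<^esub> C = (\<lambda>z. inv\<^bsub>W\<^esub> h \<otimes>\<^bsub>W\<^esub> z) ` C"
          by (auto simp: l_coset_def)
        moreover have "inj_on (\<lambda>z. inv\<^bsub>W\<^esub> h \<otimes>\<^bsub>W\<^esub> z) C"
          using CW h by (auto simp: inj_on_def)
        moreover have "inv\<^bsub>W\<^esub> h <#\<^bsub>W\<^esub> C \<in> lcosets\<^bsub>W\<^esub> K"
          using C h by (simp add: lcosets_closed)
        ultimately show ?thesis
          using h y(1) CW by (simp add: sum.reindex W.m_assoc)
      qed
      have "(\<Sum>h\<in>carrier W. complex_of_real (Poly_Mapping.lookup w h) * (?v C - ?v (inv\<^bsub>W\<^esub> h <#\<^bsub>W\<^esub> C)))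
          = (\<Sum>h\<in>carrier W. \<Sum>z\<in>C. complex_of_real (Poly_Mapping.lookup w h) * (f (z \<otimes>\<^bsub>W\<^esub> y) - f (inv\<^bsub>W\<^esub> h \<otimes>\<^bsub>W\<^esub> (z \<otimes>\<^bsub>W\<^esub> y))))"
        by (rule sum.cong [OF refl], subst shift) (simp_all add: C sum_subtractf [symmetric] sum_distrib_left)
      also have "\<dots> = (\<Sum>z\<in>C. \<Sum>h\<in>carrier W. complex_of_real (Poly_Mapping.lookup w h) * (f (z \<otimes>\<^bsub>W\<^esub> y) - f (inv\<^bsub>W\<^esub> h \<otimes>\<^bsub>W\<^esub> (z \<otimes>\<^bsub>W\<^esub> y))))"
        by (rule sum.swap)
      also have "\<dots> = (\<Sum>z\<in>C. complex_of_real r * f (z \<otimes>\<^bsub>W\<^esub> y))"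
        using eig CW y(1) by (intro sum.cong refl) simp
      finally show ?thesis
        using C by (simp add: sum_distrib_left)
    qed
    ultimately have "r \<in> eigenvalues W w (P0_rep G n)"
      unfolding eigenvalues_P0 by (intro exI [of _ ?v]) simp
    then show ?thesis ..
  next
    case False
    have zero: "(\<Sum>p | p permutes {1..n}. f (sym_emb G n p \<otimes>\<^bsub>W\<^esub> y)) = 0" if "y \<in> carrier W" for y
      using False that sum.reindex [OF inj, of "\<lambda>z. f (z \<otimes>\<^bsub>W\<^esub> y)"] by (simp add: sym_group_def)
    \<comment> \<open>The weights and \<open>r\<close> are real, so the real and the imaginary part
      of \<open>f\<close> satisfy the same equations; one of them is nonzero.\<close>
    have bound: "\<gamma> \<le> r" if "\<phi> \<in> {Re, Im}" and x0: "x0 \<in> carrier W" "\<phi> (f x0) \<noteq> 0" for \<phi> x0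
    proof (rule coset_mean_zero_bound [where g = "\<lambda>x. \<phi> (f x)", OF assms(2) gap])
      show "(\<Sum>h\<in>carrier W. Poly_Mapping.lookup w h * (\<phi> (f x) - \<phi> (f (inv\<^bsub>W\<^esub> h \<otimes>\<^bsub>W\<^esub> x)))) = r * \<phi> (f x)"
        if "x \<in> carrier W" for x
        using arg_cong [OF bspec [OF eig that], of \<phi>] that(1) \<open>\<phi> \<in> {Re, Im}\<close> by (auto simp: Re_sum Im_sum)
      show "(\<Sum>p | p permutes {1..n}. \<phi> (f (sym_emb G n p \<otimes>\<^bsub>W\<^esub> y))) = 0" if "y \<in> carrier W" for y
        using arg_cong [OF zero [OF that], of \<phi>] \<open>\<phi> \<in> {Re, Im}\<close> by (auto simp: Re_sum Im_sum)
    qed (use x0 in auto)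
    obtain x0 where x0: "x0 \<in> carrier W" "f x0 \<noteq> 0"
      using nz by blast
    then have "Re (f x0) \<noteq> 0 \<or> Im (f x0) \<noteq> 0"
      by (simp add: complex_eq_iff)
    then show ?thesis
      using bound [of Re x0] bound [of Im x0] x0(1) by auto
  qed
qed

text \<open>Invariance under \<open>\<tau> 1 i\<close> makes a fixed vector constant, and a constant
  with sum zero vanishes.\<close>

lemma fixed_space_std: "fixed_space W (std_rep n :: ('a wreath_elt, _) rep) = {0}"
proof -
  let ?V = "std_rep n :: ('a wreath_elt, nat \<Rightarrow> complex) rep"
  interpret unitary_rep W ?V
    by (rule unitary_std_rep [OF group_axioms finite_G])
  have "act ?V h 0 = 0" if "h \<in> carrier W" for h
    using that act_scl [of h 0 0] zero_vec by simp
  then have "0 \<in> fixed_space W ?V"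
    using zero_vec by (simp add: fixed_space_def)
  moreover have "u = 0" if u: "u \<in> fixed_space W ?V" for u
  proof -
    have vecs: "\<forall>i. i \<notin> {1..n} \<longrightarrow> u i = 0" "(\<Sum>i\<in>{1..n}. u i) = 0"
      using u by (simp_all add: fixed_space_def std_rep_def std_rep_sym_def pullback_rep_def sub_rep_def perm_rep_def Let_def)
    have eq: "u i = u 1" if i: "i \<in> {1..n}" for i
    proof -
      have "act ?V (\<tau> 1 i) u i = u i"
        using u \<tau>_closed [OF one_in i] by (simp add: fixed_space_def)
      moreover have "transpose 1 i \<in> carrier (sym_group n)"
        using permutes_swap_id [OF one_in i] by (simp add: sym_group_carrier)
      ultimately show ?thesis
        using i by (simp add: std_rep_def std_rep_sym_def pullback_rep_def sub_rep_def perm_rep_def Let_def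
            snd_sym_emb sym_group_inv_equality)
    qed
    have "of_nat n * u 1 = 0"
      using sum.cong [OF refl eq, of "{1..n}"] vecs(2) by simp
    then have "u 1 = 0"
      using n by simp
    then have "u i = 0" for i
      using eq [of i] vecs(1) by (cases "i \<in> {1..n}") auto
    then show "u = 0"
      by (simp add: fun_eq_iff)
  qed
  ultimately show ?thesis by blast
qed

text \<open>Both gaps are minima of finite sets of eigenvalues with
  \<open>?E2 \<subseteq> ?E1\<close>. The minimum of \<open>?E1\<close> lies in \<open>?E2\<close>
  or is at least \<gamma>, which is itself in \<open>?E2\<close>.\<close>

theorem spectral_gap_regular:
  "spectral_gap W w Reg = spectral_gap W w (std_rep n \<oplus>\<^sub>R P0_rep G n)"
proof -
  interpret Reg: unitary_rep W Reg
    by (rule unitary_regular_rep [OF W.group_axioms finite_W])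
  note Std = unitary_std_rep [OF group_axioms finite_G, of n]
  note P0 = unitary_P0_rep [OF group_axioms finite_G, of n]
  interpret P0: unitary_rep W "P0_rep G n"
    by (rule P0)
  let ?E1 = "eigenvalues W w Reg0"
  let ?E2 = "eigenvalues W w (std_rep n \<oplus>\<^sub>R P0_rep G n)"
  have E2: "?E2 = eigenvalues W w (std_rep n) \<union> eigenvalues W w (P0_rep G n)"
    by (rule eigenvalues_direct_sum [OF Std P0])
  obtain \<gamma> where \<gamma>: "\<gamma> \<in> eigenvalues W w (std_rep n)" "0 \<le> \<gamma>"
    "\<And>u. (\<Sum>i\<in>{1..n}. u i) = 0 \<Longrightarrow> \<gamma> * (\<Sum>i\<in>{1..n}. (u i)\<^sup>2) \<le> (\<Sum>i\<in>{1..n}. \<Sum>j\<in>{1..n}. b i j * (u i - u j)\<^sup>2)"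
    by (rule std_min_eigenvalue) (rule that)
  have sub: "?E2 \<subseteq> ?E1"
    unfolding E2 using eigenvalues_std_subset eigenvalues_P0_subset by blast
  have fin: "finite ?E1"
  proof (rule finite_subset)
    show "?E1 \<subseteq> eigenvalues W w Reg"
      unfolding eigenvalues_def laplacian_sub_rep by (auto simp: sub_rep_def orth_compl_def)
    show "finite (eigenvalues W w Reg)"
      unfolding eigenvalues_def by (rule Reg.finite_eigenvalues) (rule lookup_w_inv)
  qed
  have ne: "?E2 \<noteq> {}" "\<gamma> \<in> ?E2" "\<gamma> \<in> ?E1"
    using \<gamma>(1) sub E2 by auto
  have "Min ?E1 = Min ?E2"
  proof (rule antisym)
    show "Min ?E1 \<le> Min ?E2"
      using sub ne(1) fin by (rule Min_antimono)
    have "Min ?E1 \<in> ?E1"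
      using fin ne by (intro Min_in) auto
    then consider "Min ?E1 \<in> ?E2" | "\<gamma> \<le> Min ?E1"
      using eigenvalues_Reg0_cases [OF _ \<gamma>(2,3)] E2 by blast
    then show "Min ?E2 \<le> Min ?E1"
    proof cases
      case 1
      then show ?thesis
        using fin sub by (intro Min_le) (auto intro: finite_subset)
    next
      case 2
      moreover have "Min ?E2 \<le> \<gamma>"
        using fin sub ne(2) by (intro Min_le) (auto intro: finite_subset)
      ultimately show ?thesis by simp
    qed
  qed
  moreover have "spectral_gap W w Reg = ereal (Min ?E1)"
  proof (rule spectral_gap_eq_Min)
    obtain v where v: "v \<in> orth_compl Reg (fixed_space W Reg)" "v \<noteq> 0"
      using ne(3) by (auto simp: eigenvalues_def sub_rep_def)
    show "vecs Reg \<noteq> fixed_space W Reg"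
    proof
      assume "vecs Reg = fixed_space W Reg"
      then show False
        using v Reg.ip_self_eq_0 [of v] by (auto simp: orth_compl_def)
    qed
  qed
  moreover have "spectral_gap W w (std_rep n \<oplus>\<^sub>R P0_rep G n) = ereal (Min ?E2)"
  proof -
    obtain u where u: "u \<in> vecs (std_rep n :: ('a wreath_elt, _) rep)" "u \<noteq> 0"
      using \<gamma>(1) by (auto simp: eigenvalues_def)
    have "fixed_space W (std_rep n \<oplus>\<^sub>R P0_rep G n) = {0}"
      unfolding fixed_space_direct_sum fixed_space_std
      using fixed_space_orth_compl_fixed [OF unitary_quasi_regular_rep [OF W.group_axioms finite_W subgroup_K]]
      by (simp add: P0_rep_def P_rep_def zero_prod_def)
    moreover have "(u, 0) \<in> vecs (std_rep n \<oplus>\<^sub>R P0_rep G n)"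
      using u P0.zero_vec by (simp add: direct_sum_rep_def)
    ultimately show ?thesis
      by (rule spectral_gap_no_fixed [OF unitary_direct_sum_rep [OF Std P0]]) (simp add: u zero_prod_def)
  qed
  ultimately show ?thesis by simp
qed

end

theorem theorem1p1:
  fixes G :: "('a, 'b) monoid_scheme"
    and n :: nat
    and a :: "nat \<Rightarrow> nat \<Rightarrow> real"
    and c :: "(nat \<Rightarrow> 'a) \<Rightarrow> real"
    and w :: "'a wreath_elt \<Rightarrow>\<^sub>0 real"
  assumes "group G" and "finite (carrier G)" and "n \<ge> 2"
    and "\<And>i j. \<lbrakk>1 \<le> i; i < j; j \<le> n\<rbrakk> \<Longrightarrow> a i j \<ge> 0"
    and "\<And>g. g \<in> carrier (power_group G n) \<Longrightarrow> c g \<ge> 0"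
    and "\<And>g. g \<in> carrier (power_group G n) \<Longrightarrow> c g = c (inv\<^bsub>power_group G n\<^esub> g)"
    and "w = (\<Sum>(i, j)\<in>{(i, j). 1 \<le> i \<and> i < j \<and> j \<le> n}.
                Poly_Mapping.single (sym_emb G n (Transposition.transpose i j)) (a i j))
           + (\<Sum>g\<in>carrier (power_group G n). Poly_Mapping.single (base_emb n g) (c g))"
  shows "spectral_gap (wreath G n) w (regular_rep (wreath G n))
       = spectral_gap (wreath G n) w (std_rep n \<oplus>\<^sub>R P0_rep G n)"
proof -
  interpret wreath_walk G n a c w
    by (rule wreath_walk.intro [OF assms(1) wreath_walk_axioms.intro]) (fact assms)+
  show ?thesis
    by (rule spectral_gap_regular)
qed

end
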